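(* Let $m\ge3$, $\rho=\frac12+\frac1m$ and $\delta>0$ small. Uniformly for $a$ in any compact subset of $\mathbb C^m$, as $\lambda\to\infty$ in the sector $\pi-\frac{4\pi}{m+2}+\delta\le\arg\lambda\le\pi+\frac{4\pi}{m+2}-\delta$, $$\mathcal W_{-1,1}(a,\lambda)=2i\exp\bigl[L(G^{-1}(a),\omega^{-2}\lambda)+L(G(a),\omega^{-m}\lambda)+O(\lambda^{-\rho})\bigr],$$ $$f(0,a,\lambda)=\omega^{\frac12+\mu(G^{-1}(a))}\lambda^{-\frac14}e^{-L(G^{-1}(a),\omega^{-2}\lambda)+O(\lambda^{-\rho})}-i\,\omega^{\frac12+\mu(a)}\lambda^{-\frac14}e^{-L(G(a),\omega^{-m}\lambda)+O(\lambda^{-\rho})},$$ $$f'(0,a,\lambda)=\omega^{\frac12+\mu(G^{-1}(a))}\lambda^{\frac14}e^{-L(G^{-1}(a),\omega^{-2}\lambda)+O(\lambda^{-\rho})}+i\,\omega^{\frac12+\mu(a)}\lambda^{\frac14}e^{-L(G(a),\omega^{-m}\lambda)+O(\lambda^{-\rho})}.$$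
   Context: For $a=(a_1,\dots,a_m)\in\mathbb C^m$ let $P(z)=a_1z^{m-1}+\dots+a_m$; $b_{j,k}(a)$ ($j\ge1$, $1\le k\le j$) is the coefficient of $z^{mk-j}$ in $\binom{1/2}{k}P(z)^k$, $b_j(a)=\sum_{k=1}^jb_{j,k}(a)$, $\nu(a)=0$ for $m$ odd, $\nu(a)=b_{\frac m2+1}(a)$ for $m$ even, $\mu(a)=\frac m4-\nu(a)$, and $F(z,a,\lambda)=\frac{2}{m+2}z^{\frac{m+2}2}+\sum_{1\le j<\frac{m+2}2}\frac{2}{m+2-2j}b_j(a)z^{\frac12(m+2-2j)}$. $f(z,a,\lambda)$ is Sibuya's solution of $-y''+(z^m+P(z)+\lambda)y=0$: entire in $(z,a,\lambda)$, with $f=z^{\mu(a)-\frac m2}(1+O(z^{-1/2}))e^{-F(z,a,\lambda)}$ and $f'=-z^{\mu(a)}(1+O(z^{-1/2}))e^{-F(z,a,\lambda)}$ as $z\to\infty$ in $|\arg z|\le\frac{3\pi}{m+2}-\varepsilon$, every $\varepsilon>0$; $f'=\partial_zf$. $L(a,\lambda)=\int_0^\infty\bigl(\sqrt{x^m+P(x)+\lambda}-x^{m/2}-\sum_{j=1}^{\lfloor(m+1)/2\rfloor}b_j(a)x^{\frac m2-j}-\frac{\nu(a)}{x+1}\bigr)dx$ (principal root), for $|\lambda|$ large with $|\arg\lambda|\le\pi-\delta$. $\omega=e^{2\pi i/(m+2)}$ and $\omega^s:=e^{2\pi is/(m+2)}$ for real $s$; $G^{\ell}(a)=(\omega^{-\ell}a_1,\omega^{-2\ell}a_2,\dots,\omega^{-m\ell}a_m)$,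 $G=G^1$. $f_k(z,a,\lambda)=f(\omega^{-k}z,G^k(a),\omega^{2k}\lambda)$ and $\mathcal W_{j,\ell}=f_jf_\ell'-f_j'f_\ell$ (independent of $z$). In the sector considered, $\omega^{-2}\lambda$ and $\omega^{-m}\lambda$ have arguments in $[-\pi+\delta,\pi-\delta]$ and $L$ is evaluated there; $\lambda^{\pm1/4}=|\lambda|^{\pm1/4}e^{\pm i\arg(\lambda)/4}$ with $\arg\lambda$ taken in the stated interval. *)

theory Defs
  imports "HOL-Analysis.Analysis" "HOL-Computational_Algebra.Polynomial"
begin

text \<open>Coefficient vector a = (a_1,...,a_m) is represented by a function a :: nat => complex,
  only the values a 1, ..., a m matter.\<close>

definition Pfun :: "nat \<Rightarrow> (nat \<Rightarrow> complex) \<Rightarrow> complex \<Rightarrow> complex" where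
  "Pfun m a z = (\<Sum>j=1..m. a j * z ^ (m - j))"

definition Ppoly :: "nat \<Rightarrow> (nat \<Rightarrow> complex) \<Rightarrow> complex poly" where
  "Ppoly m a = (\<Sum>j=1..m. monom (a j) (m - j))"

definition bjk :: "nat \<Rightarrow> (nat \<Rightarrow> complex) \<Rightarrow> nat \<Rightarrow> nat \<Rightarrow> complex" where
  "bjk m a j k = (if j \<le> m * k
      then ((1/2::complex) gchoose k) * coeff (Ppoly m a ^ k) (m * k - j) else 0)"

definition bj :: "nat \<Rightarrow> (nat \<Rightarrow> complex) \<Rightarrow> nat \<Rightarrow> complex" where
  "bj m a j = (\<Sum>k=1..j. bjk m a j k)"

definition nu :: "nat \<Rightarrow> (nat \<Rightarrow> complex) \<Rightarrow> complex" where
  "nu m a = (if odd m then 0 else bj m a (m div 2 + 1))"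

definition mu :: "nat \<Rightarrow> (nat \<Rightarrow> complex) \<Rightarrow> complex" where
  "mu m a = of_real (real m / 4) - nu m a"

definition Ffun :: "nat \<Rightarrow> (nat \<Rightarrow> complex) \<Rightarrow> complex \<Rightarrow> complex" where
  "Ffun m a z = of_real (2 / (real m + 2)) * z powr (of_real ((real m + 2) / 2))
     + (\<Sum>j\<in>{j. 1 \<le> j \<and> real j < (real m + 2) / 2}.
          of_real (2 / (real m + 2 - 2 * real j)) * bj m a j
          * z powr (of_real ((real m + 2 - 2 * real j) / 2)))"

definition sibuya_sector :: "nat \<Rightarrow> real \<Rightarrow> complex set" where
  "sibuya_sector m \<epsilon> = {z. z \<noteq> 0 \<and> \<bar>Arg z\<bar> \<le> 3 * pi / (real m + 2) - \<epsilon>}"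

text \<open>Sibuya's solution: the (unique) entire solution of -y''+(z^m+P(z)+lambda)y=0 with the
  stated asymptotics of y and y' in every sector |arg z| <= 3pi/(m+2)-eps.\<close>
definition is_sibuya_sol :: "nat \<Rightarrow> (nat \<Rightarrow> complex) \<Rightarrow> complex \<Rightarrow> (complex \<Rightarrow> complex) \<Rightarrow> bool" where
  "is_sibuya_sol m a lam y \<longleftrightarrow>
     y holomorphic_on UNIV \<and>
     (\<forall>z. deriv (deriv y) z = (z ^ m + Pfun m a z + lam) * y z) \<and>
     (\<forall>\<epsilon>>0. \<exists>C R. \<forall>z\<in>sibuya_sector m \<epsilon>. norm z \<ge> R \<longrightarrow>
        norm (y z / (z powr (mu m a - of_real (real m / 2)) * exp (- Ffun m a z)) - 1)
          \<le> C * norm z powr (-1/2) \<and>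
        norm (deriv y z / (- (z powr (mu m a)) * exp (- Ffun m a z)) - 1)
          \<le> C * norm z powr (-1/2))"

definition sibuya :: "nat \<Rightarrow> complex \<Rightarrow> (nat \<Rightarrow> complex) \<Rightarrow> complex \<Rightarrow> complex" where
  "sibuya m z a lam = (SOME y. is_sibuya_sol m a lam y) z"

definition sibuya' :: "nat \<Rightarrow> complex \<Rightarrow> (nat \<Rightarrow> complex) \<Rightarrow> complex \<Rightarrow> complex" where
  "sibuya' m z a lam = deriv (\<lambda>w. sibuya m w a lam) z"

definition Lfun :: "nat \<Rightarrow> (nat \<Rightarrow> complex) \<Rightarrow> complex \<Rightarrow> complex" where
  "Lfun m a lam = integral {0..} (\<lambda>x::real.
      csqrt (of_real x ^ m + Pfun m a (of_real x) + lam)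
      - of_real (x powr (real m / 2))
      - (\<Sum>j=1..(m + 1) div 2. bj m a j * of_real (x powr (real m / 2 - real j)))
      - nu m a / (of_real x + 1))"

definition omega_pow :: "nat \<Rightarrow> complex \<Rightarrow> complex" where
  "omega_pow m s = exp (2 * of_real pi * \<i> * s / (of_nat m + 2))"

definition Gpow :: "nat \<Rightarrow> int \<Rightarrow> (nat \<Rightarrow> complex) \<Rightarrow> (nat \<Rightarrow> complex)" where
  "Gpow m l a = (\<lambda>j. omega_pow m (of_int (- (int j * l))) * a j)"

definition fk :: "nat \<Rightarrow> int \<Rightarrow> complex \<Rightarrow> (nat \<Rightarrow> complex) \<Rightarrow> complex \<Rightarrow> complex" where
  "fk m k z a lam = sibuya m (omega_pow m (of_int (- k)) * z) (Gpow m k a)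
                       (omega_pow m (of_int (2 * k)) * lam)"

text \<open>Wronskian W_{j,l} = f_j f_l' - f_j' f_l (z-independent), evaluated at z = 0.\<close>
definition Wr :: "nat \<Rightarrow> int \<Rightarrow> int \<Rightarrow> (nat \<Rightarrow> complex) \<Rightarrow> complex \<Rightarrow> complex" where
  "Wr m j l a lam = fk m j 0 a lam * deriv (\<lambda>z. fk m l z a lam) 0
                    - deriv (\<lambda>z. fk m j z a lam) 0 * fk m l 0 a lam"

end

theory Submission
  imports Defs "HOL-Complex_Analysis.Weierstrass_Factorization"
    "HOL-Computational_Algebra.Polynomial_FPS"
begin

text \<open>
  Write a solution as \<open>y = E (\<alpha> + \<beta>)\<close>, where \<open>E = exp (- \<integral> w) / sqrt w\<close> is a Liouville-Green
  function and \<open>\<beta>\<close> the component along the growing solution. Along any path on which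
  \<open>Re (\<integral> w)\<close> increases, \<open>\<alpha>\<close> and \<open>\<beta>\<close> at the initial point are controlled by their values at the
  end point and by the integral of an error function \<open>\<phi>\<close>.

  With \<open>w\<close> the truncated expansion of the square root of the potential, such paths, straight in
  the variable \<open>z powr ((m + 2) / 2)\<close>, carry the asymptotics from one ray to a sector around it; a
  compactness argument on the positive axis then yields Sibuya's solution. With \<open>w\<close> the exact square
  root, the positive axis itself gives \<open>f(0)\<close> and \<open>f'(0)\<close> up to a factor \<open>exp (O(\<lambda> powr - \<rho>))\<close> for
  \<open>\<lambda>\<close> away from the negative axis. The sector around the negative axis is reached through the
  linear relation between three neighbouring solutions, whose coefficients are Wronskians; those of
  adjacent solutions are constants read off from the asymptotics on a
  common ray.
\<close>

section \<open>Entire solutions of linear second order equations\<close>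

text \<open>For \<open>lam\<close> near the negative axis the potential has zeros close to the
  positive z-axis, and the path from infinity to 0 is lost; hence the detour through the solutions
  with indices -1 and 1. Their parameters are \<open>lam\<close> times \<omega>^(-2) and times
  \<omega>^2 = \<omega>^(-m), and these lie in the good sector exactly for the stated range of the
  argument. The Wronskian of these two solutions cannot be read off at infinity, since both grow on
  the rays that their sectors share. It is computed from their values at 0, where its two products
  have the same phase, so that they reinforce each other and the error stays a factor
  \<open>exp (O(...))\<close>. The exponent \<rho> is a matter of scaling: \<lambda> and x^m balance
  at x = |\<lambda>|^(1/m), and the error integral over the axis has the size of this length to the
  power -(m/2 + 1). The choice operator in \<open>sibuya\<close> makes existence an obligation of
  the proof; afterwards only the asymptotics in \<open>is_sibuya_sol\<close> are used.\<close>

fun ode_coeff :: "complex poly \<Rightarrow> complex \<Rightarrow> complex \<Rightarrow> nat \<Rightarrow> complex" where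
  "ode_coeff q u v 0 = u"
| "ode_coeff q u v (Suc 0) = v"
| "ode_coeff q u v (Suc (Suc n)) =
     (\<Sum>k\<le>n. coeff q k * ode_coeff q u v (n - k)) / (of_nat (n + 1) * of_nat (n + 2))"

text \<open>The divisor \<open>(n + 1) * (n + 2)\<close> in the recursion eventually exceeds any
  constant built from \<open>q\<close> and \<open>r\<close>, so from some index on no term can
  exceed the largest earlier one. As \<open>r\<close> is arbitrary, the power series is
  entire.\<close>

lemma ode_coeff_bounded:
  assumes r: "r > 0"
  shows "\<exists>K. \<forall>n. norm (ode_coeff q u v n) * r ^ n \<le> K"
proof -
  define c where "c = ode_coeff q u v"
  \<comment> \<open>Multiplied by \<open>r ^ n\<close>, the recursion bounds a term by
    \<open>S / M\<close> times a bound of the earlier ones; beyond \<open>N\<close> this quotient is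
    at most 1. The start up to \<open>N + 1\<close> is covered by the sum \<open>K\<close>.\<close>
  define S where "S = (\<Sum>k\<le>degree q. norm (coeff q k) * r ^ (k + 2))"
  define N where "N = nat \<lceil>S\<rceil>"
  define K where "K = (\<Sum>i\<le>N+1. norm (c i) * r ^ i)"
  have K0: "K \<ge> 0" unfolding K_def using r by (intro sum_nonneg) auto
  have Sk: "(\<Sum>j\<le>k. norm (coeff q j) * r ^ (j + 2)) \<le> S" for k
  proof -
    have "(\<Sum>j\<le>k. norm (coeff q j) * r ^ (j + 2)) \<le> (\<Sum>j\<le>max k (degree q). norm (coeff q j) * r ^ (j + 2))"
      using r by (intro sum_mono2) auto
    also have "\<dots> = S"
      unfolding S_def by (rule sum.mono_neutral_right) (auto simp: coeff_eq_0)
    finally show ?thesis .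
  qed
  have "norm (c n) * r ^ n \<le> K" for n
  proof (induction n rule: less_induct)
    case (less n)
    show ?case
    proof (cases "n \<le> N + 1")
      case True
      thus ?thesis unfolding K_def
        using r by (intro member_le_sum[of n "{..N+1}" "\<lambda>i. norm (c i) * r ^ i"]) auto
    next
      case False
      then obtain k where n: "n = Suc (Suc k)" and k: "k \<ge> N"
        by (metis Suc_eq_plus1 Suc_le_mono not_less_eq_eq not0_implies_Suc le0)
      define M where "M = real (k + 1) * real (k + 2)"
      have M: "M > 0" unfolding M_def by simp
      have "S \<le> real k" using k unfolding N_def by linarith
      also have "\<dots> \<le> M"
        unfolding M_def by (simp add: algebra_simps)
      finally have SM: "S \<le> M" .
      have "norm (c n) * r ^ n = norm (\<Sum>j\<le>k. coeff q j * c (k - j)) * r ^ (k + 2) / M"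
        unfolding n c_def M_def by (simp add: norm_divide norm_mult del: of_nat_Suc of_nat_add)
      also have "\<dots> \<le> (\<Sum>j\<le>k. norm (coeff q j * c (k - j))) * r ^ (k + 2) / M"
        using M r by (intro divide_right_mono mult_right_mono norm_sum) auto
      also have "(\<Sum>j\<le>k. norm (coeff q j * c (k - j))) * r ^ (k + 2) =
                 (\<Sum>j\<le>k. (norm (coeff q j) * r ^ (j + 2)) * (norm (c (k - j)) * r ^ (k - j)))"
        unfolding sum_distrib_right
      proof (rule sum.cong, simp)
        fix j assume "j \<in> {..k}"
        hence "k + 2 = (j + 2) + (k - j)" by auto
        hence "r ^ (k + 2) = r ^ (j + 2) * r ^ (k - j)" by (metis power_add)
        thus "norm (coeff q j * c (k - j)) * r ^ (k + 2) =
          (norm (coeff q j) * r ^ (j + 2)) * (norm (c (k - j)) * r ^ (k - j))"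
          by (simp add: norm_mult)
      qed
      also have "\<dots> / M \<le> (\<Sum>j\<le>k. (norm (coeff q j) * r ^ (j + 2)) * K) / M"
        using M r n by (intro divide_right_mono sum_mono mult_left_mono less) auto
      also have "\<dots> \<le> S * K / M"
        unfolding sum_distrib_right[symmetric] using M K0 Sk by (intro divide_right_mono mult_right_mono) auto
      also have "\<dots> \<le> K"
        using SM M K0 by (simp add: divide_le_eq mult.commute mult_left_mono)
      finally show ?thesis .
    qed
  qed
  thus ?thesis unfolding c_def by blast
qed

lemma entire_solution_exists:
  "\<exists>y. y holomorphic_on UNIV \<and> (\<forall>z. deriv (deriv y) z = poly q z * y z) \<and> y 0 = u \<and> deriv y 0 = v"
proof -
  define f where "f = Abs_fps (ode_coeff q u v)"
  have "conv_radius (ode_coeff q u v) \<ge> \<infinity>"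
  proof (rule conv_radius_geI_ex')
    fix r :: real assume r: "0 < r"
    \<comment> \<open>Boundedness at radius \<open>2 * r\<close> leaves a geometric series of ratio
      1/2 at radius \<open>r\<close>.\<close>
    obtain K where K: "norm (ode_coeff q u v n) * (2 * r) ^ n \<le> K" for n
      using ode_coeff_bounded[of "2 * r" q u v] r by (metis mult_pos_pos zero_less_numeral)
    show "summable (\<lambda>n. ode_coeff q u v n * of_real r ^ n)"
    proof (rule summable_comparison_test')
      show "summable (\<lambda>n. K * (1/2) ^ n :: real)" by (intro summable_mult summable_geometric) simp
      fix n
      have "norm (ode_coeff q u v n * of_real r ^ n) = norm (ode_coeff q u v n) * (2 * r) ^ n * (1/2)^n"
        using r by (simp add: norm_mult norm_power power_mult_distrib power_one_over)
      also have "\<dots> \<le> K * (1/2) ^ n"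
        by (intro mult_right_mono K) auto
      finally show "norm (ode_coeff q u v n * of_real r ^ n) \<le> K * (1/2) ^ n" .
    qed
  qed
  hence rf: "fps_conv_radius f = \<infinity>" unfolding f_def fps_conv_radius_def by simp
  hence rd: "fps_conv_radius (fps_deriv f) = \<infinity>" using fps_conv_radius_deriv[of f] by simp
  have ode: "fps_deriv (fps_deriv f) = fps_of_poly q * f"
  proof (rule fps_ext)
    fix n
    have "(\<Sum>i = 0..n. coeff q i * ode_coeff q u v (n - i)) = (\<Sum>i\<le>n. coeff q i * ode_coeff q u v (n - i))"
      by (simp add: atLeast0AtMost)
    thus "fps_nth (fps_deriv (fps_deriv f)) n = fps_nth (fps_of_poly q * f) n"
      unfolding f_def by (simp add: fps_mult_nth field_simps del: of_nat_Suc)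
  qed
  define y where "y = eval_fps f"
  have d: "deriv y = eval_fps (fps_deriv f)"
    unfolding y_def by (rule ext) (simp add: eval_fps_deriv rf)
  have dd: "deriv (deriv y) z = poly q z * y z" for z
  proof -
    have "deriv (deriv y) z = eval_fps (fps_deriv (fps_deriv f)) z"
      unfolding d by (simp add: eval_fps_deriv rd)
    thus ?thesis unfolding ode y_def by (simp add: eval_fps_mult rf)
  qed
  have "y holomorphic_on UNIV" unfolding y_def by (intro holomorphic_on_eval_fps) (auto simp: rf)
  moreover have "y 0 = u" unfolding y_def by (simp add: eval_fps_at_0 f_def)
  moreover have "deriv y 0 = v" unfolding d by (simp add: eval_fps_at_0 f_def)
  ultimately show ?thesis using dd by blast
qed

lemma entire_derivs:
  assumes "y holomorphic_on UNIV"
  shows "(y has_field_derivative deriv y z) (at z)"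
    and "(deriv y has_field_derivative deriv (deriv y) z) (at z)"
  using assms holomorphic_deriv[OF assms open_UNIV] holomorphic_derivI open_UNIV by blast+

lemma wronskian_constant:
  assumes "y1 holomorphic_on UNIV" "y2 holomorphic_on UNIV"
    and "\<And>z. deriv (deriv y1) z = Q z * y1 z" "\<And>z. deriv (deriv y2) z = Q z * y2 z"
  shows "y1 z * deriv y2 z - deriv y1 z * y2 z = y1 0 * deriv y2 0 - deriv y1 0 * y2 0"
proof -
  note d = entire_derivs[OF assms(1)] entire_derivs[OF assms(2)]
  have "\<exists>c. \<forall>x\<in>UNIV. y1 x * deriv y2 x - deriv y1 x * y2 x = c"
  proof (rule has_field_derivative_zero_constant)
    fix x :: complex
    show "((\<lambda>x. y1 x * deriv y2 x - deriv y1 x * y2 x) has_field_derivative 0) (at x within UNIV)"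
      by (rule derivative_eq_intros d refl)+ (simp add: assms(3,4))
  qed simp
  thus ?thesis by auto
qed

section \<open>An a priori estimate for the diagonalised system\<close>

text \<open>The equation for \<open>\<beta>\<close> is unstable forwards but stable backwards, so
  both components are estimated from the end point \<open>t\<close>. \<open>K\<close> is an
  antiderivative of a majorant of \<open>\<phi>\<close>; the smallness of its increment allows the
  unknown maximum of \<open>\<alpha> + \<beta>\<close> to be absorbed.\<close>

lemma wkb_apriori:
  fixes \<alpha> \<beta> w \<phi> \<xi> :: "real \<Rightarrow> complex" and K k :: "real \<Rightarrow> real"
  assumes st: "s \<le> t"
    and da: "\<And>x. x \<in> {s..t} \<Longrightarrow> (\<alpha> has_vector_derivative - \<phi> x * (\<alpha> x + \<beta> x) / 2) (at x)"
    and db: "\<And>x. x \<in> {s..t} \<Longrightarrow> (\<beta> has_vector_derivative 2 * w x * \<beta> x + \<phi> x * (\<alpha> x + \<beta> x) / 2) (at x)"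
    and dxi: "\<And>x. x \<in> {s..t} \<Longrightarrow> (\<xi> has_vector_derivative w x) (at x)"
    and w: "\<And>x. x \<in> {s..t} \<Longrightarrow> Re (w x) \<ge> 0"
    and dK: "\<And>x. x \<in> {s..t} \<Longrightarrow> (K has_real_derivative k x) (at x)"
    and phi: "\<And>x. x \<in> {s..t} \<Longrightarrow> norm (\<phi> x) \<le> k x"
    and small: "K t - K s \<le> 1/2"
  shows "norm (\<alpha> s - \<alpha> t) \<le> (norm (\<alpha> t) + norm (\<beta> t)) * (K t - K s)"
    and "norm (\<beta> s) \<le> norm (\<beta> t) + (norm (\<alpha> t) + norm (\<beta> t)) * (K t - K s)"
proof -
  define g where "g = (\<lambda>x. \<alpha> x + \<beta> x)"
  have ca: "continuous_on {s..t} \<alpha>" and cb: "continuous_on {s..t} \<beta>" and cK: "continuous_on {s..t} K"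
    and cxi: "continuous_on {s..t} \<xi>"
    by (meson da db dxi dK has_vector_derivative_continuous DERIV_isCont continuous_at_imp_continuous_on)+
  have dKv: "(K has_vector_derivative k x) (at x)" if "x \<in> {s..t}" for x
    using dK[OF that] by (simp add: has_real_derivative_iff_has_vector_derivative)
  have cg: "continuous_on {s..t} (\<lambda>x. norm (g x))"
    unfolding g_def by (intro continuous_intros ca cb)
  \<comment> \<open>The maximum \<open>M\<close> replaces a Gronwall argument:
    \<open>\<alpha>\<close> and \<open>\<beta>\<close> are bounded through \<open>M\<close>, and
    \<open>M\<close> in turn through the end values.\<close>
  obtain x0 where x0: "x0 \<in> {s..t}" and mx: "\<And>x. x \<in> {s..t} \<Longrightarrow> norm (g x) \<le> norm (g x0)"
    using continuous_attains_sup[OF compact_Icc _ cg] st by auto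
  define M where "M = norm (g x0)"
  have M0: "M \<ge> 0" unfolding M_def by simp
  have kn: "k x \<ge> 0" if "x \<in> {s..t}" for x
    using phi[OF that] norm_ge_zero order_trans by blast
  have pg: "norm (\<phi> x * g x / 2) \<le> k x * (M / 2)" if "x \<in> {s..t}" for x
    using mult_mono[OF phi[OF that] mx[OF that] kn[OF that]] unfolding M_def by (simp add: norm_mult)
  have A: "norm (\<alpha> t - \<alpha> x) \<le> (K t - K x) * (M / 2)" if x: "x \<in> {s..t}" for x
  proof (cases "x = t")
    case False
    have "norm (\<alpha> t - \<alpha> x) \<le> K t * (M / 2) - K x * (M / 2)"
    proof (rule differentiable_bound_general[where f' = "\<lambda>u. - \<phi> u * g u / 2" and \<phi>' = "\<lambda>u. k u * (M/2)"])
      show "continuous_on {x..t} \<alpha>" using ca x by (auto intro: continuous_on_subset)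
      show "continuous_on {x..t} (\<lambda>u. K u * (M / 2))" using cK x by (auto intro!: continuous_intros intro: continuous_on_subset)
    next
      fix u assume u: "x < u" "u < t"
      show "(\<alpha> has_vector_derivative - \<phi> u * g u / 2) (at u)" using da[of u] u x by (simp add: g_def)
      show "((\<lambda>u. K u * (M / 2)) has_vector_derivative k u * (M / 2)) (at u)"
        using dKv[of u] u x by (auto intro!: derivative_eq_intros)
      show "norm (- \<phi> u * g u / 2) \<le> k u * (M / 2)" using pg[of u] u x by simp
    qed (use x False in auto)
    thus ?thesis by (simp add: algebra_simps)
  qed auto
  have xim: "Re (\<xi> x) \<le> Re (\<xi> u)" if "x \<in> {s..t}" "u \<in> {s..t}" "x \<le> u" for x u
  proof (rule DERIV_nonneg_imp_nondecreasing[OF that(3)])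
    fix v assume "x \<le> v" "v \<le> u"
    hence v: "v \<in> {s..t}" using that by auto
    have "((\<lambda>v. Re (\<xi> v)) has_vector_derivative Re (w v)) (at v)"
      using bounded_linear.has_vector_derivative[OF bounded_linear_Re dxi[OF v]] .
    thus "\<exists>y. ((\<lambda>v. Re (\<xi> v)) has_real_derivative y) (at v) \<and> 0 \<le> y"
      using w[OF v] by (auto simp: has_real_derivative_iff_has_vector_derivative)
  qed
  have B: "norm (\<beta> x) \<le> norm (\<beta> t) + (K t - K x) * (M / 2)" if x: "x \<in> {s..t}" for x
  proof (cases "x = t")
    case False
    \<comment> \<open>Integrating factor based at \<open>x\<close>. To the right of \<open>x\<close>
      its modulus is at most 1 because \<open>Re (\<xi> u)\<close> increases, so the forcing term is
      not amplified.\<close>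
    define e where "e = (\<lambda>u. exp (-2 * (\<xi> u - \<xi> x)))"
    have de: "(e has_vector_derivative -2 * w u * e u) (at u)" if "u \<in> {s..t}" for u
    proof -
      have "((exp \<circ> (\<lambda>u. -2 * (\<xi> u - \<xi> x))) has_vector_derivative (-2 * w u) * exp (-2 * (\<xi> u - \<xi> x))) (at u)"
        by (rule field_vector_diff_chain_at)
           (auto intro!: derivative_eq_intros dxi[OF that] has_vector_derivative_mult_right
             has_vector_derivative_diff_const)
      thus ?thesis unfolding e_def o_def .
    qed
    have ne: "norm (e u) \<le> 1" if "u \<in> {s..t}" "x \<le> u" for u
      using xim[OF x that] unfolding e_def by simp
    have "norm (e t * \<beta> t - e x * \<beta> x) \<le> K t * (M / 2) - K x * (M / 2)"
    proof (rule differentiable_bound_general[where f = "\<lambda>u. e u * \<beta> u" and f' = "\<lambda>u. e u * (\<phi> u * g u / 2)" and \<phi>' = "\<lambda>u. k u * (M/2)"])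
      have "continuous_on {s..t} e"
        by (meson de has_vector_derivative_continuous continuous_at_imp_continuous_on)
      thus "continuous_on {x..t} (\<lambda>u. e u * \<beta> u)" using cb x
        by (auto intro!: continuous_intros intro: continuous_on_subset)
      show "continuous_on {x..t} (\<lambda>u. K u * (M / 2))" using cK x by (auto intro!: continuous_intros intro: continuous_on_subset)
    next
      fix u assume u: "x < u" "u < t"
      hence us: "u \<in> {s..t}" using x by auto
      show "((\<lambda>u. e u * \<beta> u) has_vector_derivative e u * (\<phi> u * g u / 2)) (at u)"
        using has_vector_derivative_mult[OF de[OF us] db[OF us]] by (simp add: g_def algebra_simps)
      show "((\<lambda>u. K u * (M / 2)) has_vector_derivative k u * (M / 2)) (at u)"
        using dKv[OF us] by (auto intro!: derivative_eq_intros)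
      have "norm (e u * (\<phi> u * g u / 2)) \<le> 1 * (k u * (M / 2))"
        unfolding norm_mult[of "e u"] by (intro mult_mono ne pg us) (use u in auto)
      thus "norm (e u * (\<phi> u * g u / 2)) \<le> k u * (M / 2)" by simp
    qed (use x False in auto)
    moreover have "e x = 1" unfolding e_def by simp
    moreover have "norm (e t * \<beta> t) \<le> norm (\<beta> t)"
      using mult_right_mono[OF ne[of t], of "norm (\<beta> t)"] x by (simp add: norm_mult)
    moreover have "norm (\<beta> x) \<le> norm (e t * \<beta> t) + norm (e t * \<beta> t - \<beta> x)"
      by (metis norm_minus_commute norm_triangle_sub)
    moreover have "(K t - K x) * (M / 2) = K t * (M / 2) - K x * (M / 2)" by (rule left_diff_distrib)
    ultimately show ?thesis by (simp add: diff_divide_distrib)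
  qed auto
  define N where "N = norm (\<alpha> t) + norm (\<beta> t)"
  have KK: "K t - K x0 \<le> 1/2"
  proof -
    have sx: "s \<le> x0" using x0 by auto
    have "K s \<le> K x0"
    proof (rule DERIV_nonneg_imp_nondecreasing[OF sx])
      fix v assume "s \<le> v" "v \<le> x0"
      hence "v \<in> {s..t}" using x0 by auto
      thus "\<exists>y. (K has_real_derivative y) (at v) \<and> 0 \<le> y" using dK kn by blast
    qed
    thus ?thesis using small by linarith
  qed
  have "M \<le> norm (\<alpha> x0) + norm (\<beta> x0)" unfolding M_def g_def by (rule norm_triangle_ineq)
  also have "norm (\<alpha> x0) \<le> norm (\<alpha> t) + norm (\<alpha> t - \<alpha> x0)"
    by (metis norm_minus_commute norm_triangle_sub)
  finally have "M \<le> N + (K t - K x0) * M"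
    using A[OF x0] B[OF x0] unfolding N_def by simp
  \<comment> \<open>The bound 1/2 enters here: half of \<open>M\<close> moves to the left
    side.\<close>
  also have "(K t - K x0) * M \<le> 1/2 * M" using KK M0 by (rule mult_right_mono)
  finally have MN: "M / 2 \<le> N" by simp
  have s: "s \<in> {s..t}" using st by simp
  have "K s \<le> K t"
    by (rule DERIV_nonneg_imp_nondecreasing[OF st]) (use dK kn in fastforce)
  hence "(K t - K s) * (M / 2) \<le> (K t - K s) * N" using MN by (intro mult_left_mono) auto
  thus "norm (\<alpha> s - \<alpha> t) \<le> (norm (\<alpha> t) + norm (\<beta> t)) * (K t - K s)"
    and "norm (\<beta> s) \<le> norm (\<beta> t) + (norm (\<alpha> t) + norm (\<beta> t)) * (K t - K s)"
    using A[OF s] B[OF s] unfolding N_def by (simp_all add: norm_minus_commute mult.commute)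
qed

text \<open>For \<open>E' = - (w + w'/(2w)) E\<close> and \<open>g = y/E\<close>, the functions \<open>\<beta> = g'/(2w)\<close> and \<open>\<alpha> = g - \<beta>\<close> diagonalise
  the equation up to the term \<open>\<phi>\<close>. Here \<open>c\<close> is the speed of a path, and \<open>D\<close> and \<open>V\<close> stand for \<open>1/E\<close>
  and \<open>1/w\<close>, so that no quotients are differentiated.\<close>

lemma wkb_system:
  fixes y y1 w w1 D V :: "real \<Rightarrow> complex"
  assumes "w x * V x = 1"
    and "(y has_vector_derivative c * y1 x) (at x)"
    and "(y1 has_vector_derivative c * (Q * y x)) (at x)"
    and "(w1 has_vector_derivative c * w2) (at x)"
    and "(D has_vector_derivative c * ((w x + w1 x * V x / 2) * D x)) (at x)"
    and "(V has_vector_derivative - (c * (w1 x * V x * V x))) (at x)"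
  defines "\<beta> \<equiv> \<lambda>x. (y1 x * V x * D x + y x * D x + w1 x * V x * V x * y x * D x / 2) / 2"
  defines "\<alpha> \<equiv> \<lambda>x. y x * D x - \<beta> x"
  defines "\<phi> \<equiv> (Q - w x * w x) * V x + w2 * V x * V x / 2 - 3 * w1 x * w1 x * V x * V x * V x / 4"
  shows "(\<alpha> has_vector_derivative - (c * \<phi>) * (\<alpha> x + \<beta> x) / 2) (at x)"
    and "(\<beta> has_vector_derivative 2 * (c * w x) * \<beta> x + (c * \<phi>) * (\<alpha> x + \<beta> x) / 2) (at x)"
proof -
  \<comment> \<open>The left side is the derivative of \<open>\<beta>\<close> as the product rule
    delivers it. It agrees with the desired one up to a multiple of \<open>w x * V x - 1\<close>,
    which makes the comparison a polynomial identity.\<close>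
  have alg: "(((c * (Q * y x)) * V x + y1 x * - (c * (w1 x * V x * V x))) * D x
        + (y1 x * V x) * (c * ((w x + w1 x * V x / 2) * D x))
      + ((c * y1 x) * D x + y x * (c * ((w x + w1 x * V x / 2) * D x)))
      + (((((c * w2) * V x + w1 x * - (c * (w1 x * V x * V x))) * V x
          + (w1 x * V x) * - (c * (w1 x * V x * V x))) * y x + (w1 x * V x * V x) * (c * y1 x)) * D x
          + (w1 x * V x * V x * y x) * (c * ((w x + w1 x * V x / 2) * D x))) / 2) / 2
    = (2 * (c * w x) * \<beta> x + (c * \<phi>) * (\<alpha> x + \<beta> x) / 2)
      + (w x * V x - 1) * (c * (w x * y x - y1 x - w1 x * V x * y x / 2) * D x / 2)"
    unfolding \<alpha>_def \<beta>_def \<phi>_def by (simp add: field_simps)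
  have b: "(\<beta> has_vector_derivative 2 * (c * w x) * \<beta> x + (c * \<phi>) * (\<alpha> x + \<beta> x) / 2) (at x)"
  proof (rule has_vector_derivative_eq_rhs)
    show "(\<beta> has_vector_derivative
       (((c * (Q * y x)) * V x + y1 x * - (c * (w1 x * V x * V x))) * D x
        + (y1 x * V x) * (c * ((w x + w1 x * V x / 2) * D x))
      + ((c * y1 x) * D x + y x * (c * ((w x + w1 x * V x / 2) * D x)))
      + (((((c * w2) * V x + w1 x * - (c * (w1 x * V x * V x))) * V x
          + (w1 x * V x) * - (c * (w1 x * V x * V x))) * y x + (w1 x * V x * V x) * (c * y1 x)) * D x
          + (w1 x * V x * V x * y x) * (c * ((w x + w1 x * V x / 2) * D x))) / 2) / 2) (at x)"
      unfolding \<beta>_def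
      by (rule has_vector_derivative_eq_rhs, (rule has_vector_derivative_add has_vector_derivative_divide
        has_vector_derivative_mult assms(2-6))+) (simp add: add_ac mult_ac)
  qed (use alg assms(1) in simp)
  show "(\<beta> has_vector_derivative 2 * (c * w x) * \<beta> x + (c * \<phi>) * (\<alpha> x + \<beta> x) / 2) (at x)" by (rule b)
  have "y x * (c * ((w x + w1 x * V x / 2) * D x)) + c * y1 x * D x
      = 2 * (c * w x) * \<beta> x + (1 - w x * V x) * (c * (y1 x + w1 x * V x * y x / 2) * D x)"
    unfolding \<beta>_def by (simp add: field_simps)
  hence "y x * (c * ((w x + w1 x * V x / 2) * D x)) + c * y1 x * D x = 2 * (c * w x) * \<beta> x"
    using assms(1) by simp
  thus "(\<alpha> has_vector_derivative - (c * \<phi>) * (\<alpha> x + \<beta> x) / 2) (at x)"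
    unfolding \<alpha>_def
    by (intro has_vector_derivative_eq_rhs[OF has_vector_derivative_diff[OF has_vector_derivative_mult[OF assms(2,5)] b]])
       (simp add: \<alpha>_def)
qed

section \<open>The square root of the potential as a power series\<close>

text \<open>The reversal of \<open>Ppoly\<close>: \<open>1 + Apoly m a\<close> evaluated at 1/z is
  the potential without \<open>lam\<close>, divided by z^m. Expansions at infinity become power
  series at 0.\<close>

definition Apoly :: "nat \<Rightarrow> (nat \<Rightarrow> complex) \<Rightarrow> complex poly" where
  "Apoly m a = (\<Sum>j=1..m. monom (a j) j)"

text \<open>Partial sum up to order \<open>m/2 + 1\<close> of the square root of \<open>1 + Apoly m a\<close>.\<close>
definition Bpoly :: "nat \<Rightarrow> (nat \<Rightarrow> complex) \<Rightarrow> complex poly" where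
  "Bpoly m a = 1 + (\<Sum>j=1..m div 2 + 1. monom (bj m a j) j)"

lemma poly_Ppoly: "poly (Ppoly m a) z = Pfun m a z"
  by (simp add: Ppoly_def Pfun_def poly_sum poly_monom)

lemma Pfun_eq_Apoly:
  assumes "z \<noteq> 0"
  shows "Pfun m a z = z ^ m * poly (Apoly m a) (1 / z)"
  unfolding Pfun_def Apoly_def poly_sum poly_monom sum_distrib_left
  using assms by (intro sum.cong refl) (simp add: power_diff power_one_over field_simps)

text \<open>Taking powers commutes with reversing coefficients. \<open>D'\<close> is the power of
  \<open>Apoly\<close>, reversed with respect to degree \<open>m * k\<close>, and it is identified
  with the power of \<open>Ppoly\<close> through its values.\<close>

lemma coeff_Ppoly_power:
  assumes "j \<le> m * k"
  shows "coeff (Ppoly m a ^ k) (m * k - j) = coeff (Apoly m a ^ k) j"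
    and "degree (Apoly m a ^ k) \<le> m * k"
proof -
  define D where "D = Apoly m a ^ k"
  have "degree (Apoly m a) \<le> m"
    unfolding Apoly_def by (rule degree_sum_le) (auto intro: order_trans[OF degree_monom_le])
  hence deg: "degree D \<le> m * k"
    unfolding D_def by (metis degree_power_le le_trans mult_le_mono1)
  thus "degree (Apoly m a ^ k) \<le> m * k" unfolding D_def .
  define D' where "D' = (\<Sum>i\<le>m * k. monom (coeff D i) (m * k - i))"
  have "poly D' z = poly (Ppoly m a ^ k) z" if "z \<noteq> 0" for z
  proof -
    have "poly D' z = z ^ (m * k) * poly D (1 / z)"
      unfolding D'_def poly_sum poly_monom poly_altdef[of D] sum_distrib_left
    proof (rule sum.mono_neutral_cong_right)
      show "\<forall>i\<in>{..m * k} - {..degree D}. coeff D i * z ^ (m * k - i) = 0"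
        by (auto simp: coeff_eq_0)
    qed (use deg that in \<open>auto simp: power_diff power_one_over field_simps\<close>)
    also have "\<dots> = (z ^ m * poly (Apoly m a) (1 / z)) ^ k"
      unfolding D_def by (simp add: power_mult power_mult_distrib poly_power)
    finally show ?thesis
      using Pfun_eq_Apoly[OF that] by (simp add: poly_power poly_Ppoly)
  qed
  hence "D' = Ppoly m a ^ k"
  proof -
    assume *: "\<And>z. z \<noteq> 0 \<Longrightarrow> poly D' z = poly (Ppoly m a ^ k) z"
    \<comment> \<open>The values agree away from 0 so far; the factor X makes them agree
      everywhere.\<close>
    have "poly ([:0, 1:] * D') = poly ([:0, 1:] * Ppoly m a ^ k)"
      using * by (intro ext) (case_tac "x = 0", auto)
    hence "[:0, 1:] * D' = [:0, 1:] * Ppoly m a ^ k" by (simp only: poly_eq_poly_eq_iff)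
    thus ?thesis by simp
  qed
  moreover have "coeff D' (m * k - j) = coeff D j"
  proof -
    have "coeff D' (m * k - j) = (\<Sum>i\<le>m * k. if i = j then coeff D i else 0)"
      unfolding D'_def coeff_sum coeff_monom using assms by (intro sum.cong refl) auto
    thus ?thesis using assms by simp
  qed
  ultimately show "coeff (Ppoly m a ^ k) (m * k - j) = coeff (Apoly m a ^ k) j"
    unfolding D_def by simp
qed

lemma coeff_Bpoly:
  "coeff (Bpoly m a) j = (if j = 0 then 1 else if j \<le> m div 2 + 1 then bj m a j else 0)"
proof -
  have "coeff (\<Sum>i=1..m div 2 + 1. monom (bj m a i) i) j = (\<Sum>i=1..m div 2 + 1. if i = j then bj m a i else 0)"
    by (simp add: coeff_sum)
  thus ?thesis unfolding Bpoly_def by (auto simp: coeff_1 sum.delta)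
qed

text \<open>The numbers \<open>bj\<close> are the coefficients of the formal square root of
  \<open>1 + Apoly\<close>. Since \<open>Apoly\<close> has no constant term, powers beyond
  \<open>j\<close> do not reach the coefficient of order \<open>j\<close>; the default 0 in
  \<open>bjk\<close> matches the vanishing of coefficients beyond the degree
  \<open>m * k\<close>.\<close>

lemma bj_eq_compose:
  assumes "j \<ge> 1"
  shows "bj m a j = fps_nth (fps_binomial (1/2) oo fps_of_poly (Apoly m a)) j"
proof -
  have "fps_nth (fps_binomial (1/2) oo fps_of_poly (Apoly m a)) j =
     (\<Sum>k=0..j. ((1/2::complex) gchoose k) * coeff (Apoly m a ^ k) j)"
    by (simp add: fps_compose_nth flip: fps_of_poly_power)
  also have "\<dots> = (\<Sum>k=1..j. ((1/2::complex) gchoose k) * coeff (Apoly m a ^ k) j)"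
    using assms by (simp add: sum.atLeast_Suc_atMost coeff_1)
  also have "\<dots> = bj m a j"
    unfolding bj_def bjk_def
  proof (rule sum.cong)
    fix k
    have "coeff (Apoly m a ^ k) j = 0" if "\<not> j \<le> m * k"
      using coeff_Ppoly_power(2)[of 0 m k a] that by (intro coeff_eq_0) auto
    thus "((1/2::complex) gchoose k) * coeff (Apoly m a ^ k) j = (if j \<le> m * k
      then ((1/2::complex) gchoose k) * coeff (Ppoly m a ^ k) (m * k - j) else 0)"
      by (simp add: coeff_Ppoly_power(1))
  qed simp
  finally show ?thesis by simp
qed

text \<open>The full formal root squares to \<open>1 + Apoly\<close> exactly, and
  \<open>Bpoly\<close> shares its coefficients up to order m div 2 + 1; a product of series up to a
  given order sees only coefficients up to that order.\<close>

lemma Bpoly_square: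
  "\<exists>S. Bpoly m a * Bpoly m a - 1 - Apoly m a = monom 1 (m div 2 + 2) * S"
proof -
  define A where "A = fps_of_poly (Apoly m a)"
  define B where "B = fps_binomial (1/2) oo A"
  have A0: "fps_nth A 0 = 0" unfolding A_def Apoly_def by (simp add: coeff_sum)
  have "B * B = (fps_binomial (1/2) * fps_binomial (1/2)) oo A"
    unfolding B_def by (rule fps_compose_mult_distrib[OF A0, symmetric])
  also have "fps_binomial (1/2) * fps_binomial (1/2) = (1 + fps_X :: complex fps)"
    by (simp flip: fps_binomial_add_mult add: fps_binomial_1)
  also have "(1 + fps_X) oo A = 1 + A"
    using A0 by (simp add: fps_compose_add_distrib)
  finally have BB: "B * B = 1 + A" .
  have cB: "coeff (Bpoly m a) j = fps_nth B j" if "j < m div 2 + 2" for j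
    using that bj_eq_compose[of j m a] unfolding B_def A_def
    by (auto simp: coeff_Bpoly fps_compose_nth)
  have "monom 1 (m div 2 + 2) dvd (Bpoly m a * Bpoly m a - 1 - Apoly m a)"
    unfolding monom_1_dvd_iff'
  proof (intro allI impI)
    fix n assume n: "n < m div 2 + 2"
    have "coeff (Bpoly m a * Bpoly m a) n = (\<Sum>i\<le>n. fps_nth B i * fps_nth B (n - i))"
      unfolding coeff_mult using n by (intro sum.cong refl) (auto simp: cB)
    also have "\<dots> = fps_nth (B * B) n" by (simp add: fps_mult_nth atLeast0AtMost)
    also have "\<dots> = coeff (1 + Apoly m a) n" unfolding BB A_def by (simp add: coeff_1)
    finally show "coeff (Bpoly m a * Bpoly m a - 1 - Apoly m a) n = 0" by simp
  qed
  thus ?thesis by (auto simp: dvd_def)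
qed

section \<open>The approximate phase and amplitude\<close>

lemma poly_inverse_bound:
  "\<exists>K\<ge>0. \<forall>z::complex. norm z \<ge> 1 \<longrightarrow> norm (poly p (1 / z)) \<le> K"
proof -
  have "norm (poly p (1 / z)) \<le> (\<Sum>i\<le>degree p. norm (coeff p i))" if "norm z \<ge> 1" for z :: complex
    unfolding poly_altdef
  proof (rule sum_norm_le)
    fix i
    have "norm (1 / z) ^ i \<le> 1" using that by (intro power_le_one) (auto simp: norm_divide divide_le_eq)
    thus "norm (coeff p i * (1 / z) ^ i) \<le> norm (coeff p i)"
      by (metis mult.right_neutral mult_left_mono norm_ge_zero norm_mult norm_power)
  qed
  thus ?thesis by (meson norm_ge_zero sum_nonneg)
qed

lemma poly_inverse_limit:
  "\<exists>K\<ge>0. \<forall>z::complex. norm z \<ge> 1 \<longrightarrow> norm (poly p (1 / z) - coeff p 0) \<le> K / norm z"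
proof -
  obtain c q where p: "p = pCons c q" by (rule pCons_cases)
  obtain K where K: "K \<ge> 0" "\<And>z::complex. norm z \<ge> 1 \<Longrightarrow> norm (poly q (1 / z)) \<le> K"
    using poly_inverse_bound by blast
  have "norm (poly p (1 / z) - coeff p 0) \<le> K / norm z" if "norm z \<ge> 1" for z :: complex
    using K(2)[OF that] that by (simp add: p norm_divide divide_right_mono)
  thus ?thesis using K(1) by blast
qed

text \<open>The functions \<open>z powr s * p (1/z)\<close> are closed under differentiation.\<close>

definition zp :: "real \<Rightarrow> complex poly \<Rightarrow> complex \<Rightarrow> complex" where
  "zp s p z = z powr of_real s * poly p (1 / z)"

definition zp_deriv :: "real \<Rightarrow> complex poly \<Rightarrow> complex poly" where
  "zp_deriv s p = smult (of_real s) p - [:0, 1:] * pderiv p"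

lemma has_field_derivative_zp:
  assumes "z \<notin> \<real>\<^sub>\<le>\<^sub>0"
  shows "(zp s p has_field_derivative zp (s - 1) (zp_deriv s p) z) (at z)"
proof -
  have z: "z \<noteq> 0" using assms by auto
  have pz: "z powr of_real s = z * z powr (of_real s - 1)"
    using z by (simp add: powr_diff)
  have "(zp s p has_field_derivative
      (of_real s * z powr (of_real s - 1)) * poly p (1 / z) +
      (poly (pderiv p) (1 / z) * (- 1 / z\<^sup>2)) * z powr of_real s) (at z)"
    unfolding zp_def
    by (rule DERIV_mult has_field_derivative_powr assms
         DERIV_chain2[where f = "poly p"] poly_DERIV)+
       (use z in \<open>auto intro!: derivative_eq_intros simp: power2_eq_square divide_inverse\<close>)
  also have "(of_real s * z powr (of_real s - 1)) * poly p (1 / z) +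
      (poly (pderiv p) (1 / z) * (- 1 / z\<^sup>2)) * z powr of_real s = zp (s - 1) (zp_deriv s p) z"
    unfolding zp_def zp_deriv_def pz using z by (simp add: field_simps power2_eq_square)
  finally show ?thesis .
qed

lemma norm_zp_le: "\<exists>K\<ge>0. \<forall>z. norm z \<ge> 1 \<longrightarrow> norm (zp s p z) \<le> K * norm z powr s"
proof -
  obtain K where K: "K \<ge> 0" "\<And>z::complex. norm z \<ge> 1 \<Longrightarrow> norm (poly p (1 / z)) \<le> K"
    using poly_inverse_bound by blast
  have "norm (zp s p z) \<le> K * norm z powr s" if "norm z \<ge> 1" for z
    using mult_right_mono[OF K(2)[OF that], of "norm z powr s"]
    by (simp add: zp_def norm_mult norm_powr_real_powr' mult.commute)
  thus ?thesis using K(1) by blast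
qed

definition Qf :: "nat \<Rightarrow> (nat \<Rightarrow> complex) \<Rightarrow> complex \<Rightarrow> complex \<Rightarrow> complex" where
  "Qf m a lam z = z ^ m + Pfun m a z + lam"

definition Bz :: "nat \<Rightarrow> (nat \<Rightarrow> complex) \<Rightarrow> complex \<Rightarrow> complex" where
  "Bz m a z = poly (Bpoly m a) (1 / z)"

text \<open>\<open>xiA\<close> is an antiderivative of \<open>wA\<close>, the logarithm coming from the coefficient \<open>nu\<close> of \<open>1/z\<close>;
  \<open>dA\<close> is \<open>1/E\<close> for \<open>w = wA\<close>, with the branch of \<open>sqrt w\<close> fixed by \<open>Bz\<close> being near \<open>1\<close>.\<close>

definition wA :: "nat \<Rightarrow> (nat \<Rightarrow> complex) \<Rightarrow> complex \<Rightarrow> complex" where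
  "wA m a = zp (real m / 2) (Bpoly m a)"

definition wA1 :: "nat \<Rightarrow> (nat \<Rightarrow> complex) \<Rightarrow> complex \<Rightarrow> complex" where
  "wA1 m a = zp (real m / 2 - 1) (zp_deriv (real m / 2) (Bpoly m a))"

definition wA2 :: "nat \<Rightarrow> (nat \<Rightarrow> complex) \<Rightarrow> complex \<Rightarrow> complex" where
  "wA2 m a = zp (real m / 2 - 1 - 1) (zp_deriv (real m / 2 - 1) (zp_deriv (real m / 2) (Bpoly m a)))"

definition xiA :: "nat \<Rightarrow> (nat \<Rightarrow> complex) \<Rightarrow> complex \<Rightarrow> complex" where
  "xiA m a z = Ffun m a z + nu m a * Ln z"

definition dA :: "nat \<Rightarrow> (nat \<Rightarrow> complex) \<Rightarrow> complex \<Rightarrow> complex" where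
  "dA m a z = z powr of_real (real m / 4) * exp (xiA m a z) * csqrt (Bz m a z)"

lemma wA_derivs:
  assumes "z \<notin> \<real>\<^sub>\<le>\<^sub>0"
  shows "(wA m a has_field_derivative wA1 m a z) (at z)"
    and "(wA1 m a has_field_derivative wA2 m a z) (at z)"
  unfolding wA_def wA1_def wA2_def by (rule has_field_derivative_zp[OF assms])+

lemma Ffun_index_set: "{j. 1 \<le> j \<and> real j < (real m + 2) / 2} = {1..(m + 1) div 2}"
proof -
  have "real j < (real m + 2) / 2 \<longleftrightarrow> j \<le> (m + 1) div 2" for j
  proof -
    have "real j < (real m + 2) / 2 \<longleftrightarrow> real (2 * j) < real (m + 2)" by (simp add: field_simps)
    also have "\<dots> \<longleftrightarrow> 2 * j < m + 2" by (simp only: of_nat_less_iff)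
    also have "\<dots> \<longleftrightarrow> j \<le> (m + 1) div 2" by linarith
    finally show ?thesis .
  qed
  thus ?thesis unfolding atLeastAtMost_iff[symmetric] by (simp only: atLeastAtMost_def atLeast_def atMost_def Collect_conj_eq[symmetric])
qed

text \<open>The powers listed here are those whose antiderivatives make up \<open>Ffun\<close>. For
  even \<open>m\<close> the last index m/2 + 1 has exponent -1, and its coefficient is
  \<open>nu\<close>: the source of the logarithm in \<open>xiA\<close> and of the shift in
  \<open>mu\<close>.\<close>

lemma wA_expand:
  assumes "z \<noteq> 0"
  shows "wA m a z = z powr of_real (real m / 2)
     + (\<Sum>j=1..(m + 1) div 2. bj m a j * z powr of_real (real m / 2 - real j)) + nu m a / z"
proof -
  have pz: "z powr of_real (real m / 2) * (1 / z) ^ j = z powr of_real (real m / 2 - real j)" for j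
  proof -
    have "z powr of_real (real m / 2 - real j) = z powr of_real (real m / 2) / z powr of_nat j"
      by (simp only: of_real_diff of_real_of_nat_eq powr_diff)
    thus ?thesis using assms powr_nat'[of z j] by (simp add: power_one_over)
  qed
  have "wA m a z = z powr of_real (real m / 2) +
     (\<Sum>j=1..m div 2 + 1. bj m a j * z powr of_real (real m / 2 - real j))"
  proof -
    have "poly (Bpoly m a) (1 / z) = 1 + (\<Sum>j=1..m div 2 + 1. bj m a j * (1 / z) ^ j)"
      unfolding Bpoly_def by (simp only: poly_add poly_1 poly_sum poly_monom)
    thus ?thesis unfolding wA_def zp_def pz[symmetric]
      by (simp only: ring_distribs sum_distrib_left mult_1_right mult.left_commute)
  qed
  also have "(\<Sum>j=1..m div 2 + 1. bj m a j * z powr of_real (real m / 2 - real j)) =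
    (\<Sum>j=1..(m + 1) div 2. bj m a j * z powr of_real (real m / 2 - real j)) + nu m a / z"
  proof (cases "odd m")
    case True
    hence "(m + 1) div 2 = m div 2 + 1" by presburger
    thus ?thesis using True by (simp add: nu_def)
  next
    case False
    hence e: "(m + 1) div 2 = m div 2" "real m = 2 * real (m div 2)" by auto
    have "z powr of_real (real m / 2 - real (m div 2 + 1)) = 1 / z"
      unfolding e(2) using assms powr_minus_divide[of z 1] by simp
    thus ?thesis using False e(1) by (simp add: nu_def)
  qed
  finally show ?thesis by (simp add: add.assoc)
qed

lemma xiA_deriv:
  assumes "z \<notin> \<real>\<^sub>\<le>\<^sub>0"
  shows "(xiA m a has_field_derivative wA m a z) (at z)"
proof -
  have z: "z \<noteq> 0" using assms by auto
  have d: "(xiA m a has_field_derivative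
     of_real (2 / (real m + 2)) * (of_real ((real m + 2) / 2) * z powr (of_real ((real m + 2) / 2) - 1))
     + (\<Sum>j=1..(m + 1) div 2. of_real (2 / (real m + 2 - 2 * real j)) * bj m a j
          * (of_real ((real m + 2 - 2 * real j) / 2) * z powr (of_real ((real m + 2 - 2 * real j) / 2) - 1)))
     + nu m a * (1 / z)) (at z)"
    unfolding xiA_def Ffun_def Ffun_index_set
    using has_field_derivative_Ln[OF assms]
    by (intro DERIV_add DERIV_sum DERIV_cmult has_field_derivative_powr assms) (simp add: divide_inverse)
  have canc: "p * (q * x) = x" "p * b * (q * x) = b * x" if "p * q = 1" for p q b x :: complex
    using that by (metis mult.assoc mult_1, metis mult.assoc mult.commute mult_1)
  have e1: "of_real (2 / (real m + 2)) * (of_real ((real m + 2) / 2) * z powr (of_real ((real m + 2) / 2) - 1))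
      = z powr of_real (real m / 2)"
  proof -
    have "of_real (2 / (real m + 2)) * (of_real ((real m + 2) / 2)) = (1::complex)"
      unfolding of_real_mult[symmetric] by (simp add: field_simps)
    moreover have "of_real ((real m + 2) / 2) - 1 = (of_real (real m / 2) :: complex)" by (simp add: field_simps)
    ultimately show ?thesis by (simp only: canc)
  qed
  have e2: "of_real (2 / (real m + 2 - 2 * real j)) * bj m a j
          * (of_real ((real m + 2 - 2 * real j) / 2) * z powr (of_real ((real m + 2 - 2 * real j) / 2) - 1))
      = bj m a j * z powr of_real (real m / 2 - real j)" if "j \<in> {1..(m+1) div 2}" for j
  proof -
    have "2 * j < m + 2" using that by auto
    hence "real m + 2 - 2 * real j \<noteq> 0" by linarith
    hence 1: "of_real (2 / (real m + 2 - 2 * real j)) * (of_real ((real m + 2 - 2 * real j) / 2)) = (1::complex)"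
      unfolding of_real_mult[symmetric] by (simp add: field_simps)
    have 2: "of_real ((real m + 2 - 2 * real j) / 2) - 1 = (of_real (real m / 2 - real j) :: complex)" by (simp add: field_simps)
    show ?thesis unfolding 2 by (rule canc[OF 1])
  qed
  have e3: "(\<Sum>j=1..(m + 1) div 2. of_real (2 / (real m + 2 - 2 * real j)) * bj m a j
          * (of_real ((real m + 2 - 2 * real j) / 2) * z powr (of_real ((real m + 2 - 2 * real j) / 2) - 1)))
     = (\<Sum>j=1..(m + 1) div 2. bj m a j * z powr of_real (real m / 2 - real j))"
    by (rule sum.cong[OF refl e2])
  show ?thesis unfolding wA_expand[OF z] using d
    unfolding e1 e3 by (simp only: times_divide_eq_right mult_1_right)
qed

lemma dA_deriv:
  assumes "z \<notin> \<real>\<^sub>\<le>\<^sub>0" "Bz m a z \<notin> \<real>\<^sub>\<le>\<^sub>0"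
  shows "(dA m a has_field_derivative ((wA m a z + wA1 m a z * (1 / wA m a z) / 2) * dA m a z)) (at z)"
proof -
  have z: "z \<noteq> 0" using assms by auto
  have B: "Bz m a z \<noteq> 0" using assms by auto
  define b' where "b' = poly (pderiv (Bpoly m a)) (1 / z) * (- 1 / z\<^sup>2)"
  have dB: "(Bz m a has_field_derivative b') (at z)"
    unfolding Bz_def b'_def
    by (rule DERIV_chain2[where f = "poly (Bpoly m a)"] poly_DERIV)+
       (use z in \<open>auto intro!: derivative_eq_intros simp: power2_eq_square divide_inverse\<close>)
  have pz: "z powr (of_real (real m / 4) - 1) = z powr of_real (real m / 4) / z"
    "z powr (of_real (real m / 2 - 1)) = z powr of_real (real m / 2) / z"
    using z by (simp_all add: powr_diff)
  have w1: "wA1 m a z * (1 / wA m a z) = of_real (real m / 2) / z + b' / Bz m a z"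
    unfolding wA1_def wA_def zp_def zp_deriv_def b'_def pz Bz_def[symmetric]
    using z B by (simp add: Bz_def[symmetric] field_simps power2_eq_square)
  have "(dA m a has_field_derivative
     ((of_real (real m / 4) * z powr (of_real (real m / 4) - 1)) * exp (xiA m a z)
        + (exp (xiA m a z) * wA m a z) * z powr of_real (real m / 4)) * csqrt (Bz m a z)
     + (1 / (2 * csqrt (Bz m a z)) * b') * (z powr of_real (real m / 4) * exp (xiA m a z))) (at z)"
    unfolding dA_def
    apply (rule DERIV_mult)+
      apply (rule has_field_derivative_powr[OF assms(1)])
     apply (rule DERIV_chain2[where f = exp]; (rule DERIV_exp xiA_deriv[OF assms(1)]))
    apply (rule DERIV_chain2[where f = csqrt, OF _ dB])
    using has_field_derivative_csqrt[OF assms(2)] by (simp add: field_simps)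
  moreover have "((of_real (real m / 4) * z powr (of_real (real m / 4) - 1)) * exp (xiA m a z)
        + (exp (xiA m a z) * wA m a z) * z powr of_real (real m / 4)) * csqrt (Bz m a z)
     + (1 / (2 * csqrt (Bz m a z)) * b') * (z powr of_real (real m / 4) * exp (xiA m a z))
     = (wA m a z + wA1 m a z * (1 / wA m a z) / 2) * dA m a z"
  proof -
    have c: "1 / (2 * csqrt (Bz m a z)) = csqrt (Bz m a z) / (2 * Bz m a z)"
      using B by (simp add: field_simps) (metis power2_csqrt power2_eq_square)
    show ?thesis unfolding w1 pz c dA_def using z B by (simp add: field_simps)
  qed
  ultimately show ?thesis by simp
qed

text \<open>By the order of agreement in \<open>Bpoly_square\<close> the error is z^(m - m div 2 -
  2) times a bounded factor. The stated exponent is attained for odd \<open>m\<close>. It is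
  nonnegative for \<open>m \<ge> 3\<close>, so the constant \<open>lam\<close> is absorbed
  too.\<close>

lemma Qf_minus_wA_bound:
  assumes "m \<ge> 3"
  shows "\<exists>K\<ge>0. \<forall>z. norm z \<ge> 1 \<longrightarrow>
    norm (Qf m a lam z - wA m a z * wA m a z) \<le> K * norm z powr (real m / 2 - 3 / 2)"
proof -
  obtain S where S: "Bpoly m a * Bpoly m a - 1 - Apoly m a = monom 1 (m div 2 + 2) * S"
    using Bpoly_square by blast
  obtain K where K: "K \<ge> 0" "\<And>z::complex. norm z \<ge> 1 \<Longrightarrow> norm (poly S (1 / z)) \<le> K"
    using poly_inverse_bound by blast
  define n where "n = m - (m div 2 + 2)"
  have n: "m = n + (m div 2 + 2)" unfolding n_def using assms by presburger
  have n2: "real n \<le> real m / 2 - 3 / 2" using n by linarith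
  have "norm (Qf m a lam z - wA m a z * wA m a z) \<le> (norm lam + K) * norm z powr (real m / 2 - 3 / 2)"
    if z1: "norm z \<ge> 1" for z
  proof -
    have z: "z \<noteq> 0" using z1 by auto
    have "z powr of_real (real m / 2) * z powr of_real (real m / 2) = z ^ m"
      using z powr_nat'[of z m] by (simp flip: powr_add)
    hence "wA m a z * wA m a z = z ^ m * poly (Bpoly m a * Bpoly m a) (1 / z)"
      unfolding wA_def zp_def by (simp add: mult_ac)
    also have "Bpoly m a * Bpoly m a = 1 + Apoly m a + monom 1 (m div 2 + 2) * S"
      using S by (simp add: algebra_simps)
    finally have "Qf m a lam z - wA m a z * wA m a z = lam - z ^ m * (1 / z) ^ (m div 2 + 2) * poly S (1 / z)"
      unfolding Qf_def Pfun_eq_Apoly[OF z] by (simp add: poly_monom algebra_simps)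
    also have "z ^ m * (1 / z) ^ (m div 2 + 2) = z ^ n"
      by (subst n, subst power_add) (use z in \<open>simp add: power_one_over del: power_Suc\<close>)
    finally have "norm (Qf m a lam z - wA m a z * wA m a z) \<le> norm lam + norm z ^ n * norm (poly S (1 / z))"
      by (metis norm_mult norm_power norm_triangle_ineq4)
    also have "\<dots> \<le> norm lam * norm z powr (real m / 2 - 3 / 2) + norm z powr (real m / 2 - 3 / 2) * K"
    proof (intro add_mono mult_mono K(2) z1)
      show "norm z ^ n \<le> norm z powr (real m / 2 - 3 / 2)"
        using powr_mono[OF n2 z1] z by (simp add: powr_realpow)
      have "1 \<le> norm z powr (real m / 2 - 3 / 2)" using z1 assms by (intro ge_one_powr_ge_zero) auto
      thus "norm lam \<le> norm lam * norm z powr (real m / 2 - 3 / 2)"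
        by (metis mult.right_neutral mult_left_mono norm_ge_zero)
    qed auto
    finally show ?thesis by (simp add: algebra_simps)
  qed
  thus ?thesis using K(1) by (intro exI[of _ "norm lam + K"]) auto
qed

section \<open>The diagonal variables for the approximate phase\<close>

definition phiA :: "nat \<Rightarrow> (nat \<Rightarrow> complex) \<Rightarrow> complex \<Rightarrow> complex \<Rightarrow> complex" where
  "phiA m a lam z = (let w = wA m a z; V = 1 / w; w1 = wA1 m a z in
     (Qf m a lam z - w * w) * V + wA2 m a z * V * V / 2 - 3 * w1 * w1 * V * V * V / 4)"

definition betaA :: "nat \<Rightarrow> (nat \<Rightarrow> complex) \<Rightarrow> (complex \<Rightarrow> complex) \<Rightarrow> complex \<Rightarrow> complex" where
  "betaA m a y z = (let V = 1 / wA m a z; D = dA m a z in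
     (deriv y z * V * D + y z * D + wA1 m a z * V * V * y z * D / 2) / 2)"

definition alphaA :: "nat \<Rightarrow> (nat \<Rightarrow> complex) \<Rightarrow> (complex \<Rightarrow> complex) \<Rightarrow> complex \<Rightarrow> complex" where
  "alphaA m a y z = y z * dA m a z - betaA m a y z"

definition is_solution :: "nat \<Rightarrow> (nat \<Rightarrow> complex) \<Rightarrow> complex \<Rightarrow> (complex \<Rightarrow> complex) \<Rightarrow> bool" where
  "is_solution m a lam y \<longleftrightarrow> y holomorphic_on UNIV \<and> (\<forall>z. deriv (deriv y) z = Qf m a lam z * y z)"

lemma Bz_near_one: "\<exists>K\<ge>0. \<forall>z. norm z \<ge> 1 \<longrightarrow> norm (Bz m a z - 1) \<le> K / norm z"
  using poly_inverse_limit[of "Bpoly m a"] by (simp add: Bz_def coeff_Bpoly)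

text \<open>With w of size |z|^(m/2), the mismatch (Q - w^2)/w has order -3/2, while the two terms
  with derivatives of w have order -m/2 - 2 and are smaller. Integrated to infinity, order -3/2
  gives the -1/2 of Sibuya's asymptotics.\<close>

lemma wA_bounds:
  assumes "m \<ge> 3"
  shows "\<exists>K\<ge>0. \<exists>R\<ge>1. \<forall>z. norm z \<ge> R \<longrightarrow>
     norm (Bz m a z - 1) \<le> 1/2 \<and> norm (Bz m a z - 1) \<le> K * norm z powr (-1/2)
   \<and> norm (phiA m a lam z) \<le> K * norm z powr (-3/2)
   \<and> norm (wA1 m a z / (wA m a z * wA m a z)) \<le> K * norm z powr (-1/2)"
proof -
  obtain K0 where K0: "K0 \<ge> 0" "\<And>z. norm z \<ge> 1 \<Longrightarrow> norm (Bz m a z - 1) \<le> K0 / norm z"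
    using Bz_near_one by blast
  obtain K1 where K1: "K1 \<ge> 0" "\<And>z. norm z \<ge> 1 \<Longrightarrow> norm (wA1 m a z) \<le> K1 * norm z powr (real m / 2 - 1)"
    unfolding wA1_def using norm_zp_le by blast
  obtain K2 where K2: "K2 \<ge> 0" "\<And>z. norm z \<ge> 1 \<Longrightarrow> norm (wA2 m a z) \<le> K2 * norm z powr (real m / 2 - 1 - 1)"
    unfolding wA2_def using norm_zp_le by blast
  obtain K3 where K3: "K3 \<ge> 0" "\<And>z. norm z \<ge> 1 \<Longrightarrow>
      norm (Qf m a lam z - wA m a z * wA m a z) \<le> K3 * norm z powr (real m / 2 - 3 / 2)"
    using Qf_minus_wA_bound[OF assms] by blast
  \<comment> \<open>From this radius on \<open>Bz\<close> is within 1/2 of 1, so \<open>wA\<close>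
    has no zeros and its reciprocal is at most twice |z|^(-m/2).\<close>
  define R where "R = max 1 (2 * K0)"
  define K where "K = K0 + 4 * K1 + (2 * K3 + 2 * K2 + 6 * K1 * K1)"
  have main: "norm (Bz m a z - 1) \<le> 1/2 \<and> norm (Bz m a z - 1) \<le> K * norm z powr (-1/2)
   \<and> norm (phiA m a lam z) \<le> K * norm z powr (-3/2)
   \<and> norm (wA1 m a z / (wA m a z * wA m a z)) \<le> K * norm z powr (-1/2)" if zR: "norm z \<ge> R" for z
  proof -
    define r where "r = norm z"
    have z1: "norm z \<ge> 1" and r1: "r \<ge> 1" and r2: "2 * K0 \<le> r" using zR unfolding R_def r_def by auto
    have pm: "r powr p \<le> r powr q" if "p \<le> q" for p q using powr_mono[OF that r1] .
    have rk: "r powr (-1) = 1 / r" using r1 by (simp add: powr_minus_divide)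
    have B1: "norm (Bz m a z - 1) \<le> K0 * r powr (-1)" using K0(2)[OF z1] r1 unfolding r_def[symmetric] rk by simp
    have "K0 / r \<le> 1/2" using r1 r2 by (simp add: field_simps)
    hence B2: "norm (Bz m a z - 1) \<le> 1/2" using K0(2)[OF z1] unfolding r_def by linarith
    have "1 - norm (1 - Bz m a z) \<le> norm (Bz m a z)"
      using norm_triangle_ineq2[of 1 "1 - Bz m a z"] by simp
    hence B3: "norm (Bz m a z) \<ge> 1/2" using B2 by (simp add: norm_minus_commute)
    define V where "V = 1 / wA m a z"
    have nw: "norm (wA m a z) = r powr (real m / 2) * norm (Bz m a z)"
      unfolding wA_def zp_def Bz_def r_def by (simp add: norm_mult norm_powr_real_powr')
    have V: "norm V \<le> 2 * r powr (- real m / 2)"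
    proof -
      have "norm V = r powr (- real m / 2) * (1 / norm (Bz m a z))"
        unfolding V_def norm_divide nw by (simp add: powr_minus_divide)
      also have "\<dots> \<le> r powr (- real m / 2) * 2"
        using B3 by (intro mult_left_mono) (auto simp: divide_le_eq)
      finally show ?thesis by simp
    qed
    have VV: "norm V * norm V \<le> 4 * r powr (- real m)"
      using mult_mono[OF V V] by (simp add: mult_ac flip: powr_add)
    have VVV: "norm V * norm V * norm V \<le> 8 * r powr (- real m - real m / 2)"
      using mult_mono[OF VV V] by (simp add: mult_ac flip: powr_add)
    have w1: "norm (wA1 m a z) \<le> K1 * r powr (real m / 2 - 1)" using K1(2)[OF z1] unfolding r_def .
    have w11: "norm (wA1 m a z) * norm (wA1 m a z) \<le> K1 * K1 * r powr (real m - 2)"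
      using mult_mono[OF w1 w1] K1(1) by (simp add: mult_ac flip: powr_add)
    have t1: "norm ((Qf m a lam z - wA m a z * wA m a z) * V) \<le> 2 * K3 * r powr (-3/2)"
      using mult_mono[OF K3(2)[OF z1] V] K3(1) unfolding r_def
      by (simp add: norm_mult mult_ac flip: powr_add)
    have "norm (wA2 m a z * V * V / 2) = norm (wA2 m a z) * (norm V * norm V) / 2"
      by (simp add: norm_mult norm_divide)
    also have "\<dots> \<le> (K2 * r powr (real m / 2 - 1 - 1)) * (4 * r powr (- real m)) / 2"
      by (intro divide_right_mono mult_mono VV) (use K2 z1 r_def in auto)
    also have "\<dots> = 2 * K2 * r powr (- real m / 2 - 2)"
      by (simp add: mult_ac flip: powr_add)
    also have "\<dots> \<le> 2 * K2 * r powr (-3/2)" using K2(1) by (intro mult_left_mono pm) auto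
    finally have t2: "norm (wA2 m a z * V * V / 2) \<le> 2 * K2 * r powr (-3/2)" .
    have "norm (3 * wA1 m a z * wA1 m a z * V * V * V / 4) =
       3 / 4 * ((norm (wA1 m a z) * norm (wA1 m a z)) * (norm V * norm V * norm V))"
      by (simp add: norm_mult norm_divide)
    also have "\<dots> \<le> 3 / 4 * ((K1 * K1 * r powr (real m - 2)) * (8 * r powr (- real m - real m / 2)))"
      by (intro mult_left_mono mult_mono w11 VVV) (use K1 in auto)
    also have "\<dots> = 6 * K1 * K1 * r powr (- real m / 2 - 2)"
      by (simp add: mult_ac flip: powr_add)
    also have "\<dots> \<le> 6 * K1 * K1 * r powr (-3/2)" using K1(1) by (intro mult_left_mono pm) auto
    finally have t3: "norm (3 * wA1 m a z * wA1 m a z * V * V * V / 4) \<le> 6 * K1 * K1 * r powr (-3/2)" .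
    have "norm (phiA m a lam z) \<le> (2 * K3 + 2 * K2 + 6 * K1 * K1) * r powr (-3/2)"
    proof -
      have "norm (phiA m a lam z) \<le> norm ((Qf m a lam z - wA m a z * wA m a z) * V) + norm (wA2 m a z * V * V / 2)
          + norm (3 * wA1 m a z * wA1 m a z * V * V * V / 4)"
        unfolding phiA_def Let_def V_def[symmetric]
        by (meson norm_triangle_ineq4 norm_triangle_ineq order_trans add_right_mono)
      thus ?thesis using t1 t2 t3 by (simp add: algebra_simps)
    qed
    also have "\<dots> \<le> K * r powr (-3/2)" unfolding K_def using K0 K1 by (intro mult_right_mono) auto
    finally have c: "norm (phiA m a lam z) \<le> K * r powr (-3/2)" .
    have "norm (wA1 m a z / (wA m a z * wA m a z)) = norm (wA1 m a z) * (norm V * norm V)"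
      unfolding V_def by (simp add: norm_divide norm_mult)
    also have "\<dots> \<le> (K1 * r powr (real m / 2 - 1)) * (4 * r powr (- real m))"
      by (intro mult_mono w1 VV) (use K1 in auto)
    also have "\<dots> = 4 * K1 * r powr (- real m / 2 - 1)"
      by (simp add: mult_ac flip: powr_add)
    also have "\<dots> \<le> K * r powr (-1/2)" unfolding K_def
      using K0 K1 K2 K3 by (intro mult_mono pm) auto
    finally have d: "norm (wA1 m a z / (wA m a z * wA m a z)) \<le> K * r powr (-1/2)" .
    note B1
    also have "K0 * r powr (-1) \<le> K * r powr (-1/2)" unfolding K_def
      using K0 K1 K2 K3 by (intro mult_mono pm) auto
    finally have b: "norm (Bz m a z - 1) \<le> K * r powr (-1/2)" .
    show ?thesis using B2 b c d unfolding r_def by blast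
  qed
  have "K \<ge> 0" unfolding K_def using K0 K1 K2 K3 by auto
  moreover have "R \<ge> 1" unfolding R_def by simp
  ultimately show ?thesis using main by blast
qed

lemma Bz_not_nonpos: "norm (Bz m a z - 1) \<le> 1/2 \<Longrightarrow> Bz m a z \<notin> \<real>\<^sub>\<le>\<^sub>0"
proof
  assume "norm (Bz m a z - 1) \<le> 1/2" "Bz m a z \<in> \<real>\<^sub>\<le>\<^sub>0"
  thus False using abs_Re_le_cmod[of "Bz m a z - 1"] by (auto simp: complex_nonpos_Reals_iff)
qed

lemma wA_nonzero: "z \<noteq> 0 \<Longrightarrow> Bz m a z \<noteq> 0 \<Longrightarrow> wA m a z \<noteq> 0"
  by (simp add: wA_def zp_def Bz_def)

lemma system_along_path:
  assumes g: "(\<gamma> has_vector_derivative c) (at x)"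
    and dom: "\<gamma> x \<notin> \<real>\<^sub>\<le>\<^sub>0" "Bz m a (\<gamma> x) \<notin> \<real>\<^sub>\<le>\<^sub>0"
    and sol: "is_solution m a lam y"
  defines "\<phi> \<equiv> c * phiA m a lam (\<gamma> x)" and "\<alpha> \<equiv> \<lambda>x. alphaA m a y (\<gamma> x)" and "\<beta> \<equiv> \<lambda>x. betaA m a y (\<gamma> x)"
  shows "(\<alpha> has_vector_derivative - \<phi> * (\<alpha> x + \<beta> x) / 2) (at x)"
    and "(\<beta> has_vector_derivative 2 * (c * wA m a (\<gamma> x)) * \<beta> x + \<phi> * (\<alpha> x + \<beta> x) / 2) (at x)"
    and "((\<lambda>x. xiA m a (\<gamma> x)) has_vector_derivative c * wA m a (\<gamma> x)) (at x)"
proof -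
  have hol: "y holomorphic_on UNIV" and ode: "\<And>z. deriv (deriv y) z = Qf m a lam z * y z"
    using sol unfolding is_solution_def by auto
  have w0: "wA m a (\<gamma> x) \<noteq> 0" using dom by (intro wA_nonzero) auto
  note ch = field_vector_diff_chain_at[OF g, unfolded o_def]
  show "((\<lambda>x. xiA m a (\<gamma> x)) has_vector_derivative c * wA m a (\<gamma> x)) (at x)"
    by (rule ch[OF xiA_deriv[OF dom(1)]])
  have dV: "((\<lambda>z. 1 / wA m a z) has_field_derivative - (wA1 m a (\<gamma> x) * (1 / wA m a (\<gamma> x)) * (1 / wA m a (\<gamma> x)))) (at (\<gamma> x))"
    using DERIV_divide[OF DERIV_const[of 1] wA_derivs(1)[OF dom(1), of m a] w0] by simp
  note sys = wkb_system[where y = "\<lambda>x. y (\<gamma> x)" and ?y1.0 = "\<lambda>x. deriv y (\<gamma> x)" and w = "\<lambda>x. wA m a (\<gamma> x)"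
    and ?w1.0 = "\<lambda>x. wA1 m a (\<gamma> x)" and V = "\<lambda>x. 1 / wA m a (\<gamma> x)" and D = "\<lambda>x. dA m a (\<gamma> x)"
    and x = x and c = c and Q = "Qf m a lam (\<gamma> x)" and ?w2.0 = "wA2 m a (\<gamma> x)"]
  have p: "wA m a (\<gamma> x) * (1 / wA m a (\<gamma> x)) = 1" using w0 by simp
  have q1: "((\<lambda>x. y (\<gamma> x)) has_vector_derivative c * deriv y (\<gamma> x)) (at x)"
    by (rule ch[OF entire_derivs(1)[OF hol]])
  have q2: "((\<lambda>x. deriv y (\<gamma> x)) has_vector_derivative c * (Qf m a lam (\<gamma> x) * y (\<gamma> x))) (at x)"
    using ch[OF entire_derivs(2)[OF hol]] unfolding ode .
  have q3: "((\<lambda>x. wA1 m a (\<gamma> x)) has_vector_derivative c * wA2 m a (\<gamma> x)) (at x)"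
    by (rule ch[OF wA_derivs(2)[OF dom(1)]])
  have q4: "((\<lambda>x. dA m a (\<gamma> x)) has_vector_derivative c * ((wA m a (\<gamma> x) + wA1 m a (\<gamma> x) * (1 / wA m a (\<gamma> x)) / 2) * dA m a (\<gamma> x))) (at x)"
    by (rule ch[OF dA_deriv[OF dom]])
  have q5: "((\<lambda>x. 1 / wA m a (\<gamma> x)) has_vector_derivative - (c * (wA1 m a (\<gamma> x) * (1 / wA m a (\<gamma> x)) * (1 / wA m a (\<gamma> x))))) (at x)"
    using ch[OF dV] by simp
  note r = sys[OF p q1 q2 q3 q4 q5]
  show "(\<alpha> has_vector_derivative - \<phi> * (\<alpha> x + \<beta> x) / 2) (at x)"
    using r(1) unfolding \<alpha>_def \<beta>_def \<phi>_def alphaA_def betaA_def phiA_def Let_def .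
  show "(\<beta> has_vector_derivative 2 * (c * wA m a (\<gamma> x)) * \<beta> x + \<phi> * (\<alpha> x + \<beta> x) / 2) (at x)"
    using r(2) unfolding \<alpha>_def \<beta>_def \<phi>_def alphaA_def betaA_def phiA_def Let_def .
qed

section \<open>Transport of asymptotics along paths\<close>

text \<open>The projection of both summands onto the bisector of their angle has length at least
  \<open>cos (\<tau> / 2) * (p + q)\<close>. In squares, the defect is a multiple of
  \<open>(p - q)\<^sup>2\<close>. The bound serves for segments in the plane of
  \<open>z powr n\<close> and for the sum of \<open>lam\<close> and x^m.\<close>

lemma norm_cis_add_ge:
  assumes "\<bar>t\<bar> \<le> \<tau>" "\<tau> \<le> pi" "p \<ge> 0" "q \<ge> 0"
  shows "norm (of_real p * cis t + of_real q) \<ge> cos (\<tau> / 2) * (p + q)"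
proof -
  define c where "c = cos (\<tau> / 2)"
  have c0: "c \<ge> 0" unfolding c_def using assms by (intro cos_ge_zero) auto
  have c1: "c\<^sup>2 \<le> 1" unfolding c_def by (simp add: abs_square_le_1)
  have "cos \<tau> = 2 * c\<^sup>2 - 1" unfolding c_def using cos_double_cos[of "\<tau> / 2"] by simp
  moreover have "cos \<tau> \<le> cos \<bar>t\<bar>" using assms by (intro cos_monotone_0_pi_le) auto
  ultimately have ct: "cos t \<ge> 2 * c\<^sup>2 - 1" by simp
  have "(norm (of_real p * cis t + of_real q))\<^sup>2 = (p * cos t + q)\<^sup>2 + (p * sin t)\<^sup>2"
    by (simp add: cmod_power2)
  also have "\<dots> = p\<^sup>2 * ((sin t)\<^sup>2 + (cos t)\<^sup>2) + q\<^sup>2 + 2 * (p * q) * cos t"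
    by algebra
  also have "\<dots> = p\<^sup>2 + q\<^sup>2 + 2 * (p * q) * cos t" by (simp only: sin_cos_squared_add mult_1_right)
  finally have e: "(norm (of_real p * cis t + of_real q))\<^sup>2 = p\<^sup>2 + q\<^sup>2 + 2 * (p * q) * cos t" .
  have "(c * (p + q))\<^sup>2 = p\<^sup>2 + q\<^sup>2 + 2 * (p * q) * (2 * c\<^sup>2 - 1) - (1 - c\<^sup>2) * (p - q)\<^sup>2"
    by (simp add: power2_eq_square algebra_simps)
  also have "\<dots> \<le> p\<^sup>2 + q\<^sup>2 + 2 * (p * q) * (2 * c\<^sup>2 - 1)" using c1 by simp
  also have "\<dots> \<le> p\<^sup>2 + q\<^sup>2 + 2 * (p * q) * cos t"
    using ct assms by (intro add_left_mono mult_left_mono) auto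
  finally have "(c * (p + q))\<^sup>2 \<le> (norm (of_real p * cis t + of_real q))\<^sup>2" unfolding e .
  thus ?thesis unfolding c_def[symmetric] by (rule power2_le_imp_le) simp
qed

lemma Re_cis_mult_nonneg:
  assumes "norm (u - 1) \<le> cos \<beta>"
  shows "Re (cis \<beta> * u) \<ge> 0"
proof -
  have "Re (cis \<beta> * u) = cos \<beta> + Re (cis \<beta> * (u - 1))" by (simp add: algebra_simps)
  moreover have "\<bar>Re (cis \<beta> * (u - 1))\<bar> \<le> norm (u - 1)"
    using abs_Re_le_cmod[of "cis \<beta> * (u - 1)"] by (simp add: norm_mult)
  ultimately show ?thesis using assms by linarith
qed

lemma exp_not_nonpos_Reals:
  assumes "\<bar>Im w\<bar> < pi"
  shows "exp w \<notin> \<real>\<^sub>\<le>\<^sub>0"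
proof
  assume n: "exp w \<in> \<real>\<^sub>\<le>\<^sub>0"
  have "Ln (exp w) = w" using assms by (intro Ln_exp) auto
  moreover have "Re (exp w) < 0"
    using n exp_not_eq_zero[of w] by (auto simp: complex_nonpos_Reals_iff complex_eq_iff order_le_less simp del: exp_not_eq_zero)
  ultimately show False using n assms Im_Ln_eq_pi[of "exp w"] by (auto simp: complex_nonpos_Reals_iff)
qed

definition transported where
  "transported m a y B z z' \<longleftrightarrow>
     (let N = (norm (alphaA m a y z') + norm (betaA m a y z')) * B
      in norm (alphaA m a y z - alphaA m a y z') \<le> N \<and> norm (betaA m a y z) \<le> norm (betaA m a y z') + N)"

text \<open>The path is \<open>cis \<psi> * \<sigma> powr (1/n)\<close> with \<open>n = (m + 2)/2\<close> and \<open>\<sigma>\<close> on the segment from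
  \<open>(cis (- \<psi>) * z) powr n\<close> to a large positive number: on it the differential of the phase is a
  positive multiple of \<open>cis (n * \<psi>)\<close> times a number near \<open>1\<close>, and \<open>\<bar>n * \<psi>\<bar> < pi/2\<close>.\<close>

lemma transport:
  assumes m: "m \<ge> 3" and psi: "\<bar>\<psi>\<bar> < pi / (real m + 2)" and eps: "\<epsilon> > 0"
  shows "\<exists>C\<ge>0. \<exists>R\<ge>1. \<forall>z. \<bar>Arg z - \<psi>\<bar> \<le> 2 * pi / (real m + 2) - \<epsilon> \<and> norm z \<ge> R \<longrightarrow>
     (\<exists>X0. \<forall>X\<ge>X0. \<forall>y. is_solution m a lam y \<longrightarrow>
        transported m a y (C * norm z powr (-1/2)) z (cis \<psi> * of_real X))"
proof -
  define n where "n = (real m + 2) / 2"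
  have n: "n > 0" "n \<ge> 5/2" unfolding n_def using m by auto
  have m2: "real m / 2 + 1 = n" unfolding n_def by simp
  \<comment> \<open>Largest angle, measured in the variable \<open>z powr n\<close>, between the
    starting point and the ray. It is below \<open>pi\<close>, so the segment joining them misses
    the negative axis.\<close>
  define \<tau> where "\<tau> = pi - n * \<epsilon>"
  define b where "b = n * \<psi>"
  have tau: "\<tau> < pi" unfolding \<tau>_def using n eps by simp
  define c where "c = cos b"
  have "\<bar>b\<bar> < pi / 2" 
  proof -
    have "\<bar>b\<bar> = n * \<bar>\<psi>\<bar>" unfolding b_def using n by (simp add: abs_mult)
    also have "\<dots> < n * (pi / (real m + 2))" using psi n by (intro mult_strict_left_mono) auto
    also have "\<dots> = pi / 2" unfolding n_def by (simp add: field_simps)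
    finally show ?thesis .
  qed
  hence c0: "c > 0" unfolding c_def by (intro cos_gt_zero_pi) auto
  have c1: "c \<le> 1" unfolding c_def by simp
  show ?thesis
  \<comment> \<open>For negative \<open>\<tau>\<close> no point satisfies the condition on the
    argument.\<close>
  proof (cases "\<tau> < 0")
    case True
    have "\<not> \<bar>x\<bar> \<le> 2 * pi / (real m + 2) - \<epsilon>" for x
    proof -
      have "2 * pi / (real m + 2) = pi / n" unfolding n_def by (simp add: field_simps)
      moreover have "pi / n < \<epsilon>" using True n unfolding \<tau>_def by (simp add: field_simps)
      ultimately show ?thesis by linarith
    qed
    thus ?thesis by (intro exI[of _ 0] conjI exI[of _ 1]) auto
  next
    case False
    define s0 where "s0 = cos (\<tau> / 2)"
    have s0: "s0 > 0" unfolding s0_def using False tau by (intro cos_gt_zero_pi) auto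
    obtain K R1 where K: "K \<ge> 0" and R1: "R1 \<ge> 1" and bd: "\<And>z. norm z \<ge> R1 \<Longrightarrow>
       norm (Bz m a z - 1) \<le> 1/2 \<and> norm (phiA m a lam z) \<le> K * norm z powr (-3/2)"
      using wA_bounds[OF m, of a lam] by blast
    obtain K0 where K0: "K0 \<ge> 0" "\<And>z. norm z \<ge> 1 \<Longrightarrow> norm (Bz m a z - 1) \<le> K0 / norm z"
      using Bz_near_one by blast
    \<comment> \<open>Beyond \<open>R2\<close>, \<open>Bz\<close> differs from 1 by at most a third
      of \<open>cos b\<close>. The rest of \<open>cos b\<close> is left for the factor
      \<open>1 - (p / T) * cis t\<close> in the differential of the phase.\<close>
    define R2 where "R2 = max R1 (3 * K0 / c)"
    have Bc: "norm (Bz m a z - 1) \<le> c / 3" if "norm z \<ge> R2" for z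
    proof -
      have z: "norm z \<ge> 1" "norm z \<ge> 3 * K0 / c" using that R1 unfolding R2_def by auto
      have "norm z > 0" using z by linarith
      hence "K0 / norm z \<le> c / 3" using z c0 by (simp add: field_simps)
      thus ?thesis using K0(2)[OF z(1)] by linarith
    qed
    have R2: "R2 \<ge> 1" "R2 \<ge> R1" unfolding R2_def using R1 by auto
    \<comment> \<open>\<open>K / n\<close> comes from the bound on \<open>phiA\<close> and the n-th
      root, 2 from \<open>norm c' \<le> 2 * (T - p)\<close>, and the power of \<open>s0\<close> from
      \<open>norm (\<sigma> u) \<ge> s0 * s u\<close>.\<close>
    define C1 where "C1 = 2 * K / n * s0 powr (-1 / (2 * n) - 1)"
    have C1: "C1 \<ge> 0" unfolding C1_def using K n by auto
    define C where "C = 2 * n * C1"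
    have C: "C \<ge> 0" unfolding C_def using C1 n by auto
    \<comment> \<open>The second entry keeps the whole path outside radius \<open>R2\<close>; the
      third makes \<open>C * norm z powr (-1/2)\<close> at most 1/2, as the a priori estimate
      demands.\<close>
    define R where "R = max 1 (max (R2 / s0 powr (1 / n)) ((2 * C)\<^sup>2))"
    show ?thesis
    proof (rule exI[of _ C], intro conjI C, rule exI[of _ R], intro conjI allI impI)
      show "R \<ge> 1" unfolding R_def by simp
      fix z assume "\<bar>Arg z - \<psi>\<bar> \<le> 2 * pi / (real m + 2) - \<epsilon> \<and> norm z \<ge> R"
      hence za: "\<bar>Arg z - \<psi>\<bar> \<le> 2 * pi / (real m + 2) - \<epsilon>" and zR: "norm z \<ge> R" by auto
      have z0: "z \<noteq> 0" using zR unfolding R_def by auto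
      define t where "t = n * (Arg z - \<psi>)"
      have t: "\<bar>t\<bar> \<le> \<tau>"
      proof -
        have "\<bar>t\<bar> = n * \<bar>Arg z - \<psi>\<bar>" unfolding t_def using n by (simp add: abs_mult)
        also have "\<dots> \<le> n * (2 * pi / (real m + 2) - \<epsilon>)" using za n by (intro mult_left_mono) auto
        also have "\<dots> = \<tau>" unfolding \<tau>_def n_def by (simp add: field_simps)
        finally show ?thesis .
      qed
      define p where "p = norm z powr n"
      have p: "p > 0" unfolding p_def using z0 by simp
      \<comment> \<open>Chosen so that \<open>3 * p \<le> T * c\<close>: the end point is so remote
        that the direction of the segment is nearly that of the positive axis.\<close>
      define X0 where "X0 = max 1 ((3 * p / c) powr (1 / n))"
      show "\<exists>X0. \<forall>X\<ge>X0. \<forall>y. is_solution m a lam y \<longrightarrow>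
        transported m a y (C * norm z powr (-1/2)) z (cis \<psi> * of_real X)"
      proof (intro exI[of _ X0] allI impI)
        fix X y assume X: "X0 \<le> X" and sol: "is_solution m a lam y"
        define T where "T = X powr n"
        have X1: "X \<ge> 1" using X unfolding X0_def by auto
        have T: "3 * p / c \<le> T"
        proof -
          have "3 * p / c = ((3 * p / c) powr (1 / n)) powr n" using p c0 n by (simp add: powr_powr)
          also have "\<dots> \<le> X powr n" using X n unfolding X0_def by (intro powr_mono2) auto
          finally show ?thesis unfolding T_def .
        qed
        hence Tp: "3 * p \<le> T * c" using c0 by (simp add: divide_le_eq)
        moreover have T0: "T > 0" unfolding T_def using X1 by simp
        ultimately have Tp3: "3 * p \<le> T" using c1 by (smt (verit) mult_left_le)
        define \<sigma> where "\<sigma> = (\<lambda>u. of_real (1 - u) * (of_real p * cis t) + of_real (u * T) :: complex)"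
        define c' where "c' = of_real T - of_real p * cis t"
        define s where "s = (\<lambda>u. (1 - u) * p + u * T)"
        have s_ge: "s u \<ge> p" if "u \<in> {0..1}" for u
        proof -
          have "s u - p = u * (T - p)" unfolding s_def by (simp add: algebra_simps)
          also have "\<dots> \<ge> 0" using that Tp3 p by auto
          finally show ?thesis by simp
        qed
        \<comment> \<open>The additional \<open>q\<close> serves to exclude the cut: were
          \<open>\<sigma> u\<close> equal to \<open>- q\<close>, the left side would vanish.\<close>
        have low: "norm (\<sigma> u + of_real q) \<ge> s0 * (s u + q)" if "u \<in> {0..1}" "q \<ge> 0" for u q
          using norm_cis_add_ge[OF t, of "(1 - u) * p" "u * T + q"] tau that p T0
          unfolding s0_def \<sigma>_def s_def by (simp add: algebra_simps)
        have sig: "norm (\<sigma> u) \<ge> s0 * s u" if "u \<in> {0..1}" for u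
          using low[OF that, of 0] by simp
        have sig0: "\<sigma> u \<notin> \<real>\<^sub>\<le>\<^sub>0" if u: "u \<in> {0..1}" for u
        proof
          assume "\<sigma> u \<in> \<real>\<^sub>\<le>\<^sub>0"
          then obtain q where q: "\<sigma> u = of_real q" "q \<le> 0" by (auto elim: nonpos_Reals_cases)
          hence "\<sigma> u + of_real (- q) = 0" by simp
          moreover have "s0 * (s u + (- q)) > 0" using s0 s_ge[OF u] p q by (intro mult_pos_pos) auto
          ultimately show False using low[OF u, of "- q"] q by simp
        qed
        define \<gamma> where "\<gamma> = (\<lambda>u. cis \<psi> * exp (Ln (\<sigma> u) / of_real n))"
        define L where "L = (\<lambda>u. \<i> * of_real \<psi> + Ln (\<sigma> u) / of_real n)"
        have gL: "\<gamma> u = exp (L u)" for u unfolding \<gamma>_def L_def by (simp add: exp_add cis_conv_exp)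
        have ImL: "\<bar>Im (L u)\<bar> < pi" if u: "u \<in> {0..1}" for u
        proof -
          have "\<bar>Im (Ln (\<sigma> u) / of_real n)\<bar> \<le> pi / n"
          proof -
            have "\<bar>Im (Ln (\<sigma> u))\<bar> \<le> pi"
              using sig0[OF u] mpi_less_Im_Ln[of "\<sigma> u"] Im_Ln_le_pi[of "\<sigma> u"] by fastforce
            thus ?thesis using n by (simp add: Im_divide_of_real abs_divide divide_right_mono)
          qed
          moreover have "pi / n = 2 * (pi / (real m + 2))" unfolding n_def by simp
          \<comment> \<open>\<open>\<psi>\<close> contributes less than \<open>pi / (m + 2)\<close>
            and the n-th root at most twice that, so the argument of the path never leaves the
            principal range and no branch jump occurs.\<close>
          moreover have "3 * (pi / (real m + 2)) < pi" using m by (simp add: divide_less_eq)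
          moreover have "Im (L u) = \<psi> + Im (Ln (\<sigma> u) / of_real n)" unfolding L_def by simp
          ultimately show ?thesis using psi by linarith
        qed
        have LnG: "Ln (\<gamma> u) = L u" if "u \<in> {0..1}" for u
          unfolding gL using ImL[OF that] by (intro Ln_exp) auto
        have gnp: "\<gamma> u \<notin> \<real>\<^sub>\<le>\<^sub>0" if "u \<in> {0..1}" for u unfolding gL by (rule exp_not_nonpos_Reals[OF ImL[OF that]])
        have gn: "norm (\<gamma> u) = norm (\<sigma> u) powr (1 / n)" if "u \<in> {0..1}" for u
        proof -
          have "\<sigma> u \<noteq> 0" using sig0[OF that] by auto
          thus ?thesis unfolding \<gamma>_def
            by (simp add: norm_mult norm_exp_eq_Re powr_def Re_divide_of_real)
        qed
        have gR: "norm (\<gamma> u) \<ge> R2" if u: "u \<in> {0..1}" for u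
        proof -
          have "R2 \<le> s0 powr (1 / n) * norm z"
          proof -
            have "R2 / s0 powr (1 / n) \<le> norm z" using zR unfolding R_def by auto
            thus ?thesis using s0 by (simp add: divide_le_eq mult.commute)
          qed
          also have "\<dots> = (s0 * p) powr (1 / n)"
            unfolding p_def using s0 n by (simp add: powr_mult powr_powr)
          also have "\<dots> \<le> norm (\<sigma> u) powr (1 / n)"
            using sig[OF u] s_ge[OF u] s0 p n by (intro powr_mono2) (auto intro: order_trans[rotated])
          finally show ?thesis unfolding gn[OF u] .
        qed
        have dsig: "(\<sigma> has_vector_derivative c') (at u)" for u
          unfolding \<sigma>_def c'_def by (auto intro!: derivative_eq_intros simp: algebra_simps)
        define g' where "g' = (\<lambda>u. \<gamma> u * c' / (of_real n * \<sigma> u))"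
        have dgam: "(\<gamma> has_vector_derivative g' u) (at u)" if u: "u \<in> {0..1}" for u
        proof -
          have s: "\<sigma> u \<noteq> 0" using sig0[OF u] by auto
          have "((\<lambda>w. cis \<psi> * exp (Ln w / of_real n)) has_field_derivative
              \<gamma> u / (of_real n * \<sigma> u)) (at (\<sigma> u))"
            unfolding \<gamma>_def
            by (rule derivative_eq_intros refl sig0[OF u] | use s n in \<open>simp add: field_simps\<close>)+
          from field_vector_diff_chain_at[OF dsig this] show ?thesis
            unfolding o_def g'_def \<gamma>_def by (simp add: mult.commute)
        qed
        have wg: "g' u * wA m a (\<gamma> u) = cis b * c' * Bz m a (\<gamma> u) / of_real n" if u: "u \<in> {0..1}" for u
        proof -
          have s: "\<sigma> u \<noteq> 0" using sig0[OF u] by auto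
          have g0: "\<gamma> u \<noteq> 0" unfolding gL by simp
          have "\<gamma> u powr of_real (real m / 2) * \<gamma> u = \<gamma> u powr of_real n"
            unfolding m2[symmetric] using g0 by (simp add: powr_add)
          also have "\<dots> = cis b * \<sigma> u"
            unfolding powr_def LnG[OF u] L_def b_def using g0 s n
            by (simp add: ring_distribs exp_add cis_conv_exp mult_ac)
          finally have e: "\<gamma> u powr of_real (real m / 2) * \<gamma> u = cis b * \<sigma> u" .
          have "g' u * wA m a (\<gamma> u) = (\<gamma> u powr of_real (real m / 2) * \<gamma> u) * c' * Bz m a (\<gamma> u) / (of_real n * \<sigma> u)"
            unfolding g'_def wA_def zp_def Bz_def by simp
          thus ?thesis unfolding e using s by simp
        qed
        have Rew: "Re (g' u * wA m a (\<gamma> u)) \<ge> 0" if u: "u \<in> {0..1}" for u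
        proof -
          define v where "v = (1 - of_real (p / T) * cis t) * Bz m a (\<gamma> u)"
          have B: "norm (Bz m a (\<gamma> u) - 1) \<le> c / 3" by (rule Bc[OF gR[OF u]])
          have pT: "p / T \<le> c / 3" using Tp T0 by (simp add: divide_le_eq mult.commute)
          have "v - 1 = (Bz m a (\<gamma> u) - 1) - of_real (p / T) * cis t * (1 + (Bz m a (\<gamma> u) - 1))"
            unfolding v_def by (simp add: algebra_simps)
          hence "norm (v - 1) \<le> norm (Bz m a (\<gamma> u) - 1) + norm (of_real (p / T) * cis t * (1 + (Bz m a (\<gamma> u) - 1)))"
            by (metis norm_triangle_ineq4)
          also have "norm (of_real (p / T) * cis t * (1 + (Bz m a (\<gamma> u) - 1))) =
              (p / T) * norm (1 + (Bz m a (\<gamma> u) - 1))" using p T0 by (simp add: norm_mult norm_divide)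
          also have "\<dots> \<le> (c / 3) * (1 + c / 3)"
            by (intro mult_mono pT order_trans[OF norm_triangle_ineq]) (use B p T0 c0 in auto)
          also have "(c / 3) * (1 + c / 3) \<le> c / 3 * 2"
            using c0 c1 by (intro mult_left_mono) auto
          finally have "norm (v - 1) \<le> c" using B by simp
          hence R0: "Re (cis b * v) \<ge> 0" unfolding c_def by (rule Re_cis_mult_nonneg)
          have "g' u * wA m a (\<gamma> u) = of_real (T / n) * (cis b * v)"
          proof -
            have "of_real T * v = c' * Bz m a (\<gamma> u)"
              unfolding v_def c'_def using T0 by (simp add: field_simps)
            thus ?thesis unfolding wg[OF u] by (simp add: mult_ac)
          qed
          hence "g' u * wA m a (\<gamma> u) = (T / n) *\<^sub>R (cis b * v)" by (simp only: scaleR_conv_of_real)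
          hence "Re (g' u * wA m a (\<gamma> u)) = (T / n) * Re (cis b * v)" by (simp only: scaleR_complex.sel)
          thus ?thesis using R0 T0 n by simp
        qed
        \<comment> \<open>The bound on \<open>phiA\<close> times the modulus of the path is of order
          \<open>norm (\<gamma> u) powr (-1/2)\<close>, which is
          \<open>norm (\<sigma> u) powr e\<close>.\<close>
        define e where "e = -1 / (2 * n)"
        define k where "k = (\<lambda>u. C1 * s u powr (e - 1) * (T - p))"
        define KK where "KK = (\<lambda>u. C1 / e * s u powr e)"
        have e0: "e < 0" unfolding e_def using n by simp
        have dK: "(KK has_real_derivative k u) (at u)" if u: "u \<in> {0..1}" for u
        proof -
          have "s u > 0" using s_ge[OF u] p by linarith
          moreover have "(s has_real_derivative (T - p)) (at u)"
            unfolding s_def by (auto intro!: derivative_eq_intros)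
          ultimately show ?thesis unfolding KK_def k_def using e0
            by (auto intro!: derivative_eq_intros simp: powr_diff)
        qed
        have phi: "norm (g' u * phiA m a lam (\<gamma> u)) \<le> k u" if u: "u \<in> {0..1}" for u
        proof -
          have su: "s u > 0" using s_ge[OF u] p by linarith
          have sn: "norm (\<sigma> u) > 0" using sig0[OF u] by auto
          have "norm (phiA m a lam (\<gamma> u)) \<le> K * norm (\<gamma> u) powr (-3/2)"
            using bd[of "\<gamma> u"] gR[OF u] R2 by auto
          hence "norm (g' u * phiA m a lam (\<gamma> u)) \<le> norm (g' u) * (K * norm (\<gamma> u) powr (-3/2))"
            unfolding norm_mult by (intro mult_left_mono) auto
          also have "\<dots> = K / n * norm c' * (norm (\<gamma> u) powr 1 * norm (\<gamma> u) powr (-3/2)) / norm (\<sigma> u) powr 1"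
            unfolding g'_def using n sn by (simp add: norm_mult norm_divide)
          also have "norm (\<gamma> u) powr 1 * norm (\<gamma> u) powr (-3/2) = norm (\<sigma> u) powr e"
            unfolding gn[OF u] e_def by (simp add: powr_powr flip: powr_add)
          also have "K / n * norm c' * norm (\<sigma> u) powr e / norm (\<sigma> u) powr 1 = K / n * norm c' * norm (\<sigma> u) powr (e - 1)"
            by (simp add: powr_diff)
          also have "\<dots> \<le> K / n * (2 * (T - p)) * (s0 * s u) powr (e - 1)"
          proof (intro mult_mono mult_left_mono)
            have "norm c' \<le> T + p" unfolding c'_def using T0 p
              by (intro order_trans[OF norm_triangle_ineq4]) (simp add: norm_mult)
            thus "norm c' \<le> 2 * (T - p)" using Tp3 by simp
            show "norm (\<sigma> u) powr (e - 1) \<le> (s0 * s u) powr (e - 1)"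
              using sig[OF u] s0 su e0 by (intro powr_mono2') auto
          qed (use K n Tp3 p in auto)
          also have "\<dots> = k u" unfolding k_def C1_def e_def using s0 su by (simp add: powr_mult)
          finally show ?thesis .
        qed
        have KK1: "KK 1 - KK 0 \<le> C * norm z powr (-1/2)"
        proof -
          have "KK 1 \<le> 0" unfolding KK_def using C1 e0 by (simp add: divide_nonneg_neg mult_nonpos_nonneg divide_nonneg_nonpos)
          moreover have "- KK 0 = C * norm z powr (-1/2)"
            unfolding KK_def s_def p_def C_def e_def using n by (simp add: powr_powr)
          ultimately show ?thesis by linarith
        qed
        have "C * norm z powr (-1/2) \<le> 1/2"
        proof -
          have "(2 * C)\<^sup>2 \<le> norm z" using zR unfolding R_def by auto
          hence "2 * C \<le> sqrt (norm z)" using C by (simp add: real_le_rsqrt)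
          hence "C / sqrt (norm z) \<le> 1/2" using z0 by (simp add: divide_le_eq)
          moreover have "norm z powr (-1/2) = 1 / sqrt (norm z)"
            using z0 powr_minus_divide[of "norm z" "1/2"] by (simp add: powr_half_sqrt)
          ultimately show ?thesis by simp
        qed
        hence small: "KK 1 - KK 0 \<le> 1/2" using KK1 by linarith
        have Bn: "Bz m a (\<gamma> u) \<notin> \<real>\<^sub>\<le>\<^sub>0" if u: "u \<in> {0..1}" for u
          using bd[of "\<gamma> u"] gR[OF u] R2 by (intro Bz_not_nonpos) auto
        note sys = system_along_path[OF dgam gnp Bn sol]
        define \<alpha> where "\<alpha> = (\<lambda>u. alphaA m a y (\<gamma> u))"
        define \<beta> where "\<beta> = (\<lambda>u. betaA m a y (\<gamma> u))"
        define N where "N = norm (\<alpha> 1) + norm (\<beta> 1)"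
        have est: "norm (\<alpha> 0 - \<alpha> 1) \<le> N * (KK 1 - KK 0)" "norm (\<beta> 0) \<le> norm (\<beta> 1) + N * (KK 1 - KK 0)"
          unfolding N_def
          using wkb_apriori[of 0 1 \<alpha> "\<lambda>u. g' u * phiA m a lam (\<gamma> u)" \<beta> "\<lambda>u. g' u * wA m a (\<gamma> u)"
              "\<lambda>u. xiA m a (\<gamma> u)" KK k, OF _ _ _ _ Rew dK phi small] sys
          unfolding \<alpha>_def \<beta>_def by auto
        have "N * (KK 1 - KK 0) \<le> N * (C * norm z powr (-1/2))"
          unfolding N_def using KK1 by (intro mult_left_mono) auto
        moreover have g0: "\<gamma> 0 = z"
        proof -
          have tp: "\<bar>t\<bar> < pi" using t tau by linarith
          have "\<sigma> 0 = exp (of_real (ln p) + \<i> * of_real t)"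
            unfolding \<sigma>_def using p by (simp add: exp_add cis_conv_exp exp_of_real)
          hence "Ln (\<sigma> 0) = of_real (ln p) + \<i> * of_real t" using tp by (simp add: Ln_exp)
          hence "L 0 = of_real (ln (norm z)) + \<i> * of_real (Arg z)"
            unfolding L_def p_def t_def using n z0 by (simp add: ln_powr field_simps)
          thus ?thesis unfolding gL using z0 Arg_eq[OF z0] by (simp add: exp_add exp_of_real mult.commute)
        qed
        moreover have g1: "\<gamma> 1 = cis \<psi> * of_real X"
        proof -
          have "Ln (\<sigma> 1) = of_real (n * ln X)"
            unfolding \<sigma>_def T_def using X1 by (simp add: Ln_of_real ln_powr)
          thus ?thesis unfolding \<gamma>_def using n X1 by (simp add: exp_of_real)
        qed
        ultimately show "transported m a y (C * norm z powr (-1/2)) z (cis \<psi> * of_real X)"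
          using est unfolding transported_def Let_def N_def \<alpha>_def \<beta>_def g0 g1 by linarith
      qed
    qed
  qed
qed

section \<open>Existence of Sibuya's solution\<close>

definition qpoly :: "nat \<Rightarrow> (nat \<Rightarrow> complex) \<Rightarrow> complex \<Rightarrow> complex poly" where
  "qpoly m a lam = monom 1 m + Ppoly m a + [:lam:]"

lemma poly_qpoly: "poly (qpoly m a lam) z = Qf m a lam z"
  by (simp add: qpoly_def Qf_def poly_monom poly_Ppoly)

lemma deriv_lincomb:
  assumes "c1 holomorphic_on UNIV" "c2 holomorphic_on UNIV"
  shows "deriv (\<lambda>z. A * c1 z + B * c2 z) = (\<lambda>z. A * deriv c1 z + B * deriv c2 z)"
proof
  fix z
  show "deriv (\<lambda>z. A * c1 z + B * c2 z) z = A * deriv c1 z + B * deriv c2 z"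
    by (rule DERIV_imp_deriv DERIV_add DERIV_cmult entire_derivs(1) assms)+
qed

lemma is_solution_lincomb:
  assumes "is_solution m a lam c1" "is_solution m a lam c2"
  shows "is_solution m a lam (\<lambda>z. A * c1 z + B * c2 z)"
proof -
  have h: "c1 holomorphic_on UNIV" "c2 holomorphic_on UNIV"
    and h': "deriv c1 holomorphic_on UNIV" "deriv c2 holomorphic_on UNIV"
    using assms unfolding is_solution_def by (auto intro: holomorphic_deriv)
  show ?thesis using assms h unfolding is_solution_def deriv_lincomb[OF h] deriv_lincomb[OF h']
    by (auto intro!: holomorphic_intros simp: algebra_simps)
qed

lemma betaA_lincomb:
  assumes "c1 holomorphic_on UNIV" "c2 holomorphic_on UNIV"
  shows "betaA m a (\<lambda>z. A * c1 z + B * c2 z) z = A * betaA m a c1 z + B * betaA m a c2 z"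
  unfolding betaA_def Let_def deriv_lincomb[OF assms] by (simp add: algebra_simps add_divide_distrib)

lemma alphaA_lincomb:
  assumes "c1 holomorphic_on UNIV" "c2 holomorphic_on UNIV"
  shows "alphaA m a (\<lambda>z. A * c1 z + B * c2 z) z = A * alphaA m a c1 z + B * alphaA m a c2 z"
  unfolding alphaA_def betaA_lincomb[OF assms] by (simp add: algebra_simps)

text \<open>This is the determinant of the passage from initial values to the diagonal variables.
  Where it does not vanish, \<open>\<alpha>\<close> and \<open>\<beta>\<close> may be prescribed at
  a point, and Cramer's rule recovers a solution from them.\<close>

lemma alpha_beta_det:
  "alphaA m a c1 z * betaA m a c2 z - betaA m a c1 z * alphaA m a c2 z
   = (dA m a z)\<^sup>2 / wA m a z / 2 * (c1 z * deriv c2 z - deriv c1 z * c2 z)"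
  unfolding alphaA_def betaA_def Let_def by (simp add: power2_eq_square algebra_simps add_divide_distrib diff_divide_distrib)

lemma dA_nonzero: "z \<noteq> 0 \<Longrightarrow> Bz m a z \<noteq> 0 \<Longrightarrow> dA m a z \<noteq> 0"
  by (simp add: dA_def)

section \<open>The recessive solution on the positive axis\<close>

definition near_unit where
  "near_unit m a y B z \<longleftrightarrow> norm (alphaA m a y z - 1) \<le> B \<and> norm (betaA m a y z) \<le> B"

lemma tendsto_const_powr_neg_half: "((\<lambda>x. C * x powr (-1/2)) \<longlongrightarrow> 0) at_top" for C :: real
  using tendsto_mult_right_zero[OF tendsto_neg_powr[of "-1/2" "\<lambda>x::real. x" at_top]] by (simp add: filterlim_ident)

text \<open>In \<open>transport\<close> the constant does not depend on the end point X. Solutions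
  normalised at ever more distant points therefore satisfy one and the same bound at each fixed
  point, and this bound survives in the limit of a subsequence.\<close>

lemma recessive_solution_exists:
  assumes m: "m \<ge> 3"
  shows "\<exists>y. is_solution m a lam y \<and>
     ((\<lambda>X. alphaA m a y (of_real X)) \<longlongrightarrow> 1) at_top \<and> ((\<lambda>X. betaA m a y (of_real X)) \<longlongrightarrow> 0) at_top"
proof -
  have pm: "pi / (real m + 2) > 0" by simp
  have pm2: "2 * pi / (real m + 2) - pi / (real m + 2) \<ge> 0" by (simp add: field_simps)
  obtain C R where C: "C \<ge> 0" and R: "R \<ge> 1" and tr: "\<And>z. \<bar>Arg z - 0\<bar> \<le> 2 * pi / (real m + 2) - pi / (real m + 2) \<and> norm z \<ge> R \<Longrightarrow>
     (\<exists>X0. \<forall>X\<ge>X0. \<forall>y. is_solution m a lam y \<longrightarrow>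
        transported m a y (C * norm z powr (-1/2)) z (cis 0 * of_real X))"
    using transport[OF m, of 0 "pi / (real m + 2)" a lam] pm by auto
  obtain R1 where R1: "R1 \<ge> 1" and B1: "\<And>z. norm z \<ge> R1 \<Longrightarrow> norm (Bz m a z - 1) \<le> 1/2"
    using wA_bounds[OF m, of a lam] by blast
  have nz: "dA m a (of_real x) \<noteq> 0" "wA m a (of_real x) \<noteq> 0" if "x \<ge> R1" for x
  proof -
    have "Bz m a (of_real x) \<notin> \<real>\<^sub>\<le>\<^sub>0" using Bz_not_nonpos[OF B1[of "of_real x"]] that R1 by auto
    hence "Bz m a (of_real x) \<noteq> 0" "complex_of_real x \<noteq> 0" using that R1 by auto
    thus "dA m a (of_real x) \<noteq> 0" "wA m a (of_real x) \<noteq> 0" by (rule dA_nonzero[rotated], rule wA_nonzero[rotated])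
  qed
  have tr': "\<exists>X0. \<forall>X\<ge>X0. \<forall>y. is_solution m a lam y \<longrightarrow> alphaA m a y (of_real X) = 1 \<longrightarrow> betaA m a y (of_real X) = 0 \<longrightarrow>
      near_unit m a y (C * x powr (-1/2)) (of_real x)"
    if "x \<ge> R" for x
  proof -
    have "\<bar>Arg (of_real x) - 0\<bar> \<le> 2 * pi / (real m + 2) - pi / (real m + 2) \<and> norm (complex_of_real x) \<ge> R"
      using that R pm2 by (simp add: Arg_of_real)
    from tr[OF this] obtain X0 where X0: "\<And>X y. X \<ge> X0 \<Longrightarrow> is_solution m a lam y \<Longrightarrow>
        transported m a y (C * norm (complex_of_real x) powr (-1/2)) (of_real x) (cis 0 * of_real X)" by blast
    have nx: "norm (complex_of_real x) = x" using that R by simp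
    show ?thesis
    proof (intro exI[of _ X0] allI impI)
      fix X y assume *: "X0 \<le> X" "is_solution m a lam y" "alphaA m a y (of_real X) = 1" "betaA m a y (of_real X) = 0"
      show "near_unit m a y (C * x powr (-1/2)) (of_real x)"
        using X0[OF *(1,2)] unfolding transported_def near_unit_def Let_def nx cis_zero mult_1 *(3,4) by simp
    qed
  qed
  obtain c1 where c1: "is_solution m a lam c1" "c1 0 = 1" "deriv c1 0 = 0"
    using entire_solution_exists[of "qpoly m a lam" 1 0] unfolding poly_qpoly is_solution_def by blast
  obtain c2 where c2: "is_solution m a lam c2" "c2 0 = 0" "deriv c2 0 = 1"
    using entire_solution_exists[of "qpoly m a lam" 0 1] unfolding poly_qpoly is_solution_def by blast
  have h: "c1 holomorphic_on UNIV" "c2 holomorphic_on UNIV" using c1 c2 unfolding is_solution_def by auto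
  have W: "c1 z * deriv c2 z - deriv c1 z * c2 z = 1" for z
    using wronskian_constant[OF h, of "Qf m a lam" z] c1 c2 unfolding is_solution_def by simp
  define \<Delta> where "\<Delta> = (\<lambda>x. (dA m a (of_real x))\<^sup>2 / wA m a (of_real x) / 2)"
  have det: "alphaA m a c1 (of_real x) * betaA m a c2 (of_real x) - betaA m a c1 (of_real x) * alphaA m a c2 (of_real x) = \<Delta> x" for x
    unfolding alpha_beta_det W \<Delta>_def by simp
  have D0: "\<Delta> x \<noteq> 0" if "x \<ge> R1" for x using nz[OF that] unfolding \<Delta>_def by simp
  define x0 where "x0 = max R R1"
  obtain X0 where X0: "\<And>X y. X \<ge> X0 \<Longrightarrow> is_solution m a lam y \<Longrightarrow> alphaA m a y (of_real X) = 1 \<Longrightarrow> betaA m a y (of_real X) = 0 \<Longrightarrow>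
      near_unit m a y (C * x0 powr (-1/2)) (of_real x0)"
    using tr'[of x0] unfolding x0_def by auto
  define T where "T = (\<lambda>k::nat. max X0 R1 + real k)"
  \<comment> \<open>The solution with \<open>\<alpha> = 1\<close> and \<open>\<beta> = 0\<close> at \<open>T k\<close>; its coefficients stay bounded by transport to \<open>x0\<close>.\<close>
  define A where "A = (\<lambda>k. betaA m a c2 (of_real (T k)) / \<Delta> (T k))"
  define B where "B = (\<lambda>k. - betaA m a c1 (of_real (T k)) / \<Delta> (T k))"
  define Y where "Y = (\<lambda>k z. A k * c1 z + B k * c2 z)"
  have Ysol: "is_solution m a lam (Y k)" for k unfolding Y_def by (rule is_solution_lincomb[OF c1(1) c2(1)])
  have T1: "T k \<ge> R1" "T k \<ge> X0" for k unfolding T_def by auto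
  have aY: "alphaA m a (Y k) z = A k * alphaA m a c1 z + B k * alphaA m a c2 z"
    and bY: "betaA m a (Y k) z = A k * betaA m a c1 z + B k * betaA m a c2 z" for k z
    unfolding Y_def by (rule alphaA_lincomb[OF h] betaA_lincomb[OF h])+
  have Yend: "alphaA m a (Y k) (of_real (T k)) = 1" "betaA m a (Y k) (of_real (T k)) = 0" for k
    unfolding aY bY A_def B_def using D0[OF T1(1)[of k]] det[of "T k"] by (simp_all add: field_simps)
  have Tinf: "filterlim T at_top sequentially"
    unfolding T_def by (intro filterlim_tendsto_add_at_top[OF tendsto_const] filterlim_real_sequentially)
  define M where "M = C * x0 powr (-1/2)"
  have M: "norm (alphaA m a (Y k) (of_real x0)) \<le> 1 + M" "norm (betaA m a (Y k) (of_real x0)) \<le> M" for k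
  proof -
    note * = X0[OF T1(2) Ysol Yend, unfolded near_unit_def, of k]
    show "norm (betaA m a (Y k) (of_real x0)) \<le> M" using * unfolding M_def by blast
    have "norm (alphaA m a (Y k) (of_real x0)) \<le> norm (alphaA m a (Y k) (of_real x0) - 1) + norm (1::complex)"
      by (metis norm_triangle_sub add.commute)
    thus "norm (alphaA m a (Y k) (of_real x0)) \<le> 1 + M" using * unfolding M_def by simp
  qed
  have M0: "M \<ge> 0" unfolding M_def using C by simp
  \<comment> \<open>Cramer's rule at the fixed point \<open>x0\<close>; together with the
    transported bounds it confines the coefficients \<open>A k\<close> and \<open>B k\<close> to a
    bounded set.\<close>
  have eqA: "A k * \<Delta> x0 = alphaA m a (Y k) (of_real x0) * betaA m a c2 (of_real x0) - betaA m a (Y k) (of_real x0) * alphaA m a c2 (of_real x0)"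
    and eqB: "B k * \<Delta> x0 = betaA m a (Y k) (of_real x0) * alphaA m a c1 (of_real x0) - alphaA m a (Y k) (of_real x0) * betaA m a c1 (of_real x0)" for k
    unfolding aY bY det[of x0, symmetric] by (simp_all add: algebra_simps)
  have D00: "norm (\<Delta> x0) > 0" using D0[of x0] unfolding x0_def by simp
  have bdd: "norm (p * u - q * v) \<le> (1 + M) * (norm u + norm v)" if "norm p \<le> 1 + M" "norm q \<le> 1 + M" for p q u v :: complex
  proof -
    have "norm (p * u - q * v) \<le> norm p * norm u + norm q * norm v"
      by (metis norm_triangle_ineq4 norm_mult)
    also have "\<dots> \<le> (1 + M) * norm u + (1 + M) * norm v" using that by (intro add_mono mult_right_mono) auto
    finally show ?thesis by (simp add: algebra_simps)
  qed
  define NA where "NA = (1 + M) * (norm (betaA m a c2 (of_real x0)) + norm (alphaA m a c2 (of_real x0))) / norm (\<Delta> x0)"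
  define NB where "NB = (1 + M) * (norm (alphaA m a c1 (of_real x0)) + norm (betaA m a c1 (of_real x0))) / norm (\<Delta> x0)"
  have NA: "norm (A k) \<le> NA" for k
  proof -
    have "norm (A k) * norm (\<Delta> x0) \<le> (1 + M) * (norm (betaA m a c2 (of_real x0)) + norm (alphaA m a c2 (of_real x0)))"
      unfolding norm_mult[symmetric] eqA using M[of k] M0 by (intro bdd) auto
    thus ?thesis unfolding NA_def using D00 by (simp add: field_simps)
  qed
  have NB: "norm (B k) \<le> NB" for k
  proof -
    have "norm (B k) * norm (\<Delta> x0) \<le> (1 + M) * (norm (alphaA m a c1 (of_real x0)) + norm (betaA m a c1 (of_real x0)))"
      unfolding norm_mult[symmetric] eqB using M[of k] M0 by (intro bdd) auto
    thus ?thesis unfolding NB_def using D00 by (simp add: field_simps)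
  qed
  have "bounded (range (\<lambda>k. (A k, B k)))"
  proof (rule boundedI)
    fix p assume "p \<in> range (\<lambda>k. (A k, B k))"
    then obtain k where k: "p = (A k, B k)" by auto
    have "norm p \<le> norm (A k) + norm (B k)" unfolding k by (rule norm_Pair_le)
    thus "norm p \<le> NA + NB" using NA[of k] NB[of k] by linarith
  qed
  then obtain l r where r: "strict_mono r" and lim: "((\<lambda>k. (A k, B k)) \<circ> r) \<longlonglongrightarrow> l"
    using bounded_imp_convergent_subsequence by blast
  have limA: "(\<lambda>k. A (r k)) \<longlonglongrightarrow> fst l" and limB: "(\<lambda>k. B (r k)) \<longlonglongrightarrow> snd l"
    using tendsto_fst[OF lim] tendsto_snd[OF lim] by (simp_all add: o_def)
  define y where "y = (\<lambda>z. fst l * c1 z + snd l * c2 z)"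
  have ysol: "is_solution m a lam y" unfolding y_def by (rule is_solution_lincomb[OF c1(1) c2(1)])
  have est: "near_unit m a y (C * x powr (-1/2)) (of_real x)"
    if x: "x \<ge> R" for x
  proof -
    obtain X1 where X1: "\<And>X y. X \<ge> X1 \<Longrightarrow> is_solution m a lam y \<Longrightarrow> alphaA m a y (of_real X) = 1 \<Longrightarrow> betaA m a y (of_real X) = 0 \<Longrightarrow>
      near_unit m a y (C * x powr (-1/2)) (of_real x)"
      using tr'[OF x] by auto
    have "filterlim (\<lambda>k. T (r k)) at_top sequentially"
      by (rule filterlim_compose[OF Tinf filterlim_subseq[OF r]])
    hence ev: "eventually (\<lambda>k. T (r k) \<ge> X1) sequentially" by (simp add: filterlim_at_top)
    have la: "(\<lambda>k. alphaA m a (Y (r k)) (of_real x) - 1) \<longlonglongrightarrow> alphaA m a y (of_real x) - 1"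
      unfolding aY y_def alphaA_lincomb[OF h] by (intro tendsto_intros limA limB)
    have lb: "(\<lambda>k. betaA m a (Y (r k)) (of_real x)) \<longlonglongrightarrow> betaA m a y (of_real x)"
      unfolding bY y_def betaA_lincomb[OF h] by (intro tendsto_intros limA limB)
    have "eventually (\<lambda>k. norm (alphaA m a (Y (r k)) (of_real x) - 1) \<le> C * x powr (-1/2)) sequentially"
      "eventually (\<lambda>k. norm (betaA m a (Y (r k)) (of_real x)) \<le> C * x powr (-1/2)) sequentially"
      using ev by (eventually_elim, use X1[OF _ Ysol Yend, unfolded near_unit_def] in blast)+
    thus ?thesis unfolding near_unit_def using Lim_norm_ubound[OF _ la] Lim_norm_ubound[OF _ lb] by auto
  qed
  have e1: "eventually (\<lambda>x. norm (alphaA m a y (of_real x) - 1) \<le> C * x powr (-1/2)) at_top"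
    and e2: "eventually (\<lambda>x. norm (betaA m a y (of_real x)) \<le> C * x powr (-1/2)) at_top"
    using eventually_ge_at_top[of R] by (eventually_elim, use est[unfolded near_unit_def] in blast)+
  have "((\<lambda>x. alphaA m a y (of_real x) - 1) \<longlongrightarrow> 0) at_top" "((\<lambda>x. betaA m a y (of_real x)) \<longlongrightarrow> 0) at_top"
    using Lim_null_comparison[OF e1 tendsto_const_powr_neg_half] Lim_null_comparison[OF e2 tendsto_const_powr_neg_half] by auto
  thus ?thesis using ysol by (auto simp: LIM_zero_iff)
qed

text \<open>Sending the end point to infinity along the ray replaces its diagonal values by their
  limits 1 and 0.\<close>

lemma transport_limit:
  assumes m: "m \<ge> 3" and psi: "\<bar>\<psi>\<bar> < pi / (real m + 2)" and eps: "\<epsilon> > 0" and sol: "is_solution m a lam y"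
    and la: "((\<lambda>X. alphaA m a y (cis \<psi> * of_real X)) \<longlongrightarrow> 1) at_top"
    and lb: "((\<lambda>X. betaA m a y (cis \<psi> * of_real X)) \<longlongrightarrow> 0) at_top"
  shows "\<exists>C\<ge>0. \<exists>R\<ge>1. \<forall>z. \<bar>Arg z - \<psi>\<bar> \<le> 2 * pi / (real m + 2) - \<epsilon> \<and> norm z \<ge> R \<longrightarrow>
     near_unit m a y (C * norm z powr (-1/2)) z"
proof -
  obtain C R where C: "C \<ge> 0" and R: "R \<ge> 1" and tr: "\<And>z. \<bar>Arg z - \<psi>\<bar> \<le> 2 * pi / (real m + 2) - \<epsilon> \<and> norm z \<ge> R \<Longrightarrow>
     (\<exists>X0. \<forall>X\<ge>X0. \<forall>y. is_solution m a lam y \<longrightarrow>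
        transported m a y (C * norm z powr (-1/2)) z (cis \<psi> * of_real X))"
    using transport[OF m psi eps, of a lam] by blast
  have "near_unit m a y (C * norm z powr (-1/2)) z"
    if z: "\<bar>Arg z - \<psi>\<bar> \<le> 2 * pi / (real m + 2) - \<epsilon> \<and> norm z \<ge> R" for z
  proof -
    define k where "k = C * norm z powr (-1/2)"
    define \<alpha> where "\<alpha> = (\<lambda>X. alphaA m a y (cis \<psi> * of_real X))"
    define \<beta> where "\<beta> = (\<lambda>X. betaA m a y (cis \<psi> * of_real X))"
    note la' = la[folded \<alpha>_def] and lb' = lb[folded \<beta>_def]
    from tr[OF z] obtain X0 where "\<And>X. X \<ge> X0 \<Longrightarrow>
         norm (alphaA m a y z - \<alpha> X) \<le> (norm (\<alpha> X) + norm (\<beta> X)) * k \<and>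
            norm (betaA m a y z) \<le> norm (\<beta> X) + (norm (\<alpha> X) + norm (\<beta> X)) * k"
      using sol unfolding transported_def Let_def k_def \<alpha>_def \<beta>_def by blast
    hence e1: "eventually (\<lambda>X. norm (alphaA m a y z - \<alpha> X) \<le> (norm (\<alpha> X) + norm (\<beta> X)) * k) at_top"
      and e2: "eventually (\<lambda>X. norm (betaA m a y z) \<le> norm (\<beta> X) + (norm (\<alpha> X) + norm (\<beta> X)) * k) at_top"
      by (auto intro: eventually_at_top_linorderI)
    have "((\<lambda>X. (norm (\<alpha> X) + norm (\<beta> X)) * k) \<longlongrightarrow> (norm (1::complex) + norm (0::complex)) * k) at_top"
      by (intro tendsto_intros la' lb')
    moreover have "((\<lambda>X. norm (alphaA m a y z - \<alpha> X)) \<longlongrightarrow> norm (alphaA m a y z - 1)) at_top"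
      by (intro tendsto_intros la')
    ultimately have 1: "norm (alphaA m a y z - 1) \<le> (norm (1::complex) + norm (0::complex)) * k"
      using e1 by (intro tendsto_le[OF trivial_limit_at_top_linorder])
    have "((\<lambda>X. norm (\<beta> X) + (norm (\<alpha> X) + norm (\<beta> X)) * k) \<longlongrightarrow> norm (0::complex) + (norm (1::complex) + norm (0::complex)) * k) at_top"
      by (intro tendsto_intros la' lb')
    hence 2: "norm (betaA m a y z) \<le> norm (0::complex) + (norm (1::complex) + norm (0::complex)) * k"
      using e2 by (intro tendsto_le[OF trivial_limit_at_top_linorder _ tendsto_const])
    show ?thesis using 1 2 unfolding near_unit_def k_def by simp
  qed
  thus ?thesis using C R by blast
qed

lemma norm_csqrt_minus_one_le: "norm (csqrt u - 1) \<le> norm (u - 1)"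
proof -
  have "1 \<le> Re (csqrt u + 1)" using csqrt_principal[of u] by auto
  also have "\<dots> \<le> norm (csqrt u + 1)" by (rule complex_Re_le_cmod)
  finally have "norm (csqrt u - 1) * 1 \<le> norm (csqrt u - 1) * norm (csqrt u + 1)"
    by (intro mult_left_mono) auto
  also have "\<dots> = norm (u - 1)"
    by (simp flip: norm_mult add: algebra_simps flip: power2_eq_square)
  finally show ?thesis by simp
qed

definition asym :: "nat \<Rightarrow> (nat \<Rightarrow> complex) \<Rightarrow> complex \<Rightarrow> complex" where
  "asym m a z = z powr (mu m a - of_real (real m / 2)) * exp (- Ffun m a z)"

definition asym' :: "nat \<Rightarrow> (nat \<Rightarrow> complex) \<Rightarrow> complex \<Rightarrow> complex" where
  "asym' m a z = - (z powr (mu m a)) * exp (- Ffun m a z)"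

text \<open>Since \<open>mu - m/2\<close> is \<open>- m/4 - nu\<close> and the logarithm sits in
  \<open>xiA\<close>, Sibuya's leading term times \<open>dA\<close> is just
  \<open>csqrt (Bz m a z)\<close>, a factor tending to 1. Both asymptotic statements are thereby
  reduced to the diagonal variables.\<close>

lemma sibuya_quotients:
  assumes z: "z \<noteq> 0" and B: "Bz m a z \<noteq> 0"
  shows "y z / asym m a z
      = (alphaA m a y z + betaA m a y z) / csqrt (Bz m a z)" (is ?t1)
    and "deriv y z / asym' m a z
      = csqrt (Bz m a z) * (alphaA m a y z - betaA m a y z
          + wA1 m a z / (wA m a z * wA m a z) / 2 * (alphaA m a y z + betaA m a y z))" (is ?t2)
proof -
  define D where "D = dA m a z"
  define k where "k = csqrt (Bz m a z)"
  define w where "w = wA m a z"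
  have k0: "k \<noteq> 0" unfolding k_def using B by simp
  have kk: "k * k = Bz m a z" unfolding k_def by (metis power2_csqrt power2_eq_square)
  have D0: "D \<noteq> 0" unfolding D_def using z B by (rule dA_nonzero)
  have w0: "w \<noteq> 0" unfolding w_def using z B by (rule wA_nonzero)
  define x where "x = z powr of_real (real m / 4) * exp (xiA m a z)"
  have Dx: "D = x * k" unfolding D_def x_def k_def dA_def by simp
  have mu1: "mu m a - of_real (real m / 2) = - of_real (real m / 4) - nu m a"
    unfolding mu_def by (simp add: field_simps)
  have e1: "asym m a z = 1 / x"
  proof -
    have lin: "- (p * L + (F + n * L)) = (- p - n) * L + - F" for p L F n :: complex
      by (simp add: algebra_simps)
    have x': "x = exp (of_real (real m / 4) * Ln z + (Ffun m a z + nu m a * Ln z))"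
      unfolding x_def xiA_def powr_def exp_add using z by simp
    have "1 / x = exp (- (of_real (real m / 4) * Ln z + (Ffun m a z + nu m a * Ln z)))"
      unfolding x' exp_minus divide_inverse by simp
    also have "- (of_real (real m / 4) * Ln z + (Ffun m a z + nu m a * Ln z))
        = (- of_real (real m / 4) - nu m a) * Ln z + - Ffun m a z"
      by (rule lin)
    finally show ?thesis unfolding asym_def mu1 powr_def exp_add using z by simp
  qed
  have mu2: "mu m a = of_real (real m / 2) + (mu m a - of_real (real m / 2))" by simp
  have e2: "asym' m a z = - (w / (x * Bz m a z))"
  proof -
    have "z powr (mu m a) * exp (- Ffun m a z) = z powr of_real (real m / 2) * (1 / x)"
      unfolding e1[symmetric] asym_def by (subst mu2, subst powr_add) (simp add: mult.assoc)
    also have "z powr of_real (real m / 2) = w / Bz m a z"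
      unfolding w_def wA_def zp_def using B by (simp add: Bz_def)
    finally show ?thesis by (simp add: asym'_def mult.commute)
  qed
  have ab: "alphaA m a y z + betaA m a y z = y z * D" unfolding alphaA_def D_def by simp
  show ?t1 unfolding e1 ab k_def[symmetric] Dx using k0 by simp
  have x0: "x \<noteq> 0" using D0 Dx by auto
  have t: "alphaA m a y z - betaA m a y z + wA1 m a z / (w * w) / 2 * (y z * D) = - (deriv y z / w * D)"
    unfolding alphaA_def betaA_def Let_def D_def[symmetric] w_def[symmetric] using w0
    by (simp add: field_simps)
  show ?t2
    unfolding e2 ab k_def[symmetric] w_def[symmetric] t
    unfolding Dx unfolding kk[symmetric] using x0 w0 k0
    by (simp add: field_simps)
qed

text \<open>One transport from the positive axis covers only arguments up to \<open>2 * h\<close>,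
  where \<open>h = pi / (m + 2)\<close>. It does control all rays of angle below \<open>h\<close>,
  and a second transport from rays close to \<open>h\<close> and \<open>- h\<close> reaches
  arguments up to \<open>3 * h\<close>.\<close>

theorem sibuya_exists:
  assumes m: "m \<ge> 3"
  shows "\<exists>y. is_sibuya_sol m a lam y"
proof -
  obtain y where sol: "is_solution m a lam y" and
     lims: "((\<lambda>X. alphaA m a y (of_real X)) \<longlongrightarrow> 1) at_top" "((\<lambda>X. betaA m a y (of_real X)) \<longlongrightarrow> 0) at_top"
    using recessive_solution_exists[OF m] by blast
  define h where "h = pi / (real m + 2)"
  have h: "h > 0" "5 * h \<le> pi" unfolding h_def using m by (auto simp: field_simps)
  have hh: "2 * pi / (real m + 2) = 2 * h" "3 * pi / (real m + 2) = 3 * h" unfolding h_def by simp_all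
  note z0 = tendsto_const_powr_neg_half
  have rays: "((\<lambda>X. alphaA m a y (cis \<psi> * of_real X)) \<longlongrightarrow> 1) at_top \<and> ((\<lambda>X. betaA m a y (cis \<psi> * of_real X)) \<longlongrightarrow> 0) at_top"
    if psi: "\<bar>\<psi>\<bar> < h" for \<psi>
  proof -
    have l0: "((\<lambda>X. alphaA m a y (cis 0 * of_real X)) \<longlongrightarrow> 1) at_top" "((\<lambda>X. betaA m a y (cis 0 * of_real X)) \<longlongrightarrow> 0) at_top"
      using lims by simp_all
    obtain C R where CR: "C \<ge> 0" "R \<ge> 1" "\<And>z. \<bar>Arg z - 0\<bar> \<le> 2 * h - h \<and> norm z \<ge> R \<Longrightarrow>
       near_unit m a y (C * norm z powr (-1/2)) z"
      using transport_limit[OF m _ h(1) sol l0] h(1) unfolding hh h_def[symmetric] by auto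
    have est: "near_unit m a y (C * X powr (-1/2)) (cis \<psi> * of_real X)"
      if "X \<ge> R" for X
    proof -
      have X: "X > 0" using that CR by linarith
      have "- pi < \<psi> \<and> \<psi> \<le> pi" using psi h by linarith
      hence "Arg (cis \<psi>) = \<psi>" by (simp add: Arg_cis)
      hence "Arg (cis \<psi> * of_real X) = \<psi>"
        using X by (simp add: mult.commute[of "cis \<psi>"] Arg_times_of_real)
      thus ?thesis using CR(3)[of "cis \<psi> * of_real X"] that psi X by (simp add: norm_mult)
    qed
    have e1: "eventually (\<lambda>x. norm (alphaA m a y (cis \<psi> * of_real x) - 1) \<le> C * x powr (-1/2)) at_top"
      and e2: "eventually (\<lambda>x. norm (betaA m a y (cis \<psi> * of_real x)) \<le> C * x powr (-1/2)) at_top"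
      using eventually_ge_at_top[of R] by (eventually_elim, use est[unfolded near_unit_def] in blast)+
    show ?thesis using Lim_null_comparison[OF e1 z0] Lim_null_comparison[OF e2 z0] by (auto simp: LIM_zero_iff)
  qed
  have bound: "\<exists>C R. \<forall>z\<in>sibuya_sector m \<epsilon>. norm z \<ge> R \<longrightarrow>
        norm (y z / asym m a z - 1)
          \<le> C * norm z powr (-1/2) \<and>
        norm (deriv y z / asym' m a z - 1)
          \<le> C * norm z powr (-1/2)" if eps: "\<epsilon> > 0" for \<epsilon>
  proof -
    define e where "e = min \<epsilon> h"
    have e: "e > 0" "e \<le> \<epsilon>" "e \<le> h" unfolding e_def using eps h by auto
    \<comment> \<open>Half of the margin \<open>e\<close> keeps the intermediate ray inside angle
      \<open>h\<close>, the other half is the margin of the second transport.\<close>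
    define p where "p = h - e / 2"
    have p: "\<bar>p\<bar> < h" "\<bar>-p\<bar> < h" unfolding p_def using e h by auto
    have e2: "e / 2 > 0" using e by simp
    obtain C1 R1 where 1: "C1 \<ge> 0" "R1 \<ge> 1" "\<And>z. \<bar>Arg z - p\<bar> \<le> 2 * h - e / 2 \<and> norm z \<ge> R1 \<Longrightarrow>
       near_unit m a y (C1 * norm z powr (-1/2)) z"
      using transport_limit[OF m _ e2 sol] rays[OF p(1)] p unfolding hh h_def[symmetric] by meson
    obtain C2 R2 where 2: "C2 \<ge> 0" "R2 \<ge> 1" "\<And>z. \<bar>Arg z - (-p)\<bar> \<le> 2 * h - e / 2 \<and> norm z \<ge> R2 \<Longrightarrow>
       near_unit m a y (C2 * norm z powr (-1/2)) z"
      using transport_limit[OF m _ e2 sol] rays[OF p(2)] p unfolding hh h_def[symmetric] by meson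
    obtain K R3 where 3: "K \<ge> 0" "R3 \<ge> 1" "\<And>z. norm z \<ge> R3 \<Longrightarrow> norm (Bz m a z - 1) \<le> 1/2 \<and> norm (Bz m a z - 1) \<le> K * norm z powr (-1/2)
     \<and> norm (wA1 m a z / (wA m a z * wA m a z)) \<le> K * norm z powr (-1/2)"
      using wA_bounds[OF m, of a lam] by blast
    define M where "M = C1 + C2 + K"
    define R where "R = max R1 (max R2 R3)"
    define C where "C = 7 * M + 4 * M * M"
    show ?thesis
    proof (rule exI[of _ C], rule exI[of _ R], intro ballI impI)
      fix z assume zs: "z \<in> sibuya_sector m \<epsilon>" and zR: "R \<le> norm z"
      have z: "z \<noteq> 0" and az: "\<bar>Arg z\<bar> \<le> 3 * h - \<epsilon>" using zs unfolding sibuya_sector_def hh by auto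
      have zR': "norm z \<ge> R1" "norm z \<ge> R2" "norm z \<ge> R3" "norm z \<ge> 1" using zR 1 unfolding R_def by auto
      define s where "s = norm z powr (-1/2)"
      have s0: "s \<ge> 0" and s1: "s \<le> 1" unfolding s_def using z zR'(4) powr_mono[of "-1/2" 0 "norm z"] by auto
      have M0: "M \<ge> 0" unfolding M_def using 1 2 3 by auto
      have le: "C1 * s \<le> M * s" "C2 * s \<le> M * s" "K * s \<le> M * s"
        unfolding M_def using s0 1 2 3 by (auto intro!: mult_right_mono)
      have ab: "norm (alphaA m a y z - 1) \<le> M * s" "norm (betaA m a y z) \<le> M * s"
      proof -
        have "norm (alphaA m a y z - 1) \<le> M * s \<and> norm (betaA m a y z) \<le> M * s"
        proof (cases "Arg z \<ge> 0")
          case True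
          have "\<bar>Arg z - p\<bar> \<le> 2 * h - e / 2" using True az e h unfolding p_def by (auto simp: abs_le_iff)
          thus ?thesis using 1(3)[of z] zR' le unfolding near_unit_def s_def by fastforce
        next
          case False
          have "\<bar>Arg z - (-p)\<bar> \<le> 2 * h - e / 2" using False az e h unfolding p_def by (auto simp: abs_le_iff)
          thus ?thesis using 2(3)[of z] zR' le unfolding near_unit_def s_def by fastforce
        qed
        thus "norm (alphaA m a y z - 1) \<le> M * s" "norm (betaA m a y z) \<le> M * s" by auto
      qed
      note b3 = 3(3)[OF zR'(3), folded s_def]
      define k where "k = csqrt (Bz m a z)"
      define g where "g = alphaA m a y z + betaA m a y z"
      define v where "v = wA1 m a z / (wA m a z * wA m a z)"
      have k1: "norm (k - 1) \<le> M * s" "norm (k - 1) \<le> 1/2"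
        using norm_csqrt_minus_one_le[of "Bz m a z"] b3 le unfolding k_def by auto
      have kl: "norm k \<ge> 1/2" using k1(2) norm_triangle_ineq2[of 1 "1 - k"] by (simp add: norm_minus_commute)
      have ku: "norm k \<le> 2" using k1(2) norm_triangle_ineq[of "k - 1" 1] by simp
      have v: "norm v \<le> M * s" using b3 le unfolding v_def by linarith
      have Ms: "M * s \<le> M" using s1 M0 by (simp add: mult_left_le)
      have g1: "norm (g - 1) \<le> 2 * (M * s)"
        using norm_triangle_ineq[of "alphaA m a y z - 1" "betaA m a y z"] ab unfolding g_def
        by (simp add: algebra_simps)
      have g2: "norm g \<le> 1 + 2 * M" using norm_triangle_ineq[of "g - 1" 1] g1 Ms by simp
      have B: "Bz m a z \<noteq> 0" using kl unfolding k_def by auto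
      have "k \<noteq> 0" using kl by auto
      hence "g / k - 1 = ((g - 1) - (k - 1)) / k" by (simp add: diff_divide_distrib)
      hence "norm (g / k - 1) = norm ((g - 1) - (k - 1)) / norm k" by (simp add: norm_divide)
      also have "\<dots> \<le> (3 * (M * s)) / (1/2)"
        using kl g1 k1 M0 s0 norm_triangle_ineq4[of "g - 1" "k - 1"] by (intro frac_le) auto
      also have "\<dots> \<le> C * s" unfolding C_def using M0 s0 by (simp add: algebra_simps)
      finally have q1: "norm (g / k - 1) \<le> C * s" .
      define r where "r = alphaA m a y z - betaA m a y z + v / 2 * g"
      have r1: "norm (r - 1) \<le> 2 * (M * s) + (M * s) / 2 * (1 + 2 * M)"
      proof -
        have "r - 1 = (alphaA m a y z - 1) - betaA m a y z + v / 2 * g" unfolding r_def by simp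
        hence "norm (r - 1) \<le> norm (alphaA m a y z - 1) + norm (betaA m a y z) + norm (v / 2 * g)"
          by (metis norm_triangle_ineq norm_triangle_ineq4 add_right_mono order_trans)
        also have "norm (v / 2 * g) \<le> (M * s) / 2 * (1 + 2 * M)"
          unfolding norm_mult norm_divide using v g2 M0 s0 by (intro mult_mono) auto
        finally show ?thesis using ab by linarith
      qed
      have "k * r - 1 = k * (r - 1) + (k - 1)" by (simp add: algebra_simps)
      hence "norm (k * r - 1) \<le> norm k * norm (r - 1) + norm (k - 1)" by (metis norm_mult norm_triangle_ineq)
      also have "\<dots> \<le> 2 * (2 * (M * s) + (M * s) / 2 * (1 + 2 * M)) + M * s"
        using ku r1 k1 M0 s0 by (intro add_mono mult_mono) auto
      also have "\<dots> \<le> C * s" unfolding C_def using M0 s0 by (simp add: algebra_simps)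
      finally have q2: "norm (k * r - 1) \<le> C * s" .
      show "norm (y z / asym m a z - 1)
          \<le> C * norm z powr (-1/2) \<and>
        norm (deriv y z / asym' m a z - 1)
          \<le> C * norm z powr (-1/2)"
        unfolding sibuya_quotients[OF z B] using q1 q2 unfolding r_def g_def k_def v_def s_def by simp
    qed
  qed
  have "is_sibuya_sol m a lam y"
    using sol bound unfolding is_sibuya_sol_def is_solution_def Qf_def asym_def asym'_def by blast
  thus ?thesis by blast
qed

lemma is_sibuya_sol_some:
  assumes "m \<ge> 3"
  shows "is_sibuya_sol m a lam (\<lambda>z. sibuya m z a lam)"
  unfolding sibuya_def using someI_ex[OF sibuya_exists[OF assms]] by simp

section \<open>Wronskians of neighbouring solutions\<close>

lemma omega_pow_add: "omega_pow m (s + t) = omega_pow m s * omega_pow m t"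
  unfolding omega_pow_def exp_add[symmetric] by (simp add: add_divide_distrib ring_distribs)

lemma omega_pow_0 [simp]: "omega_pow m 0 = 1"
  by (simp add: omega_pow_def)

lemma omega_pow_minus: "omega_pow m (- s) = inverse (omega_pow m s)"
  by (rule inverse_unique[symmetric]) (simp flip: omega_pow_add)

lemma omega_pow_nonzero [simp]: "omega_pow m s \<noteq> 0"
  by (simp add: omega_pow_def)

lemma omega_pow_power: "omega_pow m s ^ n = omega_pow m (of_nat n * s)"
  unfolding omega_pow_def exp_of_nat_mult[symmetric] by (simp add: algebra_simps)

lemma of_nat_plus_2_nonzero: "(of_nat m + 2 :: complex) \<noteq> 0"
  by (metis of_nat_add of_nat_eq_0_iff of_nat_numeral add_is_0 zero_neq_numeral)

lemma omega_pow_half: "omega_pow m ((of_nat m + 2) / 2) = -1"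
proof -
  have "2 * of_real pi * \<i> * ((of_nat m + 2) / 2) / (of_nat m + 2) = of_real pi * \<i>"
  proof -
    have "2 * p * \<i> * (M / 2) / M = p * \<i>" if "M \<noteq> 0" for p M :: complex using that by simp
    thus ?thesis using of_nat_plus_2_nonzero[of m] by blast
  qed
  thus ?thesis unfolding omega_pow_def by (simp only: exp_pi_i)
qed

lemma omega_pow_full: "omega_pow m (of_nat m + 2) = 1"
  using omega_pow_add[of m "(of_nat m + 2) / 2" "(of_nat m + 2) / 2"] by (simp add: omega_pow_half)

lemma omega_pow_real: "omega_pow m (of_real s) = cis (2 * pi * s / (real m + 2))"
  unfolding omega_pow_def cis_conv_exp by (simp add: mult_ac)

lemma norm_omega_pow_of_int: "norm (omega_pow m (of_int l)) = 1"
  using omega_pow_real[of m "of_int l"] by simp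

lemma Gpow_Gpow: "Gpow m k (Gpow m l a) = Gpow m (k + l) a"
proof
  fix j
  have "(of_int (- (int j * k)) :: complex) + of_int (- (int j * l)) = of_int (- (int j * (k + l)))"
    by (simp add: ring_distribs)
  thus "Gpow m k (Gpow m l a) j = Gpow m (k + l) a j"
    unfolding Gpow_def by (metis mult.assoc omega_pow_add)
qed

lemma Gpow_0 [simp]: "Gpow m 0 a = a"
  by (simp add: Gpow_def)

lemma norm_Gpow: "norm (Gpow m l a j) = norm (a j)"
  unfolding Gpow_def norm_mult norm_omega_pow_of_int by simp

text \<open>Multiplying \<open>a j\<close> by \<omega>^(-j) is a dilation of the variable of
  \<open>Apoly\<close>; the formal square root is dilated along with it, which gives the behaviour
  of \<open>bj\<close>.\<close>

lemma Apoly_Gpow: "Apoly m (Gpow m 1 a) = pcompose (Apoly m a) [:0, omega_pow m (-1):]"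
  unfolding Apoly_def pcompose_sum
proof (rule sum.cong[OF refl])
  fix j
  have "omega_pow m (of_int (- (int j * 1))) = omega_pow m (- 1) ^ j"
    by (simp add: omega_pow_power)
  thus "monom (Gpow m 1 a j) j = pcompose (monom (a j) j) [:0, omega_pow m (-1):]"
    by (intro poly_eqI) (simp add: coeff_pcompose_linear Gpow_def coeff_monom)
qed

lemma pcompose_power': "pcompose (p ^ k) q = pcompose p q ^ k"
  by (induction k) (simp_all add: pcompose_mult pcompose_1)

lemma bj_Gpow: "bj m (Gpow m 1 a) j = omega_pow m (- of_nat j) * bj m a j"
proof -
  have "coeff (Ppoly m (Gpow m 1 a) ^ k) (m * k - j) = omega_pow m (- of_nat j) * coeff (Ppoly m a ^ k) (m * k - j)"
    if "j \<le> m * k" for k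
    unfolding coeff_Ppoly_power(1)[OF that] Apoly_Gpow pcompose_power'[symmetric] coeff_pcompose_linear
    by (simp add: omega_pow_power)
  hence "bjk m (Gpow m 1 a) j k = omega_pow m (- of_nat j) * bjk m a j k" for k
    by (simp add: bjk_def)
  thus ?thesis unfolding bj_def by (simp add: sum_distrib_left)
qed

lemma omega_pow_half': "omega_pow m (- ((of_nat m + 2) / 2)) = -1"
  unfolding omega_pow_minus omega_pow_half by simp

lemma nu_Gpow: "nu m (Gpow m 1 a) = - nu m a"
proof (cases "odd m")
  case False
  then obtain k where k: "m = 2 * k" by (auto elim: evenE)
  have "- of_nat (m div 2 + 1) = (- ((of_nat m + 2) / 2) :: complex)"
    by (simp add: k field_simps)
  thus ?thesis using False omega_pow_half'[of m] by (simp only: nu_def bj_Gpow) simp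
qed (simp add: nu_def)

lemma mu_Gpow: "mu m (Gpow m 1 a) = of_real (real m / 2) - mu m a"
  by (simp add: mu_def nu_Gpow)

lemma Pfun_Gpow: "Pfun m (Gpow m 1 a) (omega_pow m (-1) * z) = omega_pow m 2 * Pfun m a z"
  unfolding Pfun_def sum_distrib_left
proof (rule sum.cong[OF refl])
  fix j assume j: "j \<in> {1..m}"
  have "omega_pow m (of_int (- (int j * 1))) * omega_pow m (-1) ^ (m - j) = omega_pow m (- of_nat m)"
    unfolding omega_pow_power omega_pow_add[symmetric] using j by (simp add: of_nat_diff)
  also have "\<dots> = omega_pow m 2"
    using omega_pow_add[of m "- of_nat m" "of_nat m + 2"] omega_pow_full[of m] by simp
  finally show "Gpow m 1 a j * (omega_pow m (-1) * z) ^ (m - j) = omega_pow m 2 * (a j * z ^ (m - j))"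
    unfolding Gpow_def power_mult_distrib by (metis mult.assoc mult.left_commute)
qed

lemma Qf_Gpow: "omega_pow m (-1) ^ 2 * Qf m (Gpow m 1 a) (omega_pow m 2 * lam) (omega_pow m (-1) * z) = Qf m a lam z"
proof -
  have "omega_pow m (-1) ^ m = omega_pow m 2"
    using omega_pow_add[of m "- of_nat m" "of_nat m + 2"] omega_pow_full[of m]
    by (simp add: omega_pow_power)
  moreover have "omega_pow m (-1) ^ 2 * omega_pow m 2 = 1"
    unfolding omega_pow_power by (simp flip: omega_pow_add)
  ultimately show ?thesis
    unfolding Qf_def Pfun_Gpow power_mult_distrib by (simp flip: distrib_left mult.assoc)
qed

text \<open>In each term the root of unity from \<open>bj\<close> and the one from the power combine
  to \<omega>^(-(m+2)/2) = -1. The hypothesis on powers says that the rotation does not cross the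
  branch cut. Adjacent solutions thus have reciprocal exponential factors.\<close>

lemma Ffun_Gpow:
  assumes z: "\<And>s. (omega_pow m (-1) * z) powr s = omega_pow m (- s) * z powr s"
  shows "Ffun m (Gpow m 1 a) (omega_pow m (-1) * z) = - Ffun m a z"
proof -
  have e1: "omega_pow m (- of_real ((real m + 2) / 2)) = -1"
    using omega_pow_half'[of m] by simp
  have e2: "omega_pow m (- of_nat j) * omega_pow m (- of_real ((real m + 2 - 2 * real j) / 2)) = -1" for j
  proof -
    have "- of_nat j + - of_real ((real m + 2 - 2 * real j) / 2) = (- ((of_nat m + 2) / 2) :: complex)"
      by (simp add: field_simps)
    thus ?thesis using omega_pow_half'[of m] by (simp only: omega_pow_add[symmetric])
  qed
  have "of_real (2 / (real m + 2 - 2 * real j)) * bj m (Gpow m 1 a) j * (omega_pow m (-1) * z) powr (of_real ((real m + 2 - 2 * real j) / 2))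
     = - (of_real (2 / (real m + 2 - 2 * real j)) * bj m a j * z powr (of_real ((real m + 2 - 2 * real j) / 2)))" for j
  proof -
    have "r * (p * x) * (q * y) = (p * q) * (r * x * y)" for r p q x y :: complex by (simp add: mult_ac)
    thus ?thesis unfolding z bj_Gpow by (simp only: e2) simp
  qed
  thus ?thesis unfolding Ffun_def z e1 by (simp only: sum_negf) simp
qed

section \<open>Asymptotics on rays and the Wronskian of adjacent solutions\<close>

lemma sibuya_asymptotics:
  assumes m: "m \<ge> 3" and t: "\<bar>\<theta>\<bar> < 3 * pi / (real m + 2)" and sib: "is_sibuya_sol m a lam y"
  shows "((\<lambda>t. y (of_real t * cis \<theta>) / asym m a (of_real t * cis \<theta>)) \<longlongrightarrow> 1) at_top"
    and "((\<lambda>t. deriv y (of_real t * cis \<theta>) / asym' m a (of_real t * cis \<theta>)) \<longlongrightarrow> 1) at_top"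
proof -
  define \<epsilon> where "\<epsilon> = 3 * pi / (real m + 2) - \<bar>\<theta>\<bar>"
  have e: "\<epsilon> > 0" unfolding \<epsilon>_def using t by simp
  obtain C R where CR: "\<And>z. z\<in>sibuya_sector m \<epsilon> \<Longrightarrow> norm z \<ge> R \<Longrightarrow>
        norm (y z / asym m a z - 1)
          \<le> C * norm z powr (-1/2) \<and>
        norm (deriv y z / asym' m a z - 1)
          \<le> C * norm z powr (-1/2)"
    using sib e unfolding is_sibuya_sol_def asym_def asym'_def by meson
  have "3 * pi / (real m + 2) < pi" using m by (simp add: divide_less_eq)
  hence "Arg (cis \<theta>) = \<theta>" using t by (intro Arg_cis) auto
  hence sec: "of_real t * cis \<theta> \<in> sibuya_sector m \<epsilon>" if "t > 0" for t
    using that by (simp add: sibuya_sector_def \<epsilon>_def Arg_times_of_real)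
  note z0 = tendsto_const_powr_neg_half
  have n: "norm (of_real t * cis \<theta>) = t" if "t > 0" for t using that by (simp add: norm_mult)
  have ev: "eventually (\<lambda>t. t > 0 \<and> t \<ge> R) at_top"
    using eventually_gt_at_top[of 0] eventually_ge_at_top[of R] by eventually_elim auto
  have e1: "eventually (\<lambda>t. norm (y (of_real t * cis \<theta>) / asym m a (of_real t * cis \<theta>) - 1) \<le> C * t powr (-1/2)) at_top"
    using ev by eventually_elim (use CR sec n in metis)
  have e2: "eventually (\<lambda>t. norm (deriv y (of_real t * cis \<theta>) / asym' m a (of_real t * cis \<theta>) - 1) \<le> C * t powr (-1/2)) at_top"
    using ev by eventually_elim (use CR sec n in metis)
  show "((\<lambda>t. y (of_real t * cis \<theta>) / asym m a (of_real t * cis \<theta>)) \<longlongrightarrow> 1) at_top"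
    using Lim_null_comparison[OF e1 z0] by (simp only: LIM_zero_iff)
  show "((\<lambda>t. deriv y (of_real t * cis \<theta>) / asym' m a (of_real t * cis \<theta>)) \<longlongrightarrow> 1) at_top"
    using Lim_null_comparison[OF e2 z0] by (simp only: LIM_zero_iff)
qed

lemma deriv_scale:
  assumes "y holomorphic_on UNIV"
  shows "deriv (\<lambda>z. y (c * z)) = (\<lambda>z. c * deriv y (c * z))"
proof
  fix z
  show "deriv (\<lambda>z. y (c * z)) z = c * deriv y (c * z)"
    using DERIV_chain2[where f = y and g = "\<lambda>z. c * z", OF entire_derivs(1)[OF assms] DERIV_cmult_Id]
    by (intro DERIV_imp_deriv) (simp add: mult.commute[of _ c])
qed

text \<open>On the ray of argument \<open>h\<close> both asymptotics apply, the rotated point having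
  argument \<open>- h\<close>. The exponentials and the powers of z cancel, and the constant
  Wronskian equals its limit at infinity. The factor \<open>omega_pow m (-1)\<close> is the inner
  derivative of z \<mapsto> \<open>g (c * z)\<close>.\<close>

lemma sibuya_wronskian:
  assumes m: "m \<ge> 3" and f: "is_sibuya_sol m a lam f"
    and g: "is_sibuya_sol m (Gpow m 1 a) (omega_pow m 2 * lam) g"
  shows "f 0 * (omega_pow m (-1) * deriv g 0) - deriv f 0 * g 0 = 2 * omega_pow m (mu m a)"
proof -
  define c where "c = omega_pow m (-1)"
  define h where "h = pi / (real m + 2)"
  have h: "h > 0" "h < 3 * pi / (real m + 2)" "h < pi" unfolding h_def using m by (auto simp: divide_strict_right_mono divide_less_eq)
  have hf: "f holomorphic_on UNIV" and od: "\<And>z. deriv (deriv f) z = Qf m a lam z * f z"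
    using f unfolding is_sibuya_sol_def Qf_def by auto
  have hg: "g holomorphic_on UNIV" and og: "\<And>z. deriv (deriv g) z = Qf m (Gpow m 1 a) (omega_pow m 2 * lam) z * g z"
    using g unfolding is_sibuya_sol_def Qf_def by auto
  define k where "k = (\<lambda>z. g (c * z))"
  have dk: "deriv k = (\<lambda>z. c * deriv g (c * z))" unfolding k_def by (rule deriv_scale[OF hg])
  have hk: "k holomorphic_on UNIV" unfolding k_def
    using holomorphic_on_compose[of "\<lambda>z. c * z" UNIV g] holomorphic_on_subset[OF hg]
    by (auto simp: o_def intro!: holomorphic_intros)
  have ddk: "deriv (deriv k) z = Qf m a lam z * k z" for z
  proof -
    have hd: "(\<lambda>z. deriv g (c * z)) holomorphic_on UNIV"
      using holomorphic_on_compose[of "\<lambda>z. c * z" UNIV "deriv g"] holomorphic_on_subset[OF holomorphic_deriv[OF hg open_UNIV]]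
      by (auto simp: o_def intro!: holomorphic_intros)
    have "deriv (deriv k) z = c * deriv (\<lambda>z. deriv g (c * z)) z"
      unfolding dk by (rule DERIV_imp_deriv, rule DERIV_cmult, rule entire_derivs(1)[OF hd])
    also have "\<dots> = c ^ 2 * deriv (deriv g) (c * z)"
      unfolding deriv_scale[OF holomorphic_deriv[OF hg open_UNIV]] by (simp add: power2_eq_square)
    also have "\<dots> = (omega_pow m (-1) ^ 2 * Qf m (Gpow m 1 a) (omega_pow m 2 * lam) (omega_pow m (-1) * z)) * k z"
      unfolding og k_def c_def by (simp add: mult_ac)
    finally show ?thesis unfolding Qf_Gpow .
  qed
  define W where "W = f 0 * deriv k 0 - deriv f 0 * k 0"
  have W: "f z * deriv k z - deriv f z * k z = W" for z
    unfolding W_def by (rule wronskian_constant[OF hf hk od ddk])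
  have cc: "c = cis (- (2 * h))"
    using omega_pow_real[of m "-1"] unfolding c_def h_def by simp
  have c2: "c * (of_real t * cis h) = of_real t * cis (- h)" for t
    unfolding cc by (simp add: mult_ac cis_mult)
  define z where "z = (\<lambda>t::real. of_real t * cis h)"
  have Lz: "Ln (z t) = of_real (ln t) + \<i> * of_real h" if "t > 0" for t
  proof -
    have "z t = exp (of_real (ln t) + \<i> * of_real h)"
      unfolding z_def using that by (simp add: exp_add exp_of_real cis_conv_exp)
    thus ?thesis using h by (simp add: Ln_exp)
  qed
  have Lcz: "Ln (c * z t) = of_real (ln t) - \<i> * of_real h" if "t > 0" for t
  proof -
    have "c * z t = exp (of_real (ln t) - \<i> * of_real h)"
      unfolding z_def c2 using that by (simp add: exp_diff exp_of_real cis_conv_exp exp_minus divide_inverse)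
    thus ?thesis using h by (simp add: Ln_exp)
  qed
  have zn: "z t \<noteq> 0" "c * z t \<noteq> 0" if "t > 0" for t using that unfolding z_def c_def by auto
  have om: "omega_pow m s = exp (2 * s * (\<i> * of_real h))" for s
    unfolding omega_pow_def h_def by (simp add: field_simps)
  have pw: "(c * z t) powr s = omega_pow m (- s) * z t powr s" if "t > 0" for s t
    using zn[OF that] unfolding powr_def Lz[OF that] Lcz[OF that] om by (simp add: exp_add[symmetric] algebra_simps)
  define A1 where "A1 = (\<lambda>t. f (z t) / asym m a (z t))"
  define A2 where "A2 = (\<lambda>t. deriv f (z t) / asym' m a (z t))"
  define B1 where "B1 = (\<lambda>t. g (c * z t) / asym m (Gpow m 1 a) (c * z t))"
  define B2 where "B2 = (\<lambda>t. deriv g (c * z t) / asym' m (Gpow m 1 a) (c * z t))"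
  have "\<bar>h\<bar> < 3 * pi / (real m + 2)" "\<bar>- h\<bar> < 3 * pi / (real m + 2)" using h by auto
  note lims = sibuya_asymptotics[OF m this(1) f] sibuya_asymptotics[OF m this(2) g]
  have lA: "(A1 \<longlongrightarrow> 1) at_top" "(A2 \<longlongrightarrow> 1) at_top" using lims(1,2) unfolding A1_def A2_def z_def by auto
  have lB: "(B1 \<longlongrightarrow> 1) at_top" "(B2 \<longlongrightarrow> 1) at_top" using lims(3,4) unfolding B1_def B2_def z_def c2 by auto
  have eq: "W = omega_pow m (mu m a) * (A1 t * B2 t + A2 t * B1 t)" if t: "t > 0" for t
  proof -
    define E where "E = exp (- Ffun m a (z t))"
    have F: "exp (- Ffun m (Gpow m 1 a) (c * z t)) = 1 / E"
      unfolding c_def Ffun_Gpow[OF pw[OF t, unfolded c_def]] E_def by (simp add: exp_minus divide_inverse)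
    have E0: "E \<noteq> 0" unfolding E_def by simp
    define u where "u = mu m a"
    define q where "q = (of_real (real m / 2) :: complex)"
    have muG: "mu m (Gpow m 1 a) = q - u" unfolding mu_Gpow u_def q_def ..
    have f1: "f (z t) = A1 t * (z t powr (u - q) * E)"
      unfolding A1_def asym_def E_def u_def q_def using zn[OF t] by simp
    have f2: "deriv f (z t) = - A2 t * (z t powr u * E)"
      unfolding A2_def asym'_def E_def u_def using zn[OF t] by simp
    have g1: "g (c * z t) = B1 t * ((c * z t) powr (- u) / E)"
      unfolding B1_def asym_def F muG q_def[symmetric] using zn[OF t] E0 by simp
    have g2: "deriv g (c * z t) = - B2 t * ((c * z t) powr (q - u) / E)"
      unfolding B2_def asym'_def F muG using zn[OF t] E0 by simp
    \<comment> \<open>The leftover exponent \<open>- (m + 2) / 2\<close> produces the sign -1 that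
      makes the two halves of the Wronskian add up to 2.\<close>
    have p1: "z t powr (u - q) * (c * z t) powr (q - u) * c = - omega_pow m u"
    proof -
      have "z t powr (u - q) * (c * z t) powr (q - u) * c = omega_pow m (u - q) * (z t powr (u - q) * z t powr (q - u)) * c"
        unfolding pw[OF t] by simp
      also have "z t powr (u - q) * z t powr (q - u) = 1" using zn[OF t] by (simp flip: powr_add)
      also have "omega_pow m (u - q) * 1 * c = omega_pow m (u + - ((of_nat m + 2) / 2))"
        unfolding c_def q_def by (simp flip: omega_pow_add add: field_simps)
      also have "\<dots> = - omega_pow m u" unfolding omega_pow_add omega_pow_half' by simp
      finally show ?thesis .
    qed
    have p2: "z t powr u * (c * z t) powr (- u) = omega_pow m u"
      unfolding pw[OF t] using zn[OF t] by (simp flip: powr_add)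
    have "W = f (z t) * (c * deriv g (c * z t)) - deriv f (z t) * g (c * z t)"
      using W[of "z t"] unfolding fun_cong[OF dk] by (simp add: k_def)
    also have "\<dots> = - (A1 t * B2 t) * (z t powr (u - q) * (c * z t) powr (q - u) * c)
        + A2 t * B1 t * (z t powr u * (c * z t) powr (- u))"
      unfolding f1 f2 g1 g2 using E0 by (simp add: mult_ac)
    also have "\<dots> = omega_pow m u * (A1 t * B2 t + A2 t * B1 t)" unfolding p1 p2 by (simp add: algebra_simps)
    finally show ?thesis unfolding u_def .
  qed
  have "((\<lambda>t. omega_pow m (mu m a) * (A1 t * B2 t + A2 t * B1 t)) \<longlongrightarrow> omega_pow m (mu m a) * (1 * 1 + 1 * 1)) at_top"
    by (intro tendsto_intros lA lB)
  moreover have "eventually (\<lambda>t. omega_pow m (mu m a) * (A1 t * B2 t + A2 t * B1 t) = W) at_top"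
    using eventually_gt_at_top[of 0] by eventually_elim (use eq in simp)
  ultimately have "((\<lambda>t::real. W) \<longlongrightarrow> omega_pow m (mu m a) * (1 * 1 + 1 * 1)) at_top"
    by (rule Lim_transform_eventually)
  hence "W = omega_pow m (mu m a) * (1 * 1 + 1 * 1)"
    by (simp add: tendsto_const_iff)
  thus ?thesis unfolding W_def fun_cong[OF dk] by (simp add: k_def c_def mult.commute)
qed

section \<open>Exact Liouville-Green analysis on the positive axis\<close>

lemma csqrt_scale:
  assumes "c > 0"
  shows "csqrt (of_real c * u) = of_real (sqrt c) * csqrt u"
proof (rule csqrt_unique)
  show "(of_real (sqrt c) * csqrt u)\<^sup>2 = of_real c * u"
    using assms by (simp add: power_mult_distrib flip: of_real_power)
  show "0 < Re (of_real (sqrt c) * csqrt u) \<or> Re (of_real (sqrt c) * csqrt u) = 0 \<and> 0 \<le> Im (of_real (sqrt c) * csqrt u)"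
    using csqrt_principal[of u] assms by (auto simp del: csqrt.sel)
qed

definition Q1 :: "nat \<Rightarrow> (nat \<Rightarrow> complex) \<Rightarrow> complex \<Rightarrow> complex \<Rightarrow> complex" where
  "Q1 m a lam z = poly (pderiv (qpoly m a lam)) z"

definition Q2 :: "nat \<Rightarrow> (nat \<Rightarrow> complex) \<Rightarrow> complex \<Rightarrow> complex \<Rightarrow> complex" where
  "Q2 m a lam z = poly (pderiv (pderiv (qpoly m a lam))) z"

lemma Qf_derivs:
  "(Qf m a lam has_field_derivative Q1 m a lam z) (at z)"
  "(Q1 m a lam has_field_derivative Q2 m a lam z) (at z)"
proof -
  have "Qf m a lam = poly (qpoly m a lam)" by (rule ext) (simp add: poly_qpoly)
  thus "(Qf m a lam has_field_derivative Q1 m a lam z) (at z)" unfolding Q1_def by (simp add: poly_DERIV)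
  have "Q1 m a lam = poly (pderiv (qpoly m a lam))" by (rule ext) (simp add: Q1_def)
  thus "(Q1 m a lam has_field_derivative Q2 m a lam z) (at z)" unfolding Q2_def by (simp add: poly_DERIV)
qed

definition wB :: "nat \<Rightarrow> (nat \<Rightarrow> complex) \<Rightarrow> complex \<Rightarrow> real \<Rightarrow> complex" where
  "wB m a lam x = csqrt (Qf m a lam (of_real x))"

text \<open>The error function \<phi> of \<open>wkb_system\<close> for w^2 = Q. The mismatch term
  drops out, and w' = Q'/(2w) together with w'' turns the rest into this classical
  expression.\<close>

definition phiB :: "nat \<Rightarrow> (nat \<Rightarrow> complex) \<Rightarrow> complex \<Rightarrow> real \<Rightarrow> complex" where
  "phiB m a lam x = Q2 m a lam (of_real x) / (4 * wB m a lam x ^ 3)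
     - 5 * Q1 m a lam (of_real x) ^ 2 / (16 * wB m a lam x ^ 5)"

text \<open>The a priori estimate demands two-sided derivatives, also at 0. The integral therefore
  starts slightly to the left of 0, where the potential still avoids the cut because that is an open
  condition.\<close>

lemma wB_antiderivative:
  assumes np: "\<And>x. x \<ge> 0 \<Longrightarrow> Qf m a lam (of_real x) \<notin> \<real>\<^sub>\<le>\<^sub>0"
  shows "\<exists>\<xi>. \<xi> 0 = 0 \<and> (\<forall>x\<ge>0. (\<xi> has_vector_derivative wB m a lam x) (at x))"
proof -
  have cQ: "continuous_on UNIV (\<lambda>x. Qf m a lam (of_real x))"
    unfolding poly_qpoly[symmetric] by (intro continuous_intros)
  have "open {x. Qf m a lam (of_real x) \<in> - \<real>\<^sub>\<le>\<^sub>0}"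
    using open_vimage[OF open_Compl[OF closed_nonpos_Reals_complex] cQ] by (simp add: vimage_def)
  moreover have "0 \<in> {x. Qf m a lam (of_real x) \<in> - \<real>\<^sub>\<le>\<^sub>0}" using np[of 0] by simp
  ultimately obtain e where e: "e > 0" "\<And>x. dist x 0 < e \<Longrightarrow> Qf m a lam (of_real x) \<notin> \<real>\<^sub>\<le>\<^sub>0"
    unfolding open_dist by (metis (mono_tags, lifting) ComplD mem_Collect_eq)
  define \<eta> where "\<eta> = e / 2"
  have eta: "\<eta> > 0" unfolding \<eta>_def using e by simp
  have np': "Qf m a lam (of_real x) \<notin> \<real>\<^sub>\<le>\<^sub>0" if "x \<ge> - \<eta>" for x
    using np[of x] e(2)[of x] that e(1) unfolding \<eta>_def by (cases "x \<ge> 0") (auto simp: dist_real_def)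
  have cw: "continuous_on {-\<eta>..b} (wB m a lam)" for b
    unfolding wB_def
  proof (intro continuous_at_imp_continuous_on ballI)
    fix x assume "x \<in> {-\<eta>..b}"
    hence "isCont csqrt (Qf m a lam (of_real x))"
      using np'[of x] by (intro DERIV_isCont[OF has_field_derivative_csqrt]) auto
    moreover have "isCont (\<lambda>x. Qf m a lam (complex_of_real x)) x" using cQ by (simp add: continuous_on_eq_continuous_at)
    ultimately show "isCont (\<lambda>x. csqrt (Qf m a lam (complex_of_real x))) x" by (rule isCont_o2[rotated])
  qed
  define \<xi> where "\<xi> = (\<lambda>u. integral {-\<eta>..u} (wB m a lam) - integral {-\<eta>..0} (wB m a lam))"
  have "(\<xi> has_vector_derivative wB m a lam x) (at x)" if x: "x \<ge> 0" for x
  proof -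
    have "((\<lambda>u. integral {-\<eta>..u} (wB m a lam)) has_vector_derivative wB m a lam x) (at x within {-\<eta>..x+1})"
      using x eta by (intro integral_has_vector_derivative cw) auto
    moreover have "at x within {-\<eta>..x+1} = at x"
      using x eta by (intro at_within_interior) auto
    ultimately show ?thesis unfolding \<xi>_def
      by (auto intro!: derivative_eq_intros)
  qed
  thus ?thesis by (intro exI[of _ \<xi>]) (simp add: \<xi>_def)
qed

section \<open>The regularised action\<close>

lemma Ffun_real:
  assumes "x \<ge> 0"
  shows "Ffun m a (of_real x) = of_real (2 / (real m + 2) * x powr ((real m + 2) / 2))
     + (\<Sum>j=1..(m + 1) div 2. of_real (2 / (real m + 2 - 2 * real j)) * bj m a j * of_real (x powr ((real m + 2 - 2 * real j) / 2)))"
  unfolding Ffun_def Ffun_index_set powr_of_real[OF assms] of_real_mult ..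

text \<open>\<open>Ffun\<close> and \<open>nu * ln (x + 1)\<close> are antiderivatives of exactly
  the terms subtracted in \<open>Lfun\<close>. The exponents there go down to -1/2, so at 0 the
  function \<open>H\<close> is continuous without being differentiated; at infinity the integrand is
  of order -3/2.\<close>

lemma action_limit:
  assumes m: "m \<ge> 3" and np: "\<And>x. x \<ge> 0 \<Longrightarrow> Qf m a lam (of_real x) \<notin> \<real>\<^sub>\<le>\<^sub>0"
    and xi0: "\<xi> 0 = 0" and dxi: "\<And>x. x \<ge> 0 \<Longrightarrow> (\<xi> has_vector_derivative wB m a lam x) (at x)"
  shows "(\<lambda>n. \<xi> (real n) - Ffun m a (of_real (real n)) - nu m a * of_real (ln (real n + 1))) \<longlonglongrightarrow> Lfun m a lam"
proof -
  define I where "I = (\<lambda>x::real. csqrt (of_real x ^ m + Pfun m a (of_real x) + lam)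
      - of_real (x powr (real m / 2))
      - (\<Sum>j=1..(m + 1) div 2. bj m a j * of_real (x powr (real m / 2 - real j)))
      - nu m a / (of_real x + 1))"
  define H where "H = (\<lambda>x. \<xi> x - Ffun m a (of_real x) - nu m a * of_real (ln (x + 1)))"
  have Iw: "I x = wB m a lam x - wA m a (of_real x) + nu m a * (1 / of_real x - 1 / (of_real x + 1))" if "x > 0" for x
  proof -
    have x: "x \<ge> 0" "complex_of_real x \<noteq> 0" using that by auto
    show ?thesis unfolding I_def wB_def Qf_def wA_expand[OF x(2)] powr_of_real[OF x(1)]
      by (simp add: algebra_simps)
  qed
  have dH: "(H has_vector_derivative I x) (at x)" if x: "x > 0" for x
  proof -
    have xr: "complex_of_real x \<notin> \<real>\<^sub>\<le>\<^sub>0" using x by simp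
    have "((\<lambda>z. xiA m a z - nu m a * Ln z) has_field_derivative wA m a (of_real x) - nu m a * (1 / of_real x)) (at (of_real x))"
      using DERIV_diff[OF xiA_deriv[OF xr] DERIV_cmult[OF has_field_derivative_Ln[OF xr]]]
      by (simp add: divide_inverse)
    hence "(Ffun m a has_field_derivative wA m a (of_real x) - nu m a * (1 / of_real x)) (at (of_real x))"
      unfolding xiA_def by simp
    hence dF: "((\<lambda>x. Ffun m a (of_real x)) has_vector_derivative wA m a (of_real x) - nu m a * (1 / of_real x)) (at x)"
      by (rule has_vector_derivative_real_field)
    have "((\<lambda>x. ln (x + 1)) has_real_derivative 1 / (x + 1)) (at x)"
      using x by (auto intro!: derivative_eq_intros)
    hence "((\<lambda>x. ln (x + 1)) has_vector_derivative 1 / (x + 1)) (at x)"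
      by (simp add: has_real_derivative_iff_has_vector_derivative)
    hence dl: "((\<lambda>x. complex_of_real (ln (x + 1))) has_vector_derivative of_real (1 / (x + 1))) (at x)"
      by (rule bounded_linear.has_vector_derivative[OF bounded_linear_of_real])
    have "(H has_vector_derivative wB m a lam x - (wA m a (of_real x) - nu m a * (1 / of_real x)) - nu m a * of_real (1 / (x + 1))) (at x)"
      unfolding H_def by (intro has_vector_derivative_diff dxi dF has_vector_derivative_mult_right dl) (use x in auto)
    thus ?thesis unfolding Iw[OF x] by (simp add: algebra_simps)
  qed
  have H0: "H 0 = 0" unfolding H_def by (simp add: xi0 Ffun_def)
  have cH: "continuous_on {0..T} H" for T
  proof -
    have cx: "continuous_on {0..T} \<xi>"
      by (meson dxi has_vector_derivative_continuous continuous_at_imp_continuous_on atLeastAtMost_iff)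
    have cp: "continuous_on {0..T} (\<lambda>x::real. x powr s)" if "s > 0" for s
      using that by (intro continuous_on_powr' continuous_intros) auto
    have "continuous_on {0..T} (\<lambda>x. of_real (2 / (real m + 2) * x powr ((real m + 2) / 2))
     + (\<Sum>j=1..(m + 1) div 2. of_real (2 / (real m + 2 - 2 * real j)) * bj m a j * of_real (x powr ((real m + 2 - 2 * real j) / 2))) :: complex)"
    proof (intro continuous_on_add continuous_on_sum continuous_on_mult continuous_on_const continuous_on_of_real cp)
      fix j assume "j \<in> {1..(m + 1) div 2}"
      hence "2 * j < m + 2" by auto
      hence "real (2 * j) < real (m + 2)" by (simp only: of_nat_less_iff)
      thus "0 < (real m + 2 - 2 * real j) / 2" by simp
    qed auto
    hence cF: "continuous_on {0..T} (\<lambda>x. Ffun m a (of_real x))"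
      by (rule continuous_on_eq) (simp add: Ffun_real)
    have "continuous_on {0..T} (\<lambda>x. ln (x + 1))" by (intro continuous_intros) auto
    hence cl: "continuous_on {0..T} (\<lambda>x. complex_of_real (ln (x + 1)))" by (rule continuous_on_of_real)
    show ?thesis unfolding H_def by (intro continuous_on_diff continuous_on_mult continuous_on_const cx cF cl)
  qed
  have hi: "(I has_integral H v - H u) {u..v}" if "0 \<le> u" "u \<le> v" for u v
    using that by (intro fundamental_theorem_of_calculus_interior continuous_on_subset[OF cH[of v]] dH) auto
  obtain K where K: "K \<ge> 0" "\<And>z. norm z \<ge> 1 \<Longrightarrow>
      norm (Qf m a lam z - wA m a z * wA m a z) \<le> K * norm z powr (real m / 2 - 3 / 2)"
    using Qf_minus_wA_bound[OF m] by blast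
  obtain R where R: "R \<ge> 1" "\<And>z. norm z \<ge> R \<Longrightarrow> norm (Bz m a z - 1) \<le> 1/2"
    using wA_bounds[OF m, of a lam] by blast
  define C where "C = 2 * K + norm (nu m a)"
  \<comment> \<open>The difference of the two roots is \<open>Q - v * v\<close> divided by their
    sum, and the sum is large because \<open>Re w \<ge> 0\<close> and \<open>Re v\<close> is at
    least half of \<open>x powr (m / 2)\<close>.\<close>
  have bI: "norm (I x) \<le> C * x powr (-3/2)" if x: "x \<ge> R" for x
  proof -
    have x1: "x \<ge> 1" "x > 0" using x R by auto
    have nx: "norm (complex_of_real x) = x" using x1 by simp
    define w where "w = wB m a lam x"
    define v where "v = wA m a (of_real x)"
    have w2: "w * w = Qf m a lam (of_real x)" unfolding w_def wB_def by (metis power2_csqrt power2_eq_square)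
    have hB: "Re (Bz m a (of_real x)) \<ge> 1/2"
      using R(2)[of "of_real x"] nx x abs_Re_le_cmod[of "Bz m a (of_real x) - 1"] by auto
    have "v = of_real (x powr (real m / 2)) * Bz m a (of_real x)"
      unfolding v_def wA_def zp_def Bz_def using x1 by (simp only: powr_of_real less_imp_le)
    hence "Re v = x powr (real m / 2) * Re (Bz m a (of_real x))" by simp
    hence "Re v \<ge> x powr (real m / 2) * (1/2)" using mult_left_mono[OF hB, of "x powr (real m / 2)"] by simp
    moreover have "Re w \<ge> 0" unfolding w_def wB_def by (rule Re_csqrt)
    ultimately have "x powr (real m / 2) / 2 \<le> Re (w + v)" by simp
    also have "\<dots> \<le> norm (w + v)" by (rule complex_Re_le_cmod)
    finally have lo: "x powr (real m / 2) / 2 \<le> norm (w + v)" .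
    have "(w - v) * (w + v) = Qf m a lam (of_real x) - v * v" unfolding w2[symmetric] by (simp add: algebra_simps)
    hence "norm (w - v) * norm (w + v) \<le> K * x powr (real m / 2 - 3 / 2)"
      using K(2)[of "of_real x"] nx x1 unfolding v_def by (metis norm_mult)
    moreover have "norm (w - v) * (x powr (real m / 2) / 2) \<le> norm (w - v) * norm (w + v)" using lo by (intro mult_left_mono) auto
    ultimately have "norm (w - v) * x powr (real m / 2) \<le> 2 * K * x powr (real m / 2 - 3 / 2)" by simp
    hence "norm (w - v) \<le> 2 * K * x powr (real m / 2 - 3 / 2) / x powr (real m / 2)"
      using x1 by (simp add: pos_le_divide_eq)
    also have "\<dots> = 2 * K * x powr (-3/2)"
      by (simp only: times_divide_eq_right[symmetric] powr_diff[symmetric]) simp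
    finally have 1: "norm (w - v) \<le> 2 * K * x powr (-3/2)" .
    have "1 / complex_of_real x - 1 / (of_real x + 1) = of_real (1 / (x * (x + 1)))"
    proof -
      have "1 / x - 1 / (x + 1) = 1 / (x * (x + 1))" using x1 by (simp add: field_simps)
      hence "complex_of_real (1 / x - 1 / (x + 1)) = of_real (1 / (x * (x + 1)))" by (rule arg_cong)
      thus ?thesis by (simp only: of_real_diff of_real_divide of_real_add of_real_1)
    qed
    hence "norm (1 / complex_of_real x - 1 / (of_real x + 1)) = 1 / (x * (x + 1))" using x1 by (simp only: norm_of_real) simp
    also have "\<dots> \<le> 1 / (x * x)" using x1 by (intro divide_left_mono mult_left_mono) auto
    also have "\<dots> = x powr (-2)" using x1 powr_realpow[of x 2] by (simp add: powr_minus_divide power2_eq_square)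
    also have "\<dots> \<le> x powr (-3/2)" using x1 by (intro powr_mono) auto
    finally have 2: "norm (nu m a * (1 / complex_of_real x - 1 / (of_real x + 1))) \<le> norm (nu m a) * x powr (-3/2)"
      unfolding norm_mult by (intro mult_left_mono) auto
    have "norm (I x) \<le> norm (w - v) + norm (nu m a * (1 / complex_of_real x - 1 / (of_real x + 1)))"
      unfolding Iw[OF x1(2)] w_def v_def by (rule norm_triangle_ineq)
    thus ?thesis using 1 2 unfolding C_def by (simp add: algebra_simps)
  qed
  have R0: "R > 0" using R by simp
  \<comment> \<open>Truncations at integers, so that dominated convergence turns the improper
    integral into the limit of \<open>H\<close> along the integers.\<close>
  define fk where "fk = (\<lambda>k::nat. \<lambda>x. if x \<in> {R..real k} then I x else 0)"
  have fki: "(fk k has_integral H (real k) - H R) {R..}" if "real k \<ge> R" for k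
    unfolding fk_def using hi[of R "real k"] R0 that by (subst has_integral_restrict) auto
  have fkI: "fk k integrable_on {R..}" for k
  proof (cases "real k \<ge> R")
    case False
    hence "fk k = (\<lambda>x. 0)" unfolding fk_def by auto
    thus ?thesis by (simp only: integrable_0)
  qed (use fki in \<open>auto simp: integrable_on_def\<close>)
  have hint: "(\<lambda>x. C * x powr (-3/2)) integrable_on {R..}"
    using has_integral_powr_to_inf[of "-3/2" R] R0 by (intro integrable_on_mult_right) (auto simp: integrable_on_def)
  have le: "norm (fk k x) \<le> C * x powr (-3/2)" if "x \<in> {R..}" for k x
    using bI[of x] that K(1) unfolding fk_def C_def by auto
  have conv: "(\<lambda>k. fk k x) \<longlonglongrightarrow> I x" if "x \<in> {R..}" for x
  proof (rule tendsto_eventually)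
    show "eventually (\<lambda>k. fk k x = I x) sequentially"
      using eventually_ge_at_top[of "nat \<lceil>x\<rceil>"] by eventually_elim (use that in \<open>auto simp: fk_def nat_le_iff ceiling_le_iff\<close>)
  qed
  have dc: "I integrable_on {R..}" "(\<lambda>k. integral {R..} (fk k)) \<longlonglongrightarrow> integral {R..} I"
    by (rule dominated_convergence[OF fkI hint]; (rule le conv; assumption))+
  have evk: "eventually (\<lambda>k::nat. real k \<ge> R) sequentially"
    using eventually_ge_at_top[of "nat \<lceil>R\<rceil>"] by eventually_elim (simp add: nat_le_iff ceiling_le_iff)
  have "(\<lambda>k. H (real k) - H R) \<longlonglongrightarrow> integral {R..} I"
    by (rule Lim_transform_eventually[OF dc(2)]) (use evk in eventually_elim, use fki in \<open>simp add: integral_unique\<close>)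
  hence lim: "(\<lambda>k. H (real k)) \<longlonglongrightarrow> integral {R..} I + H R"
    using tendsto_add[OF _ tendsto_const[of "H R"]] by fastforce
  have "(I has_integral (H R - H 0) + integral {R..} I) ({0..R} \<union> {R..})"
  proof (rule has_integral_Un)
    show "(I has_integral H R - H 0) {0..R}" using R0 by (intro hi) auto
    show "(I has_integral integral {R..} I) {R..}" by (rule integrable_integral[OF dc(1)])
    have "{0..R} \<inter> {R..} = {R}" using R0 by auto
    thus "negligible ({0..R} \<inter> {R..})" by simp
  qed
  moreover have "{0..R} \<union> {R..} = {0..}" using R0 by auto
  ultimately have "integral {0..} I = H R + integral {R..} I" using H0 by (simp add: integral_unique)
  hence "Lfun m a lam = integral {R..} I + H R" unfolding Lfun_def I_def by simp
  thus ?thesis using lim unfolding H_def by simp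
qed

section \<open>Matching at infinity and transport to the origin\<close>

definition dB where
  "dB m a lam \<xi> x = csqrt (wB m a lam x) * exp (\<xi> x)" for \<xi> :: "real \<Rightarrow> complex"

definition betaB where
  "betaB m a lam \<xi> y x = (deriv y (of_real x) * (1 / wB m a lam x) * dB m a lam \<xi> x + y (of_real x) * dB m a lam \<xi> x
      + Q1 m a lam (of_real x) / (2 * wB m a lam x) * (1 / wB m a lam x) * (1 / wB m a lam x) * y (of_real x) * dB m a lam \<xi> x / 2) / 2"

definition alphaB where
  "alphaB m a lam \<xi> y x = y (of_real x) * dB m a lam \<xi> x - betaB m a lam \<xi> y x"

lemma real_axis_system:
  assumes np: "Qf m a lam (of_real x) \<notin> \<real>\<^sub>\<le>\<^sub>0" and sol: "is_solution m a lam y"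
    and dxi: "(\<xi> has_vector_derivative wB m a lam x) (at x)"
  defines "\<alpha> \<equiv> alphaB m a lam \<xi> y" and "\<beta> \<equiv> betaB m a lam \<xi> y"
  shows "(\<alpha> has_vector_derivative - phiB m a lam x * (\<alpha> x + \<beta> x) / 2) (at x)"
    and "(\<beta> has_vector_derivative 2 * wB m a lam x * \<beta> x + phiB m a lam x * (\<alpha> x + \<beta> x) / 2) (at x)"
proof -
  define w where "w = csqrt (Qf m a lam (of_real x))"
  have wx: "wB m a lam x = w" unfolding w_def wB_def ..
  have w0: "w \<noteq> 0" unfolding w_def using np by auto
  have ww: "w * w = Qf m a lam (of_real x)" unfolding w_def by (metis power2_csqrt power2_eq_square)
  have wnp: "w \<notin> \<real>\<^sub>\<le>\<^sub>0" using w0 np unfolding w_def by simp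
  define q1 where "q1 = Q1 m a lam (of_real x)"
  define q2 where "q2 = Q2 m a lam (of_real x)"
  have cw: "((\<lambda>z. csqrt (Qf m a lam z)) has_field_derivative q1 / (2 * w)) (at (of_real x))"
    unfolding q1_def w_def by (rule has_field_derivative_csqrt'[OF Qf_derivs(1) np])
  have cw1: "((\<lambda>z. Q1 m a lam z / (2 * csqrt (Qf m a lam z))) has_field_derivative q2 / (2 * w) - q1 ^ 2 / (4 * w ^ 3)) (at (of_real x))"
    by (rule DERIV_cong[OF DERIV_divide[OF Qf_derivs(2) DERIV_cmult[OF cw]]])
       (use w0 in \<open>simp_all add: w_def[symmetric] q1_def[symmetric] q2_def[symmetric] field_simps power2_eq_square power3_eq_cube\<close>)
  have cV: "((\<lambda>z. 1 / csqrt (Qf m a lam z)) has_field_derivative - (q1 / (2 * w) * (1 / w) * (1 / w))) (at (of_real x))"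
    by (rule DERIV_cong[OF DERIV_divide[OF DERIV_const cw]])
       (use w0 in \<open>simp_all add: w_def[symmetric] field_simps\<close>)
  have cs: "((\<lambda>z. csqrt (csqrt (Qf m a lam z))) has_field_derivative (q1 / (2 * w)) / (2 * csqrt w)) (at (of_real x))"
    using has_field_derivative_csqrt'[OF cw] wnp unfolding w_def by simp
  have hol: "y holomorphic_on UNIV" and ode: "\<And>z. deriv (deriv y) z = Qf m a lam z * y z"
    using sol unfolding is_solution_def by auto
  have p1: "wB m a lam x * (1 / wB m a lam x) = 1" unfolding wx using w0 by simp
  have p2: "((\<lambda>x. y (of_real x)) has_vector_derivative 1 * deriv y (of_real x)) (at x)"
    using has_vector_derivative_real_field[OF entire_derivs(1)[OF hol]] by simp
  have p3: "((\<lambda>x. deriv y (of_real x)) has_vector_derivative 1 * (Qf m a lam (of_real x) * y (of_real x))) (at x)"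
    using has_vector_derivative_real_field[OF entire_derivs(2)[OF hol]] unfolding ode by simp
  have p4: "((\<lambda>x. Q1 m a lam (of_real x) / (2 * wB m a lam x)) has_vector_derivative 1 * (q2 / (2 * w) - q1 ^ 2 / (4 * w ^ 3))) (at x)"
    using has_vector_derivative_real_field[OF cw1] unfolding wB_def by simp
  have p6: "((\<lambda>x. 1 / wB m a lam x) has_vector_derivative - (1 * (Q1 m a lam (of_real x) / (2 * wB m a lam x) * (1 / wB m a lam x) * (1 / wB m a lam x)))) (at x)"
    using has_vector_derivative_real_field[OF cV] unfolding wB_def[symmetric] wx q1_def by simp
  have dexp: "((\<lambda>x. exp (\<xi> x)) has_vector_derivative wB m a lam x * exp (\<xi> x)) (at x)"
    using field_vector_diff_chain_at[OF dxi DERIV_exp] by (simp add: o_def)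
  have p5: "(dB m a lam \<xi> has_vector_derivative 1 *
      ((wB m a lam x + Q1 m a lam (of_real x) / (2 * wB m a lam x) * (1 / wB m a lam x) / 2) * dB m a lam \<xi> x)) (at x)"
  proof -
    have "((\<lambda>x. csqrt (wB m a lam x)) has_vector_derivative (q1 / (2 * w)) / (2 * csqrt w)) (at x)"
      using has_vector_derivative_real_field[OF cs] unfolding wB_def[symmetric] .
    from has_vector_derivative_mult[OF this dexp]
    have "((\<lambda>x. csqrt (wB m a lam x) * exp (\<xi> x)) has_vector_derivative
      csqrt w * (w * exp (\<xi> x)) + (q1 / (2 * w)) / (2 * csqrt w) * exp (\<xi> x)) (at x)" unfolding wx .
    note d = this
    have "1 / csqrt w = csqrt w / w" using w0 by (simp add: field_simps) (metis power2_csqrt power2_eq_square)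
    moreover have "(q1 / (2 * w)) / (2 * csqrt w) = (q1 / (2 * w)) / 2 * (1 / csqrt w)" by simp
    ultimately have h: "(q1 / (2 * w)) / (2 * csqrt w) = q1 / (2 * w) * (1 / w) / 2 * csqrt w" by simp
    have "csqrt w * (w * exp (\<xi> x)) + (q1 / (2 * w)) / (2 * csqrt w) * exp (\<xi> x)
       = 1 * ((w + q1 / (2 * w) * (1 / w) / 2) * (csqrt w * exp (\<xi> x)))"
      unfolding h by (simp only: ring_distribs mult_1_left mult_ac)
    thus ?thesis using d unfolding dB_def[abs_def] wx q1_def[symmetric] by (simp only:)
  qed
  note sys = wkb_system[where y = "\<lambda>x. y (of_real x)" and ?y1.0 = "\<lambda>x. deriv y (of_real x)" and w = "wB m a lam"
    and ?w1.0 = "\<lambda>x. Q1 m a lam (of_real x) / (2 * wB m a lam x)" and V = "\<lambda>x. 1 / wB m a lam x"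
    and D = "dB m a lam \<xi>"
    and x = x and c = 1 and Q = "Qf m a lam (of_real x)" and ?w2.0 = "q2 / (2 * w) - q1 ^ 2 / (4 * w ^ 3)", OF p1 p2 p3 p4 p5 p6]
  have ph: "(Qf m a lam (of_real x) - wB m a lam x * wB m a lam x) * (1 / wB m a lam x)
      + (q2 / (2 * w) - q1 ^ 2 / (4 * w ^ 3)) * (1 / wB m a lam x) * (1 / wB m a lam x) / 2
      - 3 * (Q1 m a lam (of_real x) / (2 * wB m a lam x)) * (Q1 m a lam (of_real x) / (2 * wB m a lam x)) * (1 / wB m a lam x) * (1 / wB m a lam x) * (1 / wB m a lam x) / 4
      = phiB m a lam x"
    unfolding phiB_def wx q1_def[symmetric] q2_def[symmetric] ww using w0
    by (simp add: field_simps power2_eq_square power3_eq_cube eval_nat_numeral)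
  show "(\<alpha> has_vector_derivative - phiB m a lam x * (\<alpha> x + \<beta> x) / 2) (at x)"
    using sys(1) unfolding ph \<alpha>_def \<beta>_def alphaB_def[abs_def] betaB_def[abs_def] by simp
  show "(\<beta> has_vector_derivative 2 * wB m a lam x * \<beta> x + phiB m a lam x * (\<alpha> x + \<beta> x) / 2) (at x)"
    using sys(2) unfolding ph \<alpha>_def \<beta>_def alphaB_def[abs_def] betaB_def[abs_def] by simp
qed

lemma Qf_over_power_tendsto: "m \<ge> 1 \<Longrightarrow> (\<lambda>n. Qf m a lam (of_real (real n)) / of_real (real n ^ m)) \<longlonglongrightarrow> 1"
proof -
  assume m: "m \<ge> 1"
  define p where "p = 1 + Apoly m a + monom lam m"
  have p0: "coeff p 0 = 1" using m unfolding p_def Apoly_def by (auto simp: coeff_sum)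
  obtain K where K: "\<And>z::complex. norm z \<ge> 1 \<Longrightarrow> norm (poly p (1 / z) - 1) \<le> K / norm z"
    using poly_inverse_limit[of p] unfolding p0 by blast
  have e: "Qf m a lam z / z ^ m = poly p (1 / z)" if "z \<noteq> 0" for z
    unfolding Qf_def Pfun_eq_Apoly[OF that] p_def using that
    by (simp add: poly_monom field_simps)
  have "eventually (\<lambda>n. norm (Qf m a lam (of_real (real n)) / of_real (real n ^ m) - 1) \<le> K / real n) sequentially"
    using eventually_ge_at_top[of 1]
  proof eventually_elim
    case (elim n)
    thus ?case using K[of "of_real (real n)"] e[of "of_real (real n)"] by simp
  qed
  moreover have "(\<lambda>n. K / real n) \<longlonglongrightarrow> 0" by (rule lim_const_over_n)
  ultimately have "(\<lambda>n. Qf m a lam (of_real (real n)) / of_real (real n ^ m) - 1) \<longlonglongrightarrow> 0"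
    by (rule Lim_null_comparison)
  thus ?thesis by (simp only: LIM_zero_iff)
qed

text \<open>Sibuya's solution is normalised at infinity, whereas the phase \<open>\<xi>\<close>
  vanishes at 0. The discrepancy of the two normalisations is the factor
  \<open>exp (Lfun m a lam)\<close>.\<close>

lemma wkb_limits:
  assumes m: "m \<ge> 3" and sib: "is_sibuya_sol m a lam y"
    and np: "\<And>x. x \<ge> 0 \<Longrightarrow> Qf m a lam (of_real x) \<notin> \<real>\<^sub>\<le>\<^sub>0"
    and xi0: "\<xi> 0 = 0" and dxi: "\<And>x. x \<ge> 0 \<Longrightarrow> (\<xi> has_vector_derivative wB m a lam x) (at x)"
  shows "(\<lambda>n. y (of_real (real n)) * dB m a lam \<xi> (real n)) \<longlonglongrightarrow> exp (Lfun m a lam)"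
    and "(\<lambda>n. deriv y (of_real (real n)) * (1 / wB m a lam (real n)) * dB m a lam \<xi> (real n)) \<longlonglongrightarrow> - exp (Lfun m a lam)"
proof -
  define z where "z = (\<lambda>n::nat. complex_of_real (real n))"
  define A1 where "A1 = (\<lambda>n. y (z n) / asym m a (z n))"
  define A2 where "A2 = (\<lambda>n. deriv y (z n) / asym' m a (z n))"
  have "\<bar>0::real\<bar> < 3 * pi / (real m + 2)" by simp
  note as = sibuya_asymptotics[OF m this sib, unfolded cis_zero mult_1_right]
  have A1: "A1 \<longlonglongrightarrow> 1" unfolding A1_def z_def by (rule filterlim_compose[OF as(1) filterlim_real_sequentially])
  have A2: "A2 \<longlonglongrightarrow> 1" unfolding A2_def z_def by (rule filterlim_compose[OF as(2) filterlim_real_sequentially])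
  define u where "u = (\<lambda>n::nat. Qf m a lam (z n) / of_real (real n ^ m))"
  have u: "u \<longlonglongrightarrow> 1" unfolding u_def z_def using m by (intro Qf_over_power_tendsto) simp
  have c1: "isCont csqrt 1" by (rule DERIV_isCont[OF has_field_derivative_csqrt]) simp
  have cu: "(\<lambda>n. csqrt (u n)) \<longlonglongrightarrow> 1" using isCont_tendsto_compose[OF c1 u] by simp
  have ccu: "(\<lambda>n. csqrt (csqrt (u n))) \<longlonglongrightarrow> 1" using isCont_tendsto_compose[OF c1 cu] by simp
  define H where "H = (\<lambda>n::nat. \<xi> (real n) - Ffun m a (z n) - nu m a * of_real (ln (real n + 1)))"
  have H: "H \<longlonglongrightarrow> Lfun m a lam" unfolding H_def z_def by (rule action_limit[OF m np xi0 dxi])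
  have "(\<lambda>n. ln (1 + 1 / real n)) \<longlonglongrightarrow> ln (1 + 0)"
    by (intro tendsto_intros lim_const_over_n) simp
  hence l: "(\<lambda>n. complex_of_real (ln (1 + 1 / real n))) \<longlonglongrightarrow> 0" using tendsto_of_real by fastforce
  \<comment> \<open>The product of Sibuya's leading term and \<open>dB\<close>: the iterated root
    compares the fourth root of the potential with n^(m/4), and the logarithm of
    \<open>1 + 1 / n\<close> trades \<open>ln n\<close> in the asymptotics for the
    \<open>ln (n + 1)\<close> of the action.\<close>
  define G where "G = (\<lambda>n. csqrt (csqrt (u n)) * exp (H n + nu m a * of_real (ln (1 + 1 / real n))))"
  have "G \<longlonglongrightarrow> 1 * exp (Lfun m a lam + nu m a * 0)"
    unfolding G_def by (intro tendsto_mult ccu tendsto_exp tendsto_add H tendsto_const l)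
  hence G: "G \<longlonglongrightarrow> exp (Lfun m a lam)" by simp
  have w: "wB m a lam (real n) = of_real (real n powr (real m / 2)) * csqrt (u n)" if n: "n \<ge> 1" for n
  proof -
    have 1: "Qf m a lam (complex_of_real (real n)) = of_real (real n ^ m) * u n" unfolding u_def z_def using n by simp
    have 2: "sqrt (real n ^ m) = real n powr (real m / 2)"
      using n by (simp add: powr_half_sqrt[symmetric] powr_realpow[symmetric] powr_powr)
    have 3: "real n ^ m > 0" using n by simp
    show ?thesis unfolding wB_def 1 csqrt_scale[OF 3] 2 ..
  qed
  have cw: "csqrt (wB m a lam (real n)) = of_real (real n powr (real m / 4)) * csqrt (csqrt (u n))" if n: "n \<ge> 1" for n
  proof -
    have "sqrt (real n powr (real m / 2)) = real n powr (real m / 4)"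
      using n by (simp add: powr_half_sqrt[symmetric] powr_powr)
    thus ?thesis unfolding w[OF n] using n by (subst csqrt_scale) auto
  qed
  have zp: "asym m a (z n) * dB m a lam \<xi> (real n) = G n"
    if n: "n \<ge> 1" for n
  proof -
    have z0: "z n \<noteq> 0" using n unfolding z_def by simp
    have Lz: "Ln (z n) = of_real (ln (real n))" using n unfolding z_def by (simp add: Ln_of_real)
    have "real n powr (real m / 4) = exp (real m / 4 * ln (real n))" using n by (simp add: powr_def)
    hence r: "complex_of_real (real n powr (real m / 4)) = exp (of_real (real m / 4) * of_real (ln (real n)))"
      by (metis exp_of_real of_real_mult)
    have mu1: "mu m a - of_real (real m / 2) = - of_real (real m / 4) - nu m a"
      unfolding mu_def by (simp add: field_simps)
    have "ln (1 + 1 / real n) = ln ((real n + 1) / real n)" using n by (simp add: field_simps)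
    also have "\<dots> = ln (real n + 1) - ln (real n)" using n by (simp add: ln_div)
    finally have l: "complex_of_real (ln (1 + 1 / real n)) = of_real (ln (real n + 1)) - of_real (ln (real n))" by simp
    have alg: "(- p - v) * L + - F + (p * L + x) = x - F - v * L1 + v * (L1 - L)" for p v L F x L1 :: complex
      by (simp add: algebra_simps)
    have "asym m a (z n) * (of_real (real n powr (real m / 4)) * exp (\<xi> (real n)))
      = exp (H n + nu m a * of_real (ln (1 + 1 / real n)))"
      unfolding asym_def mu1 powr_def[of "z n"] Lz r H_def l using z0
      by (simp only: exp_add[symmetric] if_False) (rule arg_cong[where f = exp], rule alg)
    thus ?thesis unfolding dB_def cw[OF n] G_def by (simp add: mult_ac)
  qed
  have y1: "A1 n * G n = y (z n) * dB m a lam \<xi> (real n)" if n: "n \<ge> 1" for n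
    unfolding zp[OF n, symmetric] A1_def asym_def using n by (simp add: z_def)
  have "(\<lambda>n. A1 n * G n) \<longlonglongrightarrow> 1 * exp (Lfun m a lam)" by (intro tendsto_mult A1 G)
  thus "(\<lambda>n. y (of_real (real n)) * dB m a lam \<xi> (real n)) \<longlonglongrightarrow> exp (Lfun m a lam)"
    unfolding mult_1_left z_def[symmetric]
    by (rule Lim_transform_eventually) (use eventually_ge_at_top[of 1] in eventually_elim, use y1 in \<open>simp add: z_def\<close>)
  have y2: "- (A2 n * G n * (1 / csqrt (u n))) = deriv y (z n) * (1 / wB m a lam (real n)) * dB m a lam \<xi> (real n)" if n: "n \<ge> 1" for n
  proof -
    have z0: "z n \<noteq> 0" using n unfolding z_def by simp
    have mu2: "mu m a = of_real (real m / 2) + (mu m a - of_real (real m / 2))" by simp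
    have e1: "z n powr mu m a = of_real (real n powr (real m / 2)) * z n powr (mu m a - of_real (real m / 2))"
      by (subst mu2, subst powr_add) (simp only: z_def powr_of_real[OF of_nat_0_le_iff])
    have "deriv y (z n) = - A2 n * (z n powr mu m a * exp (- Ffun m a (z n)))"
      unfolding A2_def asym'_def using z0 by simp
    hence "deriv y (z n) * dB m a lam \<xi> (real n) = - A2 n * of_real (real n powr (real m / 2)) * G n"
      unfolding zp[OF n, symmetric] asym_def e1 by (simp add: mult_ac)
    hence "deriv y (z n) * (1 / wB m a lam (real n)) * dB m a lam \<xi> (real n) = (- A2 n * of_real (real n powr (real m / 2)) * G n) / wB m a lam (real n)"
      by (simp add: divide_simps mult_ac)
    thus ?thesis unfolding w[OF n] using n by simp
  qed
  have "(\<lambda>n. - (A2 n * G n * (1 / csqrt (u n)))) \<longlonglongrightarrow> - (1 * exp (Lfun m a lam) * (1 / 1))"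
    by (intro tendsto_mult A2 G tendsto_minus tendsto_divide tendsto_const cu) simp
  hence "(\<lambda>n. - (A2 n * G n * (1 / csqrt (u n)))) \<longlonglongrightarrow> - exp (Lfun m a lam)" by simp
  thus "(\<lambda>n. deriv y (of_real (real n)) * (1 / wB m a lam (real n)) * dB m a lam \<xi> (real n)) \<longlonglongrightarrow> - exp (Lfun m a lam)"
    unfolding z_def[symmetric]
    by (rule Lim_transform_eventually) (use eventually_ge_at_top[of 1] in eventually_elim, use y2 in \<open>simp add: z_def\<close>)
qed

text \<open>At infinity the diagonal variables tend to \<open>exp (Lfun m a lam)\<close> and 0; the
  a priori estimate carries this to 0, with an error relative to \<open>exp (Lfun m a lam)\<close>.
  The extra term in \<open>e2\<close> stems from the derivative of the amplitude, which enters
  \<open>deriv y\<close> but not \<open>y\<close>.\<close>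

lemma wkb_real_axis:
  fixes K k :: "real \<Rightarrow> real"
  assumes m: "m \<ge> 3" and sib: "is_sibuya_sol m a lam y"
    and np: "\<And>x. x \<ge> 0 \<Longrightarrow> Qf m a lam (of_real x) \<notin> \<real>\<^sub>\<le>\<^sub>0"
    and dK: "\<And>x. x \<ge> 0 \<Longrightarrow> (K has_real_derivative k x) (at x)"
    and phi: "\<And>x. x \<ge> 0 \<Longrightarrow> norm (phiB m a lam x) \<le> k x"
    and Kle: "\<And>x. x \<ge> 0 \<Longrightarrow> K x - K 0 \<le> \<kappa>" and kap: "\<kappa> \<le> 1/2"
    and lim0: "(\<lambda>n. Q1 m a lam (of_real (real n)) / wB m a lam (real n) ^ 3) \<longlonglongrightarrow> 0"
  shows "\<exists>e1 e2. norm e1 \<le> 2 * \<kappa> \<and> norm e2 \<le> 2 * \<kappa> + norm (Q1 m a lam 0 / wB m a lam 0 ^ 3) \<and>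
     y 0 = exp (Lfun m a lam) * (1 + e1) / csqrt (wB m a lam 0) \<and>
     deriv y 0 = - csqrt (wB m a lam 0) * exp (Lfun m a lam) * (1 + e2)"
proof -
  have sol: "is_solution m a lam y"
    using sib unfolding is_sibuya_sol_def is_solution_def Qf_def by blast
  obtain \<xi> where xi0: "\<xi> 0 = 0" and dxi: "\<And>x. x \<ge> 0 \<Longrightarrow> (\<xi> has_vector_derivative wB m a lam x) (at x)"
    using wB_antiderivative[OF np] by blast
  define D where "D = dB m a lam \<xi>"
  define \<alpha> where "\<alpha> = alphaB m a lam \<xi> y"
  define \<beta> where "\<beta> = betaB m a lam \<xi> y"
  have sys: "(\<alpha> has_vector_derivative - phiB m a lam x * (\<alpha> x + \<beta> x) / 2) (at x)"
    "(\<beta> has_vector_derivative 2 * wB m a lam x * \<beta> x + phiB m a lam x * (\<alpha> x + \<beta> x) / 2) (at x)" if "x \<ge> 0" for x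
    using real_axis_system[OF np[OF that] sol dxi[OF that]] unfolding \<alpha>_def \<beta>_def .
  define e where "e = exp (Lfun m a lam)"
  define v where "v = (\<lambda>x. Q1 m a lam (of_real x) / wB m a lam x ^ 3)"
  have wl: "(\<lambda>n. y (of_real (real n)) * D (real n)) \<longlonglongrightarrow> e"
    "(\<lambda>n. deriv y (of_real (real n)) * (1 / wB m a lam (real n)) * D (real n)) \<longlonglongrightarrow> - e"
    unfolding D_def e_def by (rule wkb_limits[OF m sib np xi0 dxi]; assumption)+
  have b_eq: "\<beta> x = (deriv y (of_real x) * (1 / wB m a lam x) * D x + y (of_real x) * D x + v x / 4 * (y (of_real x) * D x)) / 2" for x
    unfolding \<beta>_def betaB_def D_def v_def by (simp add: power3_eq_cube)
  have "(\<lambda>n. \<beta> (real n)) \<longlonglongrightarrow> (- e + e + 0 / 4 * e) / 2"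
    unfolding b_eq v_def by (intro tendsto_divide tendsto_add tendsto_mult tendsto_const wl lim0) simp_all
  hence lb: "(\<lambda>n. \<beta> (real n)) \<longlonglongrightarrow> 0" by simp
  have "(\<lambda>n. \<alpha> (real n)) \<longlonglongrightarrow> e - 0"
    unfolding \<alpha>_def alphaB_def D_def[symmetric] \<beta>_def[symmetric] by (intro tendsto_diff wl lb)
  hence la: "(\<lambda>n. \<alpha> (real n)) \<longlonglongrightarrow> e" by simp
  have est: "norm (\<alpha> 0 - \<alpha> (real n)) \<le> (norm (\<alpha> (real n)) + norm (\<beta> (real n))) * \<kappa>"
    "norm (\<beta> 0) \<le> norm (\<beta> (real n)) + (norm (\<alpha> (real n)) + norm (\<beta> (real n))) * \<kappa>" for n
  proof -
    have w: "Re (wB m a lam x) \<ge> 0" for x unfolding wB_def by (rule Re_csqrt)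
    have sm: "K (real n) - K 0 \<le> 1/2" using Kle[of "real n"] kap by simp
    have st: "(0::real) \<le> real n" by simp
    have "norm (\<alpha> 0 - \<alpha> (real n)) \<le> (norm (\<alpha> (real n)) + norm (\<beta> (real n))) * (K (real n) - K 0)"
      "norm (\<beta> 0) \<le> norm (\<beta> (real n)) + (norm (\<alpha> (real n)) + norm (\<beta> (real n))) * (K (real n) - K 0)"
      by (rule wkb_apriori[where w = "wB m a lam" and \<phi> = "phiB m a lam" and \<xi> = \<xi> and k = k, OF st _ _ _ _ _ _ sm];
          use sys dxi w dK phi in auto)+
    moreover have "(norm (\<alpha> (real n)) + norm (\<beta> (real n))) * (K (real n) - K 0) \<le> (norm (\<alpha> (real n)) + norm (\<beta> (real n))) * \<kappa>"
      using Kle[of "real n"] by (intro mult_left_mono) auto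
    ultimately show "norm (\<alpha> 0 - \<alpha> (real n)) \<le> (norm (\<alpha> (real n)) + norm (\<beta> (real n))) * \<kappa>"
    "norm (\<beta> 0) \<le> norm (\<beta> (real n)) + (norm (\<alpha> (real n)) + norm (\<beta> (real n))) * \<kappa>" by linarith+
  qed
  have a0: "norm (\<alpha> 0 - e) \<le> (norm e + norm (0::complex)) * \<kappa>"
  proof (rule LIMSEQ_le)
    show "(\<lambda>n. norm (\<alpha> 0 - \<alpha> (real n))) \<longlonglongrightarrow> norm (\<alpha> 0 - e)" by (intro tendsto_intros la)
    show "(\<lambda>n. (norm (\<alpha> (real n)) + norm (\<beta> (real n))) * \<kappa>) \<longlonglongrightarrow> (norm e + norm (0::complex)) * \<kappa>"
      by (intro tendsto_intros la lb)
  qed (use est in blast)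
  have b0: "norm (\<beta> 0) \<le> norm (0::complex) + (norm e + norm (0::complex)) * \<kappa>"
  proof (rule LIMSEQ_le)
    show "(\<lambda>n. norm (\<beta> (real n)) + (norm (\<alpha> (real n)) + norm (\<beta> (real n))) * \<kappa>)
        \<longlonglongrightarrow> norm (0::complex) + (norm e + norm (0::complex)) * \<kappa>"
      by (intro tendsto_intros la lb)
  qed (rule tendsto_const, use est in blast)
  have e0: "e \<noteq> 0" unfolding e_def by simp
  define p where "p = \<alpha> 0 / e - 1"
  define q where "q = \<beta> 0 / e"
  have p: "norm p \<le> \<kappa>"
  proof -
    have "p = (\<alpha> 0 - e) / e" unfolding p_def using e0 by (simp add: diff_divide_distrib)
    thus ?thesis using a0 e0 by (simp add: norm_divide divide_le_eq mult.commute)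
  qed
  have q: "norm q \<le> \<kappa>" using b0 e0 unfolding q_def by (simp add: norm_divide divide_le_eq mult.commute)
  have ap: "\<alpha> 0 = e * (1 + p)" and bq: "\<beta> 0 = e * q" unfolding p_def q_def using e0 by (simp_all add: field_simps)
  define s where "s = csqrt (wB m a lam 0)"
  have w0: "wB m a lam 0 \<noteq> 0" using np[of 0] unfolding wB_def by auto
  have s0: "s \<noteq> 0" unfolding s_def using w0 by simp
  have ss: "s * s = wB m a lam 0" unfolding s_def by (metis power2_csqrt power2_eq_square)
  have D0: "D 0 = s" unfolding D_def dB_def s_def xi0 by simp
  have sum: "\<alpha> 0 + \<beta> 0 = y 0 * s"
    unfolding D0[symmetric] \<alpha>_def \<beta>_def D_def alphaB_def by simp
  \<comment> \<open>Obtained by solving the definitions of \<open>\<alpha> 0\<close> and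
    \<open>\<beta> 0\<close> for \<open>y 0\<close> and \<open>deriv y 0\<close>.\<close>
  define e1 where "e1 = p + q"
  define e2 where "e2 = p - q + v 0 / 4 * (1 + p + q)"
  have y0: "y 0 = e * (1 + e1) / s"
  proof -
    have "y 0 = (\<alpha> 0 + \<beta> 0) / s" unfolding sum using s0 by simp
    thus ?thesis unfolding ap bq e1_def by (simp add: algebra_simps)
  qed
  have y1: "deriv y 0 = - s * e * (1 + e2)"
  proof -
    have "deriv y 0 / (s * s) * s = 2 * \<beta> 0 - (\<alpha> 0 + \<beta> 0) - v 0 / 4 * (\<alpha> 0 + \<beta> 0)"
      unfolding sum unfolding b_eq[of 0] D0 ss[symmetric] using s0 by (simp add: field_simps)
    also have "\<dots> = - (e * (1 + e2))" unfolding ap bq e2_def by (simp add: algebra_simps)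
    finally have "deriv y 0 / s = - (e * (1 + e2))" using s0 by simp
    thus ?thesis using s0 by (simp add: field_simps)
  qed
  have n1: "norm e1 \<le> 2 * \<kappa>" unfolding e1_def using norm_triangle_ineq[of p q] p q by linarith
  have n2: "norm e2 \<le> 2 * \<kappa> + norm (v 0)"
  proof -
    have "norm (1 + e1) \<le> 1 + norm e1" using norm_triangle_ineq[of 1 e1] by simp
    also have "\<dots> \<le> 2" using n1 kap by simp
    finally have "norm (v 0 / 4 * (1 + e1)) \<le> norm (v 0) / 4 * 2"
      unfolding norm_mult norm_divide by (intro mult_mono) auto
    also have "\<dots> \<le> norm (v 0)" by simp
    finally have "norm (v 0 / 4 * (1 + e1)) \<le> norm (v 0)" .
    moreover have "norm (p - q) \<le> 2 * \<kappa>" using norm_triangle_ineq4[of p q] p q by linarith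
    moreover have "e2 = (p - q) + v 0 / 4 * (1 + e1)" unfolding e2_def e1_def by simp
    ultimately show ?thesis using norm_triangle_ineq[of "p - q" "v 0 / 4 * (1 + e1)"] by simp
  qed
  show ?thesis
    using y0 y1 n1 n2 unfolding s_def e_def v_def by (intro exI[of _ e1] exI[of _ e2]) auto
qed

section \<open>Bounds uniform in the coefficients and in the direction of \<open>lam\<close>\<close>

lemma pderiv_sum_poly: "pderiv (sum f A) = (\<Sum>x\<in>A. pderiv (f x))"
  by (induction A rule: infinite_finite_induct) (simp_all add: pderiv_add)

lemma Q1_expand: "Q1 m a lam z = of_nat m * z ^ (m - 1) + (\<Sum>j=1..m. of_nat (m - j) * a j * z ^ (m - j - 1))"
  unfolding Q1_def qpoly_def Ppoly_def
  by (simp add: pderiv_add pderiv_sum_poly pderiv_monom poly_monom poly_sum)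

lemma Q2_expand: "Q2 m a lam z = of_nat (m - 1) * of_nat m * z ^ (m - 1 - 1)
    + (\<Sum>j=1..m. of_nat (m - j - 1) * (of_nat (m - j) * a j) * z ^ (m - j - 1 - 1))"
  unfolding Q2_def qpoly_def Ppoly_def
  by (simp add: pderiv_add pderiv_sum_poly pderiv_monom poly_monom poly_sum)

lemma sum_power_bound:
  fixes c :: "nat \<Rightarrow> complex" and e :: "nat \<Rightarrow> nat"
  assumes "\<And>j. j \<in> {1..m} \<Longrightarrow> norm (c j) \<le> B" "\<And>j. j \<in> {1..m} \<Longrightarrow> e j \<le> N" "0 \<le> x" "x \<le> Y" "1 \<le> Y" "0 \<le> B"
  shows "norm (\<Sum>j=1..m. c j * of_real x ^ e j) \<le> real m * B * Y ^ N"
proof -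
  have "norm (\<Sum>j=1..m. c j * of_real x ^ e j) \<le> (\<Sum>j=1..m. B * Y ^ N)"
  proof (rule sum_norm_le)
    fix j assume j: "j \<in> {1..m}"
    have "x ^ e j \<le> Y ^ e j" using assms by (intro power_mono) auto
    also have "\<dots> \<le> Y ^ N" using assms j by (intro power_increasing) auto
    finally show "norm (c j * of_real x ^ e j) \<le> B * Y ^ N"
      unfolding norm_mult norm_power using assms j by (intro mult_mono) auto
  qed
  thus ?thesis by simp
qed

lemma power_sum_lower: "(x + l) ^ m \<le> 2 ^ m * (x ^ m + l ^ m)" if "x \<ge> 0" "l \<ge> 0" for x l :: real
proof -
  have "(x + l) ^ m \<le> (2 * max x l) ^ m" using that by (intro power_mono) auto
  also have "\<dots> = 2 ^ m * (max x l) ^ m" by (rule power_mult_distrib)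
  also have "\<dots> \<le> 2 ^ m * (x ^ m + l ^ m)" using that by (intro mult_left_mono) (auto simp: max_def)
  finally show ?thesis .
qed

text \<open>With |\<lambda>| written as \<open>l ^ m\<close>, the terms x^m and \<lambda> have the
  same homogeneity and cannot cancel away from the negative direction. The lower order terms are
  smaller by a factor 1/(x + l) and cost half of the bound once \<open>l\<close> is large. The slack
  \<open>s\<close> makes the same inequality keep the potential off the branch cut.\<close>

lemma Qf_lower_bound:
  assumes m: "m \<ge> 1" and a: "\<And>j. j \<in> {1..m} \<Longrightarrow> norm (a j) \<le> R" and R: "R \<ge> 0"
    and d: "0 < \<delta>" "\<delta> \<le> pi" and th: "\<bar>\<theta>\<bar> \<le> pi - \<delta>"
    and l: "l \<ge> 1" "l \<ge> 2 ^ (m + 1) * real m * R / cos ((pi - \<delta>) / 2)"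
    and x: "x \<ge> 0" and s: "s \<ge> 0"
  shows "norm (Qf m a (of_real (l ^ m) * cis \<theta>) (of_real x) + of_real s) \<ge> cos ((pi - \<delta>) / 2) / 2 / 2 ^ m * (x + l) ^ m"
proof -
  define c where "c = cos ((pi - \<delta>) / 2)"
  have c: "c > 0" unfolding c_def using d by (intro cos_gt_zero_pi) auto
  define Y where "Y = x + l"
  have Y: "Y \<ge> 1" "x \<le> Y" "l \<le> Y" unfolding Y_def using l x by auto
  have P: "norm (Pfun m a (of_real x)) \<le> real m * R * Y ^ (m - 1)"
    unfolding Pfun_def by (rule sum_power_bound[OF a]) (use x Y R in auto)
  have YY: "Y ^ m = Y * Y ^ (m - 1)" using m by (metis power_eq_if One_nat_def not_one_le_zero)
  have lo: "norm (of_real (l ^ m) * cis \<theta> + of_real (x ^ m + s)) \<ge> c * (l ^ m + (x ^ m + s))"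
    unfolding c_def using d th l x s by (intro norm_cis_add_ge) auto
  have "real m * R * Y ^ (m - 1) * 2 ^ (m + 1) \<le> c * Y ^ m"
  proof -
    have "2 ^ (m + 1) * real m * R \<le> c * l" using l(2) c unfolding c_def[symmetric] by (simp add: divide_le_eq mult.commute)
    also have "\<dots> \<le> c * Y" using Y c by (intro mult_left_mono) auto
    finally have "2 ^ (m + 1) * real m * R * Y ^ (m - 1) \<le> c * Y * Y ^ (m - 1)" using Y by (intro mult_right_mono) auto
    thus ?thesis unfolding YY by (simp add: mult_ac)
  qed
  hence "norm (Pfun m a (of_real x)) * 2 ^ (m + 1) \<le> c * Y ^ m"
    using P by (meson mult_right_mono order_trans zero_le_numeral zero_le_power)
  hence Ple: "norm (Pfun m a (of_real x)) \<le> c * Y ^ m / 2 ^ (m + 1)" by (simp add: le_divide_eq)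
  have "Y ^ m \<le> 2 ^ m * (x ^ m + l ^ m)" unfolding Y_def using x l by (intro power_sum_lower) auto
  also have "\<dots> \<le> 2 ^ m * (l ^ m + (x ^ m + s))" using s by simp
  finally have "c * Y ^ m \<le> c * (2 ^ m * (l ^ m + (x ^ m + s)))" using c by (intro mult_left_mono) auto
  hence big: "c * Y ^ m / 2 ^ m \<le> c * (l ^ m + (x ^ m + s))" by (simp add: divide_le_eq mult_ac)
  have "Qf m a (of_real (l ^ m) * cis \<theta>) (of_real x) + of_real s =
     (of_real (l ^ m) * cis \<theta> + of_real (x ^ m + s)) + Pfun m a (of_real x)"
    unfolding Qf_def by simp
  hence "norm (Qf m a (of_real (l ^ m) * cis \<theta>) (of_real x) + of_real s) \<ge>
     norm (of_real (l ^ m) * cis \<theta> + of_real (x ^ m + s)) - norm (Pfun m a (of_real x))"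
    by (metis norm_diff_ineq)
  hence "norm (Qf m a (of_real (l ^ m) * cis \<theta>) (of_real x) + of_real s) \<ge> c * Y ^ m / 2 ^ m - c * Y ^ m / 2 ^ (m + 1)"
    using lo big Ple by linarith
  thus ?thesis unfolding c_def[symmetric] Y_def[symmetric] by (simp add: field_simps)
qed

lemma Qf_not_nonpos:
  assumes "\<And>s. s \<ge> 0 \<Longrightarrow> norm (Qf m a lam (of_real x) + of_real s) \<ge> B" "B > 0"
  shows "Qf m a lam (of_real x) \<notin> \<real>\<^sub>\<le>\<^sub>0"
proof
  assume "Qf m a lam (of_real x) \<in> \<real>\<^sub>\<le>\<^sub>0"
  then obtain q where q: "Qf m a lam (of_real x) = of_real q" "q \<le> 0" by (auto elim: nonpos_Reals_cases)
  have "norm (Qf m a lam (of_real x) + of_real (- q)) = 0" unfolding q by simp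
  thus False using assms(1)[of "- q"] assms(2) q(2) by simp
qed

lemma Q12_bounds:
  assumes m: "m \<ge> 1" and a: "\<And>j. j \<in> {1..m} \<Longrightarrow> norm (a j) \<le> R" and R: "R \<ge> 0"
    and x: "x \<ge> 0" "x \<le> Y" "1 \<le> Y"
  defines "B \<equiv> real m ^ 2 + real m ^ 3 * R"
  shows "norm (Q1 m a lam (of_real x)) \<le> B * Y ^ (m - 1)" "norm (Q2 m a lam (of_real x)) \<le> B * Y ^ (m - 1 - 1)"
proof -
  have xp: "x ^ k \<le> Y ^ k" for k using x by (intro power_mono)
  have m1: "real m \<ge> 1" using m by simp
  have mm: "real m \<le> real m ^ 2" "real m ^ 2 \<le> real m ^ 3" using m1 by (simp_all add: self_le_power power_increasing)
  have bj1: "norm (of_nat (m - j) * a j) \<le> real m * R" if "j \<in> {1..m}" for j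
    unfolding norm_mult using a[OF that] by (intro mult_mono) auto
  have bj2: "norm (of_nat (m - j - 1) * (of_nat (m - j) * a j)) \<le> real m * (real m * R)" if "j \<in> {1..m}" for j
    unfolding norm_mult[of "of_nat (m - j - 1)"] using bj1[OF that] by (intro mult_mono) auto
  have "norm (Q1 m a lam (of_real x)) \<le> norm (of_nat m * of_real x ^ (m - 1) :: complex) +
      norm (\<Sum>j=1..m. of_nat (m - j) * a j * of_real x ^ (m - j - 1))"
    unfolding Q1_expand by (rule norm_triangle_ineq)
  also have "\<dots> \<le> real m * Y ^ (m - 1) + real m * (real m * R) * Y ^ (m - 1)"
  proof (rule add_mono)
    show "norm (of_nat m * of_real x ^ (m - 1) :: complex) \<le> real m * Y ^ (m - 1)"
      using xp x by (simp add: norm_mult norm_power mult_left_mono)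
    show "norm (\<Sum>j=1..m. of_nat (m - j) * a j * of_real x ^ (m - j - 1)) \<le> real m * (real m * R) * Y ^ (m - 1)"
      by (rule sum_power_bound[OF bj1]) (use x R in auto)
  qed
  also have "\<dots> = (real m + real m ^ 2 * R) * Y ^ (m - 1)" by (simp add: algebra_simps power2_eq_square)
  also have "\<dots> \<le> B * Y ^ (m - 1)" unfolding B_def using x R mm by (intro mult_right_mono add_mono mult_right_mono) auto
  finally show "norm (Q1 m a lam (of_real x)) \<le> B * Y ^ (m - 1)" .
  have "norm (Q2 m a lam (of_real x)) \<le> norm (of_nat (m - 1) * of_nat m * of_real x ^ (m - 1 - 1) :: complex) +
      norm (\<Sum>j=1..m. of_nat (m - j - 1) * (of_nat (m - j) * a j) * of_real x ^ (m - j - 1 - 1))"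
    unfolding Q2_expand by (rule norm_triangle_ineq)
  also have "\<dots> \<le> real m * real m * Y ^ (m - 1 - 1) + real m * (real m * (real m * R)) * Y ^ (m - 1 - 1)"
  proof (rule add_mono)
    have "norm (of_nat (m - 1) * of_nat m * of_real x ^ (m - 1 - 1) :: complex) = real (m - 1) * real m * x ^ (m - 1 - 1)"
      using x by (simp add: norm_mult norm_power)
    also have "\<dots> \<le> real m * real m * Y ^ (m - 1 - 1)" using x xp by (intro mult_mono) auto
    finally show "norm (of_nat (m - 1) * of_nat m * of_real x ^ (m - 1 - 1) :: complex) \<le> real m * real m * Y ^ (m - 1 - 1)" .
    show "norm (\<Sum>j=1..m. of_nat (m - j - 1) * (of_nat (m - j) * a j) * of_real x ^ (m - j - 1 - 1)) \<le> real m * (real m * (real m * R)) * Y ^ (m - 1 - 1)"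
      by (rule sum_power_bound[OF bj2]) (use x R in auto)
  qed
  also have "\<dots> = B * Y ^ (m - 1 - 1)" unfolding B_def by (simp add: algebra_simps power2_eq_square power3_eq_cube)
  finally show "norm (Q2 m a lam (of_real x)) \<le> B * Y ^ (m - 1 - 1)" .
qed

text \<open>Pure homogeneity: the potential and its two derivatives have orders m, m - 1 and m - 2
  in \<open>Y\<close>, so both terms of \<open>phiB\<close> have order -m/2 - 2. The exponent is
  written so that its antiderivative is visible.\<close>

lemma phiB_bounds:
  assumes m: "m \<ge> 2" and Y: "Y \<ge> 1" and c: "c > 0" and B: "B \<ge> 0"
    and Q: "norm (Qf m a lam (of_real x)) \<ge> c\<^sup>2 * Y ^ m"
    and b1: "norm (Q1 m a lam (of_real x)) \<le> B * Y ^ (m - 1)" and b2: "norm (Q2 m a lam (of_real x)) \<le> B * Y ^ (m - 1 - 1)"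
  shows "norm (phiB m a lam x) \<le> (B / (4 * c ^ 3) + 5 * B\<^sup>2 / (16 * c ^ 5)) * Y powr (- (real m / 2 + 1) - 1)"
    and "norm (Q1 m a lam (of_real x) / wB m a lam x ^ 3) \<le> B / c ^ 3 * Y powr (- (real m / 2 + 1))"
proof -
  define v where "v = Y powr (real m / 2)"
  define w where "w = norm (wB m a lam x)"
  have v0: "v > 0" unfolding v_def using Y by simp
  have vv: "v\<^sup>2 = Y ^ m"
    unfolding v_def power2_eq_square using Y by (simp add: powr_realpow flip: powr_add)
  have w2: "w\<^sup>2 = norm (Qf m a lam (of_real x))"
    unfolding w_def wB_def norm_power[symmetric] by simp
  have "(c * v)\<^sup>2 \<le> w\<^sup>2" unfolding power_mult_distrib vv w2 by (rule Q)
  hence wv: "w \<ge> c * v" by (rule power2_le_imp_le) (simp add: w_def)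
  have cv: "c * v > 0" using c v0 by simp
  have Ym1: "Y ^ (m - 1) = v\<^sup>2 / Y" and Ym2: "Y ^ (m - 1 - 1) = v\<^sup>2 / Y\<^sup>2"
  proof -
    have "m = Suc (Suc (m - 1 - 1))" using m by simp
    hence e: "v\<^sup>2 = Y * (Y * Y ^ (m - 1 - 1))" unfolding vv by (metis power_Suc)
    have "m - 1 = Suc (m - 1 - 1)" using m by simp
    hence e': "Y ^ (m - 1) = Y * Y ^ (m - 1 - 1)" by (metis power_Suc)
    show "Y ^ (m - 1) = v\<^sup>2 / Y" "Y ^ (m - 1 - 1) = v\<^sup>2 / Y\<^sup>2" unfolding e e' using Y by (simp_all add: power2_eq_square)
  qed
  have p1: "Y powr (- (real m / 2 + 1)) = 1 / (Y * v)"
  proof -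
    have "Y powr (real m / 2 + 1) = v * Y" unfolding v_def powr_add using Y by simp
    thus ?thesis by (simp only: powr_minus_divide mult.commute)
  qed
  have p2: "Y powr (- (real m / 2 + 1) - 1) = 1 / (Y\<^sup>2 * v)"
  proof -
    have "Y powr (- (real m / 2 + 1) - 1) = Y powr (- (real m / 2 + 1)) / Y powr 1" by (rule powr_diff)
    thus ?thesis unfolding p1 using Y by (simp add: power2_eq_square)
  qed
  have t1: "norm (Q1 m a lam (of_real x) / wB m a lam x ^ 3) \<le> (B * Y ^ (m - 1)) / (c * v) ^ 3"
    unfolding norm_divide norm_power w_def[symmetric]
    using b1 wv cv B Y by (intro frac_le power_mono) auto
  also have "\<dots> = B / c ^ 3 * Y powr (- (real m / 2 + 1))"
    unfolding p1 Ym1 using v0 c Y by (simp add: field_simps power2_eq_square power3_eq_cube)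
  finally show "norm (Q1 m a lam (of_real x) / wB m a lam x ^ 3) \<le> B / c ^ 3 * Y powr (- (real m / 2 + 1))" .
  have "norm (phiB m a lam x) \<le> norm (Q2 m a lam (of_real x)) / (4 * w ^ 3) + 5 * norm (Q1 m a lam (of_real x)) ^ 2 / (16 * w ^ 5)"
    unfolding phiB_def w_def by (rule order_trans[OF norm_triangle_ineq4]) (simp add: norm_divide norm_mult norm_power)
  also have "\<dots> \<le> (B * Y ^ (m - 1 - 1)) / (4 * (c * v) ^ 3) + 5 * (B * Y ^ (m - 1)) ^ 2 / (16 * (c * v) ^ 5)"
    using b1 b2 wv cv c v0 B Y by (intro add_mono frac_le mult_left_mono power_mono mult_pos_pos zero_less_power) auto
  also have "(B * Y ^ (m - 1 - 1)) / (4 * (c * v) ^ 3) = B / (4 * c ^ 3) * (1 / (Y\<^sup>2 * v))"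
    unfolding Ym2 using v0 c Y by (simp add: field_simps power2_eq_square power3_eq_cube)
  also have "5 * (B * Y ^ (m - 1)) ^ 2 / (16 * (c * v) ^ 5) = 5 * B\<^sup>2 / (16 * c ^ 5) * (1 / (Y\<^sup>2 * v))"
    unfolding Ym1 using v0 c Y by (simp add: field_simps eval_nat_numeral)
  finally show "norm (phiB m a lam x) \<le> (B / (4 * c ^ 3) + 5 * B\<^sup>2 / (16 * c ^ 5)) * Y powr (- (real m / 2 + 1) - 1)"
    unfolding p2 by (simp add: algebra_simps)
qed

lemma one_plus_nonzero: "norm x < 1/2 \<Longrightarrow> 1 + x \<noteq> 0" for x :: complex
proof
  assume "norm x < 1/2" "1 + x = 0"
  moreover from this have "x = -1" by (metis add.commute eq_neg_iff_add_eq_0)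
  ultimately show False by simp
qed

lemma csqrt_exp: "\<bar>Im u\<bar> < pi \<Longrightarrow> csqrt (exp u) = exp (u / 2)"
  using csqrt_exp_Ln[of "exp u"] Ln_exp[of u] by (auto simp: abs_less_iff)

text \<open>Integrating the bound on \<open>phiB\<close> from 0 to infinity gives a multiple of
  \<open>l powr (- (m / 2 + 1))\<close>, and this is \<open>r powr (- \<rho>)\<close> for
  \<open>l = r powr (1 / m)\<close>. Replacing the fourth root of the potential at 0, which is
  \<open>lam + a m\<close>, by that of \<open>lam\<close> costs only O(1/r), and
  \<open>\<rho> \<le> 1\<close>.\<close>

lemma wkb_uniform:
  assumes m: "m \<ge> 3" and d: "0 < \<delta>" "\<delta> \<le> pi"
  defines "\<rho> \<equiv> 1/2 + 1 / real m"
  shows "\<exists>C \<Lambda>. \<forall>a \<theta> r y. (\<forall>j\<in>{1..m}. norm (a j) \<le> R) \<and> \<bar>\<theta>\<bar> \<le> pi - \<delta> \<and> r \<ge> \<Lambda> \<and>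
      is_sibuya_sol m a (of_real r * cis \<theta>) y \<longrightarrow>
     r \<ge> 1 \<and> (\<exists>E1 E2. norm E1 \<le> C * r powr (-\<rho>) \<and> norm E2 \<le> C * r powr (-\<rho>) \<and>
       y 0 = of_real (r powr (-1/4)) * cis (- \<theta> / 4) * exp (Lfun m a (of_real r * cis \<theta>) + E1) \<and>
       deriv y 0 = - (of_real (r powr (1/4)) * cis (\<theta> / 4) * exp (Lfun m a (of_real r * cis \<theta>) + E2)))"
proof -
  define R0 where "R0 = max R 0"
  define s0 where "s0 = cos ((pi - \<delta>) / 2)"
  have s0: "s0 > 0" unfolding s0_def using d by (intro cos_gt_zero_pi) auto
  define c where "c = sqrt (s0 / 2 / 2 ^ m)"
  have c: "c > 0" "c\<^sup>2 = s0 / 2 / 2 ^ m" unfolding c_def using s0 by auto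
  define B where "B = real m ^ 2 + real m ^ 3 * R0"
  have R0: "R0 \<ge> 0" "R \<le> R0" unfolding R0_def by auto
  have B: "B \<ge> 0" unfolding B_def using R0 by simp
  define C1 where "C1 = B / (4 * c ^ 3) + 5 * B\<^sup>2 / (16 * c ^ 5)"
  define C2 where "C2 = 2 * C1 + B / c ^ 3"
  have C1: "C1 \<ge> 0" unfolding C1_def using B c by simp
  have C12: "2 * C1 \<le> C2" unfolding C2_def using B c by simp
  define l0 where "l0 = max 1 (2 ^ (m + 1) * real m * R0 / s0)"
  \<comment> \<open>In turn: the lower bound on the potential applies; the relative errors stay
    below 1/2, so their logarithms are controlled; \<open>a m / lam\<close> is below 1/2; and the
    argument of \<open>1 + a m / lam\<close> cannot use up the margin
    \<open>\<delta>\<close>.\<close>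
  define \<Lambda> where "\<Lambda> = max (l0 ^ m) (max ((2 * C2 + 1) powr (1 / \<rho>)) (max (2 * R0 + 1) (2 * R0 / \<delta> + 1)))"
  define C where "C = 2 * C2 + R0"
  have rho: "\<rho> > 0" "\<rho> \<le> 1" unfolding \<rho>_def using m by (auto simp: field_simps)
  show ?thesis
  proof (rule exI[of _ C], rule exI[of _ \<Lambda>], intro allI impI, goal_cases)
    case (1 a \<theta> r y)
    hence aR: "\<And>j. j \<in> {1..m} \<Longrightarrow> norm (a j) \<le> R0" and th: "\<bar>\<theta>\<bar> \<le> pi - \<delta>" and rL: "r \<ge> \<Lambda>"
      and sib: "is_sibuya_sol m a (of_real r * cis \<theta>) y" using R0 by force+
    have r1: "r \<ge> 1" using rL R0 unfolding \<Lambda>_def by linarith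
    define lam where "lam = of_real r * cis \<theta>"
    define l where "l = r powr (1 / real m)"
    have lm: "l ^ m = r" unfolding l_def using r1 m by (simp add: powr_realpow[symmetric] powr_powr)
    have l00: "l0 \<ge> 1" unfolding l0_def by simp
    have ll0: "l \<ge> l0"
    proof -
      have "l0 ^ m \<le> l ^ m" unfolding lm using rL unfolding \<Lambda>_def by simp
      thus ?thesis using l00 m unfolding l_def by (intro power_le_imp_le_base[of l0 "m - 1"]) auto
    qed
    have l1: "l \<ge> 1" and l2: "l \<ge> 2 ^ (m + 1) * real m * R0 / cos ((pi - \<delta>) / 2)"
      using ll0 unfolding l0_def s0_def by auto
    have lr: "l powr (- (real m / 2 + 1)) = r powr (-\<rho>)"
    proof -
      have "1 / real m * (- (real m / 2 + 1)) = - \<rho>" unfolding \<rho>_def using m by (simp add: field_simps)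
      thus ?thesis unfolding l_def powr_powr by (simp only:)
    qed
    have Qlow: "norm (Qf m a lam (of_real x) + of_real s) \<ge> c\<^sup>2 * (x + l) ^ m" if "x \<ge> 0" "s \<ge> 0" for x s
      using Qf_lower_bound[OF _ aR R0(1) d th l1 l2 that] m unfolding lm c(2) s0_def lam_def by simp
    have pos: "c\<^sup>2 * (x + l) ^ m > 0" if "x \<ge> 0" for x using c l1 that by (intro mult_pos_pos zero_less_power) auto
    have np: "Qf m a lam (of_real x) \<notin> \<real>\<^sub>\<le>\<^sub>0" if "x \<ge> 0" for x
      by (rule Qf_not_nonpos[OF Qlow[OF that] pos[OF that]])
    have m1: "m \<ge> 1" "m \<ge> 2" using m by auto
    note qb = Q12_bounds[OF m1(1) aR R0(1), folded B_def]
    have pb: "norm (phiB m a lam x) \<le> C1 * (x + l) powr (- (real m / 2 + 1) - 1)"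
      "norm (Q1 m a lam (of_real x) / wB m a lam x ^ 3) \<le> B / c ^ 3 * (x + l) powr (- (real m / 2 + 1))" if "x \<ge> 0" for x
    proof -
      have x: "x \<le> x + l" "1 \<le> x + l" using that l1 by auto
      have q: "norm (Qf m a lam (of_real x)) \<ge> c\<^sup>2 * (x + l) ^ m" using Qlow[OF that, of 0] by simp
      show "norm (phiB m a lam x) \<le> C1 * (x + l) powr (- (real m / 2 + 1) - 1)"
      "norm (Q1 m a lam (of_real x) / wB m a lam x ^ 3) \<le> B / c ^ 3 * (x + l) powr (- (real m / 2 + 1))"
        unfolding C1_def by (rule phiB_bounds[OF m1(2) x(2) c(1) B q qb(1)[OF _ that x] qb(2)[OF _ that x]]; assumption)+
    qed
    define e where "e = - (real m / 2 + 1)"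
    have e: "e \<le> -1" unfolding e_def by simp
    define K where "K = (\<lambda>x. C1 / e * (x + l) powr e)"
    define k where "k = (\<lambda>x. C1 * (x + l) powr (e - 1))"
    have dK: "(K has_real_derivative k x) (at x)" if "x \<ge> 0" for x
      unfolding K_def k_def using that l1 e by (auto intro!: derivative_eq_intros simp: powr_diff)
    have phi: "norm (phiB m a lam x) \<le> k x" if "x \<ge> 0" for x
      using pb(1)[OF that] unfolding k_def e_def .
    define \<kappa> where "\<kappa> = C1 * r powr (-\<rho>)"
    have Kle: "K x - K 0 \<le> \<kappa>" if "x \<ge> 0" for x
    proof -
      have "K x \<le> 0" unfolding K_def using C1 e by (intro mult_nonpos_nonneg divide_nonneg_nonpos) auto
      moreover have "- K 0 = C1 / (- e) * r powr (-\<rho>)" unfolding K_def lr[folded e_def, symmetric] by simp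
      moreover have "C1 / (- e) \<le> C1 / 1" using C1 e by (intro divide_left_mono) auto
      ultimately show ?thesis unfolding \<kappa>_def using mult_right_mono[of "C1 / (- e)" C1 "r powr (-\<rho>)"] by simp
    qed
    have C20: "C2 \<ge> 0" using C12 C1 by simp
    have small: "C2 * r powr (-\<rho>) < 1/2"
    proof -
      have "(2 * C2 + 1) = ((2 * C2 + 1) powr (1 / \<rho>)) powr \<rho>" using C20 rho by (simp add: powr_powr)
      also have "\<dots> \<le> r powr \<rho>" using rL rho unfolding \<Lambda>_def by (intro powr_mono2) auto
      finally have "2 * C2 + 1 \<le> r powr \<rho>" .
      thus ?thesis using r1 by (simp add: powr_minus_divide divide_less_eq)
    qed
    have kap: "\<kappa> \<le> 1/2"
      using small mult_right_mono[OF C12, of "r powr (-\<rho>)"] C1 unfolding \<kappa>_def by simp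
    have lim0: "(\<lambda>n. Q1 m a lam (of_real (real n)) / wB m a lam (real n) ^ 3) \<longlonglongrightarrow> 0"
    proof (rule Lim_null_comparison)
      show "eventually (\<lambda>n. norm (Q1 m a lam (of_real (real n)) / wB m a lam (real n) ^ 3) \<le> B / c ^ 3 * (real n + l) powr e) sequentially"
        unfolding e_def by (intro always_eventually allI pb(2)) simp
      have "filterlim (\<lambda>n. l + real n) at_top sequentially"
        by (intro filterlim_tendsto_add_at_top[OF tendsto_const] filterlim_real_sequentially)
      hence "filterlim (\<lambda>n. real n + l) at_top sequentially" by (simp add: add.commute)
      hence "(\<lambda>n. (real n + l) powr e) \<longlonglongrightarrow> 0" using e by (intro tendsto_neg_powr) auto
      thus "(\<lambda>n. B / c ^ 3 * (real n + l) powr e) \<longlonglongrightarrow> 0" by (rule tendsto_mult_right_zero)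
    qed
    obtain e1 e2 where e1: "norm e1 \<le> 2 * \<kappa>" and e2: "norm e2 \<le> 2 * \<kappa> + norm (Q1 m a lam 0 / wB m a lam 0 ^ 3)"
      and y0: "y 0 = exp (Lfun m a lam) * (1 + e1) / csqrt (wB m a lam 0)"
      and y1: "deriv y 0 = - csqrt (wB m a lam 0) * exp (Lfun m a lam) * (1 + e2)"
      using wkb_real_axis[OF m sib[folded lam_def] np dK phi Kle kap lim0] by blast
    have e1': "norm e1 \<le> C2 * r powr (-\<rho>)"
      using e1 mult_right_mono[OF C12, of "r powr (-\<rho>)"] unfolding \<kappa>_def by simp
    have e2': "norm e2 \<le> C2 * r powr (-\<rho>)"
      using e2 pb(2)[of 0] unfolding \<kappa>_def C2_def add_0 lr by (simp add: algebra_simps)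
    define \<eta> where "\<eta> = a m / lam"
    have lam0: "lam \<noteq> 0" unfolding lam_def using r1 by auto
    have nlam: "norm lam = r" unfolding lam_def using r1 by (simp add: norm_mult)
    have eta: "norm \<eta> \<le> R0 / r" unfolding \<eta>_def norm_divide nlam using aR[of m] m r1 by (intro divide_right_mono) auto
    have "R0 / r < 1/2"
      using rL r1 R0 unfolding \<Lambda>_def by (simp add: divide_less_eq)
    hence eta1: "norm \<eta> < 1/2" using eta by linarith
    have "2 * (R0 / r) < \<delta>"
    proof -
      have "2 * R0 / \<delta> < r" using rL unfolding \<Lambda>_def by linarith
      thus ?thesis using d r1 by (simp add: divide_less_eq mult.commute)
    qed
    hence eta2: "2 * norm \<eta> < \<delta>" using eta by linarith
    define h where "h = Ln (1 + \<eta>)"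
    have h: "norm h \<le> 2 * norm \<eta>" unfolding h_def by (rule norm_Ln_le[OF eta1])
    have eh: "exp h = 1 + \<eta>" unfolding h_def using eta1 by (intro exp_Ln one_plus_nonzero)
    define u where "u = of_real (ln r) + \<i> * of_real \<theta> + h"
    have lamexp: "lam = exp (of_real (ln r) + \<i> * of_real \<theta>)"
      unfolding lam_def using r1 by (simp add: exp_add exp_of_real cis_conv_exp)
    have Q0: "Qf m a lam 0 = exp u"
    proof -
      have "Pfun m a 0 = (\<Sum>j=1..m. if j = m then a m else 0)"
        unfolding Pfun_def by (intro sum.cong) auto
      hence "Qf m a lam 0 = a m + lam" unfolding Qf_def using m by simp
      also have "\<dots> = lam * (1 + \<eta>)" unfolding \<eta>_def using lam0 by (simp add: field_simps)
      also have "\<dots> = exp u" unfolding u_def exp_add[of _ h] eh lamexp ..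
      finally show ?thesis .
    qed
    have Imu: "\<bar>Im u\<bar> < pi"
    proof -
      have "\<bar>Im h\<bar> < \<delta>" using abs_Im_le_cmod[of h] h eta2 by linarith
      thus ?thesis unfolding u_def using th by simp
    qed
    \<comment> \<open>As \<open>\<bar>Im u\<bar> < pi\<close>, each principal root simply halves the
      exponent, so the fourth root follows the argument \<open>\<theta>\<close> without a
      jump.\<close>
    have w0: "csqrt (wB m a lam 0) = exp (u / 4)"
      unfolding wB_def of_real_0 Q0 using csqrt_exp[OF Imu] csqrt_exp[of "u / 2"] Imu by simp
    define lq where "lq = of_real (r powr (1/4)) * cis (\<theta> / 4)"
    have lq: "lq = exp ((of_real (ln r) + \<i> * of_real \<theta>) / 4)"
      unfolding lq_def using r1 by (simp add: powr_def exp_add add_divide_distrib cis_conv_exp exp_of_real[symmetric])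
    have lqi: "of_real (r powr (-1/4)) * cis (- \<theta> / 4) = inverse lq"
      unfolding lq_def by (simp add: powr_minus cis_inverse inverse_mult_distrib)
    have u4: "exp (u / 4) = lq * exp (h / 4)" unfolding lq u_def by (simp add: add_divide_distrib exp_add[symmetric])
    have lnb: "norm (Ln (1 + e1)) \<le> 2 * norm e1" "norm (Ln (1 + e2)) \<le> 2 * norm e2"
      using e1' e2' small by (auto intro!: norm_Ln_le)
    have exl: "exp (Ln (1 + e1)) = 1 + e1" "exp (Ln (1 + e2)) = 1 + e2"
      using e1' e2' small by (auto intro!: exp_Ln one_plus_nonzero)
    have rr: "1 / r \<le> r powr (-\<rho>)"
    proof -
      have "r powr (-1) \<le> r powr (-\<rho>)" using r1 rho by (intro powr_mono) auto
      thus ?thesis using r1 by (simp add: powr_minus_divide)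
    qed
    have "norm (h / 4) = norm h / 4" by (simp add: norm_divide)
    also have "\<dots> \<le> R0 / r" using h eta norm_ge_zero[of \<eta>] by linarith
    also have "\<dots> \<le> R0 * r powr (-\<rho>)" using rr R0 mult_left_mono[OF rr R0(1)] by simp
    finally have h4: "norm (h / 4) \<le> R0 * r powr (-\<rho>)" .
    define E1 where "E1 = Ln (1 + e1) - h / 4"
    define E2 where "E2 = Ln (1 + e2) + h / 4"
    have E1: "norm E1 \<le> C * r powr (-\<rho>)"
      using norm_triangle_ineq4[of "Ln (1 + e1)" "h / 4"] lnb e1' h4 unfolding E1_def C_def by (simp add: algebra_simps)
    have E2: "norm E2 \<le> C * r powr (-\<rho>)"
      using norm_triangle_ineq[of "Ln (1 + e2)" "h / 4"] lnb e2' h4 unfolding E2_def C_def by (simp add: algebra_simps)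
    have f1: "y 0 = inverse lq * exp (Lfun m a lam + E1)"
    proof -
      have "exp (Lfun m a lam + E1) = exp (Lfun m a lam) * (1 + e1) / exp (h / 4)"
        unfolding E1_def exp_add exp_diff exl by simp
      thus ?thesis unfolding y0 w0 u4 by (simp only: divide_inverse inverse_mult_distrib mult_ac)
    qed
    have f2: "deriv y 0 = - (lq * exp (Lfun m a lam + E2))"
    proof -
      have "exp (Lfun m a lam + E2) = exp (Lfun m a lam) * (1 + e2) * exp (h / 4)"
        unfolding E2_def exp_add exl by simp
      thus ?thesis unfolding y1 w0 u4 by (simp only: mult_ac mult_minus_left mult_minus_right)
    qed
    show ?case
      using r1 E1 E2 f1 f2 unfolding lqi lq_def[symmetric] lam_def[symmetric] by blast
  qed
qed

section \<open>Connection formula\<close>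

lemma omega_pow_quarter: "omega_pow m ((of_nat m + 2) / 4) = \<i>"
proof -
  have "2 * p * \<i> * (M / 4) / M = \<i> * (p / 2)" if "M \<noteq> 0" for p M :: complex using that by simp
  hence "omega_pow m ((of_nat m + 2) / 4) = exp (\<i> * (of_real pi / 2))"
    unfolding omega_pow_def using of_nat_plus_2_nonzero[of m] by metis
  also have "\<dots> = cis (pi / 2)" by (simp add: cis_conv_exp)
  finally show ?thesis by simp
qed

text \<open>The quotient of the sum by \<open>2 * exp p\<close> is 1 plus a small number, whose
  logarithm is of the order of \<open>s\<close>. This keeps an error in exponential form under
  addition of two nearly equal terms.\<close>

lemma exp_add_exp:
  fixes p q :: complex
  assumes "norm p \<le> s" "norm q \<le> s" "s < 1/4"
  shows "\<exists>E. norm E \<le> 5 * s \<and> exp p + exp q = 2 * exp E"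
proof -
  define d where "d = q - p"
  have d: "norm d \<le> 2 * s" unfolding d_def using norm_triangle_ineq4[of q p] assms by simp
  define x where "x = (exp d - 1) / 2"
  have "norm (exp d - 1) \<le> 3 / 2 * norm d" by (rule norm_exp_bounds) (use d assms in simp)
  hence "norm (exp d - 1) \<le> 2 * norm d" using norm_ge_zero[of d] by linarith
  hence x: "norm x \<le> 2 * s" unfolding x_def using d by (simp add: norm_divide)
  hence x2: "norm x < 1/2" using assms by simp
  have "exp (Ln (1 + x)) = 1 + x" by (rule exp_Ln[OF one_plus_nonzero[OF x2]])
  moreover have "exp p + exp q = exp p * (2 * (1 + x))"
    unfolding x_def d_def exp_diff by (simp add: field_simps)
  ultimately have "exp p + exp q = 2 * exp (p + Ln (1 + x))" by (simp add: exp_add)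
  moreover have "norm (p + Ln (1 + x)) \<le> 5 * s"
    using norm_triangle_ineq[of p "Ln (1 + x)"] norm_Ln_le[OF x2] x assms(1) by simp
  ultimately show ?thesis by blast
qed

text \<open>The modulus \<open>r\<close> and the argument \<open>\<theta>\<close> are kept as
  separate parameters because \<open>\<theta>\<close> may exceed \<open>pi\<close>, and the quarter
  powers of \<open>lam\<close> refer to this argument and not to the principal one. The error terms
  become witnesses with a constant chosen before \<open>a\<close>, \<open>\<theta>\<close> and
  \<open>r\<close>.\<close>

theorem theorem5p1:
  fixes m :: nat
  assumes "m \<ge> 3"
  defines "\<rho> \<equiv> 1/2 + 1 / real m"
  shows "\<forall>R \<delta>. \<delta> > 0 \<longrightarrow> (\<exists>C \<Lambda>. \<forall>a \<theta> r.
     (\<forall>j\<in>{1..m}. norm (a j) \<le> R) \<and>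
     pi - 4 * pi / (real m + 2) + \<delta> \<le> \<theta> \<and> \<theta> \<le> pi + 4 * pi / (real m + 2) - \<delta> \<and>
     r \<ge> \<Lambda> \<longrightarrow>
     (let lam = of_real r * exp (\<i> * of_real \<theta>);
          lq = of_real (r powr (1/4)) * exp (\<i> * of_real (\<theta> / 4));
          lqi = of_real (r powr (-1/4)) * exp (- \<i> * of_real (\<theta> / 4));
          L1 = Lfun m (Gpow m (-1) a) (omega_pow m (-2) * lam);
          L2 = Lfun m (Gpow m 1 a) (omega_pow m (- of_nat m) * lam);
          w1 = omega_pow m (1/2 + mu m (Gpow m (-1) a));
          w2 = omega_pow m (1/2 + mu m a)
      in (\<exists>E. norm E \<le> C * r powr (-\<rho>) \<and>
            Wr m (-1) 1 a lam = 2 * \<i> * exp (L1 + L2 + E)) \<and>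
         (\<exists>E1 E2. norm E1 \<le> C * r powr (-\<rho>) \<and> norm E2 \<le> C * r powr (-\<rho>) \<and>
            sibuya m 0 a lam = w1 * lqi * exp (- L1 + E1) - \<i> * w2 * lqi * exp (- L2 + E2)) \<and>
         (\<exists>E1 E2. norm E1 \<le> C * r powr (-\<rho>) \<and> norm E2 \<le> C * r powr (-\<rho>) \<and>
            sibuya' m 0 a lam = w1 * lq * exp (- L1 + E1) + \<i> * w2 * lq * exp (- L2 + E2))))"
proof (intro allI impI, goal_cases)
  case (1 R \<delta>)
  hence del: "\<delta> > 0" .
  note m = \<open>m \<ge> 3\<close>
  define d where "d = min \<delta> pi"
  have d: "0 < d" "d \<le> pi" "d \<le> \<delta>" unfolding d_def using del by auto
  obtain C \<Lambda> where wkb: "\<And>a \<theta> r y. (\<forall>j\<in>{1..m}. norm (a j) \<le> R) \<Longrightarrow> \<bar>\<theta>\<bar> \<le> pi - d \<Longrightarrow> r \<ge> \<Lambda> \<Longrightarrow>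
      is_sibuya_sol m a (of_real r * cis \<theta>) y \<Longrightarrow>
     r \<ge> 1 \<and> (\<exists>E1 E2. norm E1 \<le> C * r powr (-\<rho>) \<and> norm E2 \<le> C * r powr (-\<rho>) \<and>
       y 0 = of_real (r powr (-1/4)) * cis (- \<theta> / 4) * exp (Lfun m a (of_real r * cis \<theta>) + E1) \<and>
       deriv y 0 = - (of_real (r powr (1/4)) * cis (\<theta> / 4) * exp (Lfun m a (of_real r * cis \<theta>) + E2)))"
    using wkb_uniform[OF m d(1,2), of R] unfolding \<rho>_def by metis
  have rho: "\<rho> > 0" unfolding \<rho>_def by (simp add: add_pos_nonneg)
  \<comment> \<open>Makes \<open>s\<close> below 1/8, so that the combined errors, at most
    \<open>2 * s\<close>, are admissible in \<open>exp_add_exp\<close>.\<close>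
  define \<Lambda>' where "\<Lambda>' = max \<Lambda> ((8 * \<bar>C\<bar> + 1) powr (1 / \<rho>))"
  show ?case
  \<comment> \<open>10 from the error of the Wronskian and 1 from that of a neighbouring solution at
    0.\<close>
  proof (rule exI[of _ "11 * \<bar>C\<bar>"], rule exI[of _ \<Lambda>'], intro allI impI, goal_cases)
    case asm: (1 a \<theta> r)
    define h where "h = pi / (real m + 2)"
    have h: "5 * h \<le> pi" unfolding h_def using m by (simp add: field_simps)
    have th: "pi - 4 * h + \<delta> \<le> \<theta>" "\<theta> \<le> pi + 4 * h - \<delta>" using asm unfolding h_def by auto
    have aR: "\<forall>j\<in>{1..m}. norm (Gpow m l a j) \<le> R" for l using asm by (simp add: norm_Gpow)
    have rL: "r \<ge> \<Lambda>" and rL': "(8 * \<bar>C\<bar> + 1) powr (1 / \<rho>) \<le> r" using asm unfolding \<Lambda>'_def by auto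
    define lam where "lam = of_real r * cis \<theta>"
    define b where "b = Gpow m (-1) a"
    define g where "g = Gpow m 1 a"
    \<comment> \<open>Arguments of the two rotated parameters, chosen within distance
      \<open>pi - d\<close> of 0; for the second this takes a full turn backwards, which matters as
      soon as quarter powers are formed.\<close>
    define \<theta>1 where "\<theta>1 = \<theta> - 4 * h"
    define \<theta>2 where "\<theta>2 = \<theta> - 2 * pi + 4 * h"
    have th12: "\<bar>\<theta>1\<bar> \<le> pi - d" "\<bar>\<theta>2\<bar> \<le> pi - d"
      unfolding \<theta>1_def \<theta>2_def using th d h by (auto simp: abs_le_iff)
    have o2: "omega_pow m 2 = cis (4 * h)" using omega_pow_real[of m 2] unfolding h_def by simp
    have o2m: "omega_pow m (-2) = cis (- (4 * h))" using omega_pow_real[of m "-2"] unfolding h_def by simp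
    have om: "omega_pow m (- of_nat m) = omega_pow m 2"
      using omega_pow_add[of m "- of_nat m" "of_nat m + 2"] omega_pow_full[of m] by simp
    have lam1: "omega_pow m (-2) * lam = of_real r * cis \<theta>1"
      unfolding o2m lam_def \<theta>1_def by (simp add: mult_ac cis_mult)
    have lam2: "omega_pow m 2 * lam = of_real r * cis \<theta>2"
    proof -
      have "cis \<theta>2 = cis (4 * h + \<theta>) * cis (- (2 * pi))" unfolding \<theta>2_def cis_mult by (simp add: algebra_simps)
      also have "cis (- (2 * pi)) = 1" by (metis cis_2pi cis_inverse inverse_1)
      finally show ?thesis unfolding o2 lam_def by (simp add: mult_ac cis_mult add.commute)
    qed
    define u where "u = (\<lambda>z. sibuya m z b (omega_pow m (-2) * lam))"
    define v where "v = (\<lambda>z. sibuya m z g (omega_pow m 2 * lam))"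
    define f where "f = (\<lambda>z. sibuya m z a lam)"
    have su: "is_sibuya_sol m b (omega_pow m (-2) * lam) u" unfolding u_def by (rule is_sibuya_sol_some[OF m])
    have sv: "is_sibuya_sol m g (omega_pow m 2 * lam) v" unfolding v_def by (rule is_sibuya_sol_some[OF m])
    have sf: "is_sibuya_sol m a lam f" unfolding f_def by (rule is_sibuya_sol_some[OF m])
    define L1 where "L1 = Lfun m b (omega_pow m (-2) * lam)"
    define L2 where "L2 = Lfun m g (omega_pow m 2 * lam)"
    define s where "s = \<bar>C\<bar> * r powr (-\<rho>)"
    have Cs: "C * r powr (-\<rho>) \<le> s" unfolding s_def by (intro mult_right_mono) auto
    note w1 = wkb[OF aR th12(1) rL su[unfolded b_def lam1], folded b_def]
    note w2 = wkb[OF aR th12(2) rL sv[unfolded g_def lam2], folded g_def]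
    have r1: "r \<ge> 1" using w1 by blast
    define lq where "lq = of_real (r powr (1/4)) * cis (\<theta> / 4)"
    have lq0: "lq \<noteq> 0" unfolding lq_def using r1 by auto
    have lqi: "of_real (r powr (-1/4)) * cis (- (\<theta> / 4)) = inverse lq"
      unfolding lq_def by (simp add: powr_minus cis_inverse inverse_mult_distrib)
    have c1: "cis (\<theta>1 / 4) = cis (\<theta> / 4) * omega_pow m (- (1/2))" "cis (- \<theta>1 / 4) = cis (- (\<theta> / 4)) * omega_pow m (1/2)"
    proof -
      have "omega_pow m (- (1/2)) = cis (- h)" "omega_pow m (1/2) = cis h"
        using omega_pow_real[of m "-(1/2)"] omega_pow_real[of m "1/2"] unfolding h_def by simp_all
      thus "cis (\<theta>1 / 4) = cis (\<theta> / 4) * omega_pow m (- (1/2))" "cis (- \<theta>1 / 4) = cis (- (\<theta> / 4)) * omega_pow m (1/2)"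
        unfolding \<theta>1_def by (simp_all add: cis_mult diff_divide_distrib)
    qed
    have c2: "cis (\<theta>2 / 4) = cis (\<theta> / 4) * omega_pow m (- (of_nat m / 4))" "cis (- \<theta>2 / 4) = cis (- (\<theta> / 4)) * omega_pow m (of_nat m / 4)"
    proof -
      have e: "- \<theta>2 / 4 = - (\<theta> / 4) + 2 * pi * (real m / 4) / (real m + 2)"
        unfolding \<theta>2_def h_def by (simp add: field_simps)
      have e': "\<theta>2 / 4 = \<theta> / 4 + 2 * pi * (- (real m / 4)) / (real m + 2)"
        unfolding \<theta>2_def h_def by (simp add: field_simps)
      show "cis (\<theta>2 / 4) = cis (\<theta> / 4) * omega_pow m (- (of_nat m / 4))"
        unfolding e' cis_mult[symmetric] using omega_pow_real[of m "- (real m / 4)"] by simp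
      show "cis (- \<theta>2 / 4) = cis (- (\<theta> / 4)) * omega_pow m (of_nat m / 4)"
        unfolding e cis_mult[symmetric] using omega_pow_real[of m "real m / 4"] by simp
    qed
    define p where "p = omega_pow m (1/2)"
    define q where "q = omega_pow m (of_nat m / 4)"
    have p0: "p \<noteq> 0" "q \<noteq> 0" unfolding p_def q_def by auto
    have pi1: "omega_pow m (- (1/2)) = inverse p" and qi1: "omega_pow m (- (of_nat m / 4)) = inverse q"
      unfolding p_def q_def by (rule omega_pow_minus)+
    have pp: "omega_pow m 1 = p * p" unfolding p_def by (simp flip: omega_pow_add)
    have ppi: "omega_pow m (-1) = inverse (p * p)" unfolding pp[symmetric] by (rule omega_pow_minus)
    \<comment> \<open>The two quarter powers differ by \<omega>^((m+2)/4), a right angle. All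
      factors \<open>\<i>\<close> in the final formulas originate here.\<close>
    have pq: "p * q = \<i>" unfolding p_def q_def omega_pow_add[symmetric]
      using omega_pow_quarter[of m] by (simp add: add_divide_distrib add.commute)
    obtain e1 e1' where e1: "norm e1 \<le> s" "norm e1' \<le> s"
      and u0: "u 0 = inverse lq * p * exp (L1 + e1)" and u1: "deriv u 0 = - (lq * inverse p * exp (L1 + e1'))"
    proof -
      from w1 obtain E1 E2 where *: "norm E1 \<le> C * r powr (-\<rho>)" "norm E2 \<le> C * r powr (-\<rho>)"
       "u 0 = of_real (r powr (-1/4)) * cis (- \<theta>1 / 4) * exp (L1 + E1)"
       "deriv u 0 = - (of_real (r powr (1/4)) * cis (\<theta>1 / 4) * exp (L1 + E2))"
        unfolding L1_def lam1 by blast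
      show ?thesis
      proof (rule that[of E1 E2])
        show "norm E1 \<le> s" "norm E2 \<le> s" using *(1,2) Cs by linarith+
        show "u 0 = inverse lq * p * exp (L1 + E1)" unfolding *(3) c1 lqi[symmetric] p_def by (simp only: mult_ac)
        show "deriv u 0 = - (lq * inverse p * exp (L1 + E2))" unfolding *(4) c1 pi1 lq_def by (simp only: mult_ac)
      qed
    qed
    obtain e2 e2' where e2: "norm e2 \<le> s" "norm e2' \<le> s"
      and v0: "v 0 = inverse lq * q * exp (L2 + e2)" and v1: "deriv v 0 = - (lq * inverse q * exp (L2 + e2'))"
    proof -
      from w2 obtain E1 E2 where *: "norm E1 \<le> C * r powr (-\<rho>)" "norm E2 \<le> C * r powr (-\<rho>)"
       "v 0 = of_real (r powr (-1/4)) * cis (- \<theta>2 / 4) * exp (L2 + E1)"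
       "deriv v 0 = - (of_real (r powr (1/4)) * cis (\<theta>2 / 4) * exp (L2 + E2))"
        unfolding L2_def lam2 by blast
      show ?thesis
      proof (rule that[of E1 E2])
        show "norm E1 \<le> s" "norm E2 \<le> s" using *(1,2) Cs by linarith+
        show "v 0 = inverse lq * q * exp (L2 + E1)" unfolding *(3) c2 lqi[symmetric] q_def by (simp only: mult_ac)
        show "deriv v 0 = - (lq * inverse q * exp (L2 + E2))" unfolding *(4) c2 qi1 lq_def by (simp only: mult_ac)
      qed
    qed
    have s8: "s < 1/8"
    proof -
      have "8 * \<bar>C\<bar> + 1 = ((8 * \<bar>C\<bar> + 1) powr (1 / \<rho>)) powr \<rho>" using rho by (simp add: powr_powr)
      also have "\<dots> \<le> r powr \<rho>" using rL' rho by (intro powr_mono2) auto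
      finally have "8 * \<bar>C\<bar> + 1 \<le> r powr \<rho>" .
      thus ?thesis unfolding s_def using r1 by (simp add: powr_minus_divide divide_less_eq)
    qed
    have n1: "norm (e1 + e2') \<le> 2 * s" using norm_triangle_ineq[of e1 e2'] e1 e2 by linarith
    have n2: "norm (e1' + e2) \<le> 2 * s" using norm_triangle_ineq[of e1' e2] e1 e2 by linarith
    obtain E where E: "norm E \<le> 5 * (2 * s)" and EE: "exp (e1 + e2') + exp (e1' + e2) = 2 * exp E"
      using exp_add_exp[OF n1 n2] s8 by auto
    have hu: "u holomorphic_on UNIV" and hv: "v holomorphic_on UNIV"
      using su sv unfolding is_sibuya_sol_def by auto
    \<comment> \<open>\<open>P\<close> and \<open>T\<close> are the derivatives at 0 of the
      solutions with indices -1 and 1, the root of unity being the inner derivative.\<close>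
    define P where "P = omega_pow m 1 * deriv u 0"
    define T where "T = omega_pow m (-1) * deriv v 0"
    have fm: "fk m (-1) z a lam = u (omega_pow m 1 * z)" for z unfolding fk_def u_def b_def by simp
    have fp: "fk m 1 z a lam = v (omega_pow m (-1) * z)" for z unfolding fk_def v_def g_def by simp
    have W: "Wr m (-1) 1 a lam = u 0 * T - P * v 0"
      unfolding Wr_def fm fp deriv_scale[OF hu] deriv_scale[OF hv] P_def T_def by simp
    have P: "P = - (lq * p * exp (L1 + e1'))" unfolding P_def u1 pp using p0 by (simp add: field_simps)
    have ip: "inverse (p * p) * inverse q = - \<i> * inverse p"
    proof -
      have "inverse (p * p) * inverse q = inverse (p * q) * inverse p" using p0 by (simp add: field_simps)
      thus ?thesis unfolding pq by simp
    qed
    have T: "T = \<i> * inverse p * lq * exp (L2 + e2')"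
    proof -
      have "T = - (inverse (p * p) * inverse q) * lq * exp (L2 + e2')" unfolding T_def v1 ppi by (simp add: mult_ac)
      thus ?thesis unfolding ip by simp
    qed
    \<comment> \<open>The two products equal \<open>\<i> * exp (L1 + L2)\<close> with opposite
      signs, up to their errors; the minus sign of the Wronskian turns their difference into a sum
      of nearly equal terms.\<close>
    have WW: "Wr m (-1) 1 a lam = 2 * \<i> * exp (L1 + L2 + E)"
    proof -
      have "u 0 * T = \<i> * exp (L1 + L2) * exp (e1 + e2')"
        unfolding u0 T using lq0 p0 by (simp add: exp_add field_simps)
      moreover have "P * v 0 = - (\<i> * exp (L1 + L2) * exp (e1' + e2))"
        unfolding v0 P pq[symmetric] using lq0 by (simp add: exp_add field_simps)
      ultimately have "Wr m (-1) 1 a lam = \<i> * exp (L1 + L2) * (exp (e1 + e2') + exp (e1' + e2))"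
        unfolding W by (simp add: algebra_simps)
      thus ?thesis unfolding EE by (simp add: exp_add)
    qed
    have W01: "f 0 * T - deriv f 0 * v 0 = 2 * omega_pow m (mu m a)"
      using sibuya_wronskian[OF m sf sv[unfolded g_def]] unfolding T_def .
    \<comment> \<open>The same Wronskian one index lower: \<open>Gpow m 1 b\<close> is
      \<open>a\<close>, and the passage from z to \<omega> z brings in the factor
      \<open>p * p\<close>.\<close>
    have W10: "u 0 * deriv f 0 - P * f 0 = 2 * (p * p) * omega_pow m (mu m b)"
    proof -
      have b1: "Gpow m 1 b = a" unfolding b_def Gpow_Gpow by simp
      have l1: "omega_pow m 2 * (omega_pow m (-2) * lam) = lam"
        using omega_pow_add[of m 2 "-2"] by simp
      have "u 0 * (omega_pow m (-1) * deriv f 0) - deriv u 0 * f 0 = 2 * omega_pow m (mu m b)"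
        by (rule sibuya_wronskian[OF m su, unfolded b1 l1, OF sf])
      moreover have "u 0 * deriv f 0 - (p * p * deriv u 0) * f 0
          = (p * p) * (u 0 * (inverse (p * p) * deriv f 0) - deriv u 0 * f 0)"
        using p0 by (simp add: right_diff_distrib) (simp add: field_simps)
      ultimately show ?thesis unfolding P_def pp ppi by simp
    qed
    define X where "X = exp (L1 + L2 + E)"
    have X0: "X \<noteq> 0" unfolding X_def by simp
    have WX: "u 0 * T - P * v 0 = 2 * \<i> * X" using W WW unfolding X_def by simp
    define A where "A = omega_pow m (mu m a)"
    define B where "B = omega_pow m (mu m b)"
    \<comment> \<open>The linear relation between three neighbouring solutions, taken at 0: the
      middle one times the Wronskian of the outer two.\<close>
    have f0: "f 0 * (2 * \<i> * X) = u 0 * (2 * A) + v 0 * (2 * (p * p) * B)"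
      unfolding WX[symmetric] A_def B_def W01[symmetric] W10[symmetric] by (simp add: algebra_simps)
    have f1: "deriv f 0 * (2 * \<i> * X) = P * (2 * A) + T * (2 * (p * p) * B)"
      unfolding WX[symmetric] A_def B_def W01[symmetric] W10[symmetric] by (simp add: algebra_simps)
    \<comment> \<open>Division by the Wronskian exchanges the roles of \<open>L1\<close> and
      \<open>L2\<close>: the neighbour carrying \<open>exp L2\<close> contributes the term with
      \<open>exp (- L1)\<close>, and conversely.\<close>
    have x1: "exp (L1 + e) = X * exp (- L2 + (e - E))" "exp (L2 + e) = X * exp (- L1 + (e - E))" for e
      unfolding X_def exp_add[symmetric] by (simp_all add: algebra_simps)
    have w: "omega_pow m (1/2 + mu m b) = p * B" "omega_pow m (1/2 + mu m a) = p * A"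
      unfolding p_def A_def B_def omega_pow_add by simp_all
    have canc: "y = z" if "k \<noteq> 0" "y * (2 * \<i> * k) = (2 * \<i> * k) * z" for y z k :: complex
      using that by (simp add: mult.commute[of y])
    have F0: "f 0 = p * B * inverse lq * exp (- L1 + (e2 - E)) - \<i> * (p * A) * inverse lq * exp (- L2 + (e1 - E))"
    proof -
      have "f 0 * (2 * \<i> * X) = (2 * \<i> * X) * (p * B * inverse lq * exp (- L1 + (e2 - E)) - \<i> * (p * A) * inverse lq * exp (- L2 + (e1 - E)))"
      proof -
        have t1: "v 0 * (2 * (p * p) * B) = (p * q) * (2 * X * p * B * inverse lq * exp (- L1 + (e2 - E)))"
          unfolding v0 x1 by (simp add: mult_ac)
        have t2: "u 0 * (2 * A) = 2 * X * p * A * inverse lq * exp (- L2 + (e1 - E))"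
          unfolding u0 x1 by (simp add: mult_ac)
        show ?thesis unfolding f0 t1 t2 pq by (simp add: algebra_simps)
      qed
      thus ?thesis by (rule canc[OF X0])
    qed
    have F1: "deriv f 0 = p * B * lq * exp (- L1 + (e2' - E)) + \<i> * (p * A) * lq * exp (- L2 + (e1' - E))"
    proof -
      have "deriv f 0 * (2 * \<i> * X) = (2 * \<i> * X) * (p * B * lq * exp (- L1 + (e2' - E)) + \<i> * (p * A) * lq * exp (- L2 + (e1' - E)))"
      proof -
        have t1: "T * (2 * (p * p) * B) = 2 * \<i> * X * p * B * lq * exp (- L1 + (e2' - E))"
          unfolding T x1 using p0 by (simp add: field_simps)
        have t2: "P * (2 * A) = - (2 * X * p * A * lq * exp (- L2 + (e1' - E)))"
          unfolding P x1 by (simp add: mult_ac)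
        show ?thesis unfolding f1 t1 t2 by (simp add: algebra_simps)
      qed
      thus ?thesis by (rule canc[OF X0])
    qed
    have ne: "norm (e - E) \<le> 11 * s" if "norm e \<le> s" for e
      using norm_triangle_ineq4[of e E] that E by linarith
    have s11: "11 * \<bar>C\<bar> * r powr (-\<rho>) = 11 * s" unfolding s_def by simp
    have s0: "s \<ge> 0" using norm_ge_zero[of e1] e1 by linarith
    have lamx: "of_real r * exp (\<i> * of_real \<theta>) = lam" unfolding lam_def cis_conv_exp ..
    have lqx: "of_real (r powr (1/4)) * exp (\<i> * of_real (\<theta> / 4)) = lq" unfolding lq_def cis_conv_exp ..
    have lqix: "of_real (r powr (-1/4)) * exp (- \<i> * of_real (\<theta> / 4)) = inverse lq"
      unfolding lqi[symmetric] cis_conv_exp by simp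
    have fx: "sibuya m 0 a lam = f 0" "sibuya' m 0 a lam = deriv f 0" unfolding f_def sibuya'_def by simp_all
    have "norm E \<le> 11 * s" using E s0 by linarith
    thus ?case
      unfolding Let_def lamx lqx lqix om b_def[symmetric] g_def[symmetric] L1_def[symmetric] L2_def[symmetric] w s11 fx
      using WW F0 F1 ne[OF e1(1)] ne[OF e1(2)] ne[OF e2(1)] ne[OF e2(2)] by blast
  qed
qed

end
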